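(* Let $\alpha,\beta,\gamma\in\Bbbk^n$ and $\mathcal H=\mathcal H(\alpha,\beta,\gamma)$. The following are equivalent: (1) $\beta_i\neq0$ for all $i\in Q_0$; (2) $\mathcal H$ is right noetherian; (2') $\mathcal H$ is left noetherian; (3) for every $i\in Q_0$, $\Bbbk[u_id_i,\,d_{i-1}u_{i-1}]$ is a polynomial ring in two variables; (4) $\mathcal H$ is a piecewise domain.
   Context: $\Bbbk$ is an algebraically closed field of characteristic zero. Fix $n\ge1$; indices mod $n$, $Q_0=\{0,\dots,n-1\}$. $Q$ is the quiver with vertices $Q_0$ and arrows $u_i:i\to i+1$, $d_i:i+1\to i$; paths are written left to right (so $u_id_i$ and $d_{i-1}u_{i-1}$ are loops at $i$), $e_i$ is the trivial path at $i$. $\mathcal H(\alpha,\beta,\gamma)$ is $\Bbbk Q$ modulo the relations $d_{i-1}u_{i-1}u_i=\alpha_iu_id_iu_i+\beta_iu_iu_{i+1}d_{i+1}+\gamma_iu_i$ and $d_id_{i-1}u_{i-1}=\alpha_id_iu_id_i+\beta_iu_{i+1}d_{i+1}d_i+\gamma_id_i$ for all $i\in Q_0$. $\Bbbk[u_id_i,d_{i-1}u_{i-1}]$ denotes the subalgebra of $e_i\mathcal He_i$ generated by $e_i$, $u_id_i$, $d_{i-1}u_{i-1}$. A ring with complete set of orthogonal idempotents $e_0,\dots,e_{n-1}$ is a piecewise domain if $ab=0$ implies $a=0$ or $b=0$ whenever $a\in e_iSe_k$, $b\in e_kSe_j$. *)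

theory Defs
  imports "HOL-Algebra.QuotRing"
begin

definition algebraically_closed :: "'k::field itself \<Rightarrow> bool" where
  "algebraically_closed _ \<longleftrightarrow>
     (\<forall>(m::nat) (c::nat \<Rightarrow> 'k). m \<ge> 1 \<longrightarrow> (\<exists>x. x ^ m + (\<Sum>j<m. c j * x ^ j) = 0))"

datatype arr = U nat | D nat

fun arr_idx :: "arr \<Rightarrow> nat" where
  "arr_idx (U i) = i" | "arr_idx (D i) = i"

fun src :: "nat \<Rightarrow> arr \<Rightarrow> nat" where
  "src n (U i) = i" | "src n (D i) = Suc i mod n"

fun tgt :: "nat \<Rightarrow> arr \<Rightarrow> nat" where
  "tgt n (U i) = Suc i mod n" | "tgt n (D i) = i"

text \<open>Paths are pairs (starting vertex, list of arrows), composed left to right.\<close>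
fun chain :: "nat \<Rightarrow> nat \<Rightarrow> arr list \<Rightarrow> bool" where
  "chain n v [] = True"
| "chain n v (a # as) = (src n a = v \<and> chain n (tgt n a) as)"

definition path_tgt :: "nat \<Rightarrow> nat \<Rightarrow> arr list \<Rightarrow> nat" where
  "path_tgt n v xs = foldl (\<lambda>_ a. tgt n a) v xs"

definition valid_path :: "nat \<Rightarrow> nat \<times> arr list \<Rightarrow> bool" where
  "valid_path n p = (fst p < n \<and> (\<forall>a\<in>set (snd p). arr_idx a < n) \<and> chain n (fst p) (snd p))"

type_synonym 'k kq = "nat \<times> arr list \<Rightarrow> 'k"

definition kQ :: "nat \<Rightarrow> ('k::field) kq ring" where
  "kQ n = \<lparr>carrier = {f. finite {p. f p \<noteq> 0} \<and> (\<forall>p. f p \<noteq> 0 \<longrightarrow> valid_path n p)},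
           mult = (\<lambda>f g (v, xs). \<Sum>k\<in>{0..length xs}.
                      f (v, take k xs) * g (path_tgt n v (take k xs), drop k xs)),
           one = (\<lambda>(v, xs). if v < n \<and> xs = [] then 1 else 0),
           zero = (\<lambda>_. 0),
           add = (\<lambda>f g p. f p + g p)\<rparr>"

definition pth :: "nat \<times> arr list \<Rightarrow> ('k::field) kq" where
  "pth q = (\<lambda>p. if p = q then 1 else 0)"

definition sc :: "'k::field \<Rightarrow> 'k kq \<Rightarrow> 'k kq" where
  "sc c f = (\<lambda>p. c * f p)"

definition pr :: "nat \<Rightarrow> nat \<Rightarrow> nat" where "pr n i = (i + n - 1) mod n"
definition nx :: "nat \<Rightarrow> nat \<Rightarrow> nat" where "nx n i = Suc i mod n"

definition rel1 :: "nat \<Rightarrow> (nat \<Rightarrow> 'k::field) \<Rightarrow> (nat \<Rightarrow> 'k) \<Rightarrow> (nat \<Rightarrow> 'k) \<Rightarrow> nat \<Rightarrow> 'k kq" where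
  "rel1 n \<alpha> \<beta> \<gamma> i =
     pth (i, [D (pr n i), U (pr n i), U i])
     - sc (\<alpha> i) (pth (i, [U i, D i, U i]))
     - sc (\<beta> i) (pth (i, [U i, U (nx n i), D (nx n i)]))
     - sc (\<gamma> i) (pth (i, [U i]))"

definition rel2 :: "nat \<Rightarrow> (nat \<Rightarrow> 'k::field) \<Rightarrow> (nat \<Rightarrow> 'k) \<Rightarrow> (nat \<Rightarrow> 'k) \<Rightarrow> nat \<Rightarrow> 'k kq" where
  "rel2 n \<alpha> \<beta> \<gamma> i =
     pth (nx n i, [D i, D (pr n i), U (pr n i)])
     - sc (\<alpha> i) (pth (nx n i, [D i, U i, D i]))
     - sc (\<beta> i) (pth (nx n i, [U (nx n i), D (nx n i), D i]))
     - sc (\<gamma> i) (pth (nx n i, [D i]))"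

definition rels :: "nat \<Rightarrow> (nat \<Rightarrow> 'k::field) \<Rightarrow> (nat \<Rightarrow> 'k) \<Rightarrow> (nat \<Rightarrow> 'k) \<Rightarrow> 'k kq set" where
  "rels n \<alpha> \<beta> \<gamma> = {rel1 n \<alpha> \<beta> \<gamma> i | i. i < n} \<union> {rel2 n \<alpha> \<beta> \<gamma> i | i. i < n}"

definition relI :: "nat \<Rightarrow> (nat \<Rightarrow> 'k::field) \<Rightarrow> (nat \<Rightarrow> 'k) \<Rightarrow> (nat \<Rightarrow> 'k) \<Rightarrow> 'k kq set" where
  "relI n \<alpha> \<beta> \<gamma> = genideal (kQ n) (rels n \<alpha> \<beta> \<gamma>)"

definition HH :: "nat \<Rightarrow> (nat \<Rightarrow> 'k::field) \<Rightarrow> (nat \<Rightarrow> 'k) \<Rightarrow> (nat \<Rightarrow> 'k) \<Rightarrow> 'k kq set ring" where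
  "HH n \<alpha> \<beta> \<gamma> = kQ n Quot relI n \<alpha> \<beta> \<gamma>"

definition cls :: "nat \<Rightarrow> (nat \<Rightarrow> 'k::field) \<Rightarrow> (nat \<Rightarrow> 'k) \<Rightarrow> (nat \<Rightarrow> 'k) \<Rightarrow> 'k kq \<Rightarrow> 'k kq set" where
  "cls n \<alpha> \<beta> \<gamma> f = a_r_coset (kQ n) (relI n \<alpha> \<beta> \<gamma>) f"

definition scH :: "nat \<Rightarrow> (nat \<Rightarrow> 'k::field) \<Rightarrow> (nat \<Rightarrow> 'k) \<Rightarrow> (nat \<Rightarrow> 'k) \<Rightarrow> 'k \<Rightarrow> 'k kq set \<Rightarrow> 'k kq set" where
  "scH n \<alpha> \<beta> \<gamma> c h = cls n \<alpha> \<beta> \<gamma> (sc c \<one>\<^bsub>kQ n\<^esub>) \<otimes>\<^bsub>HH n \<alpha> \<beta> \<gamma>\<^esub> h"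

definition eH where "eH n \<alpha> \<beta> \<gamma> i = cls n \<alpha> \<beta> \<gamma> (pth (i, []))"
definition udH where "udH n \<alpha> \<beta> \<gamma> i = cls n \<alpha> \<beta> \<gamma> (pth (i, [U i, D i]))"
definition duH where "duH n \<alpha> \<beta> \<gamma> i = cls n \<alpha> \<beta> \<gamma> (pth (i, [D (pr n i), U (pr n i)]))"

definition right_ideal :: "('a, 'b) ring_scheme \<Rightarrow> 'a set \<Rightarrow> bool" where
  "right_ideal R I \<longleftrightarrow> additive_subgroup I R \<and> (\<forall>a\<in>I. \<forall>x\<in>carrier R. a \<otimes>\<^bsub>R\<^esub> x \<in> I)"

definition left_ideal :: "('a, 'b) ring_scheme \<Rightarrow> 'a set \<Rightarrow> bool" where
  "left_ideal R I \<longleftrightarrow> additive_subgroup I R \<and> (\<forall>a\<in>I. \<forall>x\<in>carrier R. x \<otimes>\<^bsub>R\<^esub> a \<in> I)"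

definition right_noetherian :: "('a, 'b) ring_scheme \<Rightarrow> bool" where
  "right_noetherian R \<longleftrightarrow> (\<forall>C :: nat \<Rightarrow> 'a set.
     (\<forall>k. right_ideal R (C k)) \<and> (\<forall>k. C k \<subseteq> C (Suc k)) \<longrightarrow> (\<exists>N. \<forall>m\<ge>N. C m = C N))"

definition left_noetherian :: "('a, 'b) ring_scheme \<Rightarrow> bool" where
  "left_noetherian R \<longleftrightarrow> (\<forall>C :: nat \<Rightarrow> 'a set.
     (\<forall>k. left_ideal R (C k)) \<and> (\<forall>k. C k \<subseteq> C (Suc k)) \<longrightarrow> (\<exists>N. \<forall>m\<ge>N. C m = C N))"

definition piecewise_domain :: "('a, 'b) ring_scheme \<Rightarrow> nat \<Rightarrow> (nat \<Rightarrow> 'a) \<Rightarrow> bool" where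
  "piecewise_domain R n E \<longleftrightarrow>
     (\<forall>i<n. \<forall>j<n. \<forall>k<n. \<forall>a b.
        a \<in> {E i \<otimes>\<^bsub>R\<^esub> s \<otimes>\<^bsub>R\<^esub> E k | s. s \<in> carrier R} \<longrightarrow>
        b \<in> {E k \<otimes>\<^bsub>R\<^esub> s \<otimes>\<^bsub>R\<^esub> E j | s. s \<in> carrier R} \<longrightarrow>
        a \<otimes>\<^bsub>R\<^esub> b = \<zero>\<^bsub>R\<^esub> \<longrightarrow> a = \<zero>\<^bsub>R\<^esub> \<or> b = \<zero>\<^bsub>R\<^esub>)"

text \<open>The subalgebra k[x,y] of e_i H e_i generated by e_i, x, y is a polynomial ring in
  two variables (in x and y): x and y commute and the monomials e_i x^a y^b are
  linearly independent over k.\<close>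
definition poly_ring_two_vars ::
  "nat \<Rightarrow> (nat \<Rightarrow> 'k::field) \<Rightarrow> (nat \<Rightarrow> 'k) \<Rightarrow> (nat \<Rightarrow> 'k) \<Rightarrow> nat \<Rightarrow> bool" where
  "poly_ring_two_vars n \<alpha> \<beta> \<gamma> i \<longleftrightarrow>
     (let R = HH n \<alpha> \<beta> \<gamma>; e = eH n \<alpha> \<beta> \<gamma> i; x = udH n \<alpha> \<beta> \<gamma> i; y = duH n \<alpha> \<beta> \<gamma> i;
          mon = (\<lambda>(a::nat, b::nat). e \<otimes>\<^bsub>R\<^esub> (x [^]\<^bsub>R\<^esub> a) \<otimes>\<^bsub>R\<^esub> (y [^]\<^bsub>R\<^esub> b))
      in x \<otimes>\<^bsub>R\<^esub> y = y \<otimes>\<^bsub>R\<^esub> x \<and>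
         (\<forall>c :: nat \<times> nat \<Rightarrow> 'k. finite {m. c m \<noteq> 0} \<longrightarrow>
            finsum R (\<lambda>m. scH n \<alpha> \<beta> \<gamma> (c m) (mon m)) {m. c m \<noteq> 0} = \<zero>\<^bsub>R\<^esub> \<longrightarrow>
            (\<forall>m. c m = 0)))"

end

theory Submission
  imports Defs "HOL-Library.Function_Algebras" "HOL-Library.Product_Lexorder"
    "HOL-Computational_Algebra.Formal_Power_Series" "HOL-Computational_Algebra.Polynomial"
begin

text \<open>Write \<open>x\<^sub>i = u\<^sub>i d\<^sub>i\<close> and \<open>y\<^sub>i = d\<^sub>i\<^sub>-\<^sub>1 u\<^sub>i\<^sub>-\<^sub>1\<close>. If all \<open>\<beta>\<^sub>i\<close> are nonzero, arrows can be moved past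
  affine forms in \<open>x\<close> and \<open>y\<close> at the cost of an affine substitution. Choosing an eigenvector for the
  substitution once around the cycle makes it triangular, so \<open>H\<close> is spanned by monomials
  \<open>W\<^sup>i Z\<^sup>j u\<^sup>m\<close>, \<open>W\<^sup>i Z\<^sup>j d\<^sup>m\<close> whose leading terms multiply well; Dickson's lemma then gives the
  noetherian property. Weight modules whose weights solve the recurrence
  \<open>s\<^sub>m\<^sub>-\<^sub>1 = \<alpha> s\<^sub>m + \<beta> s\<^sub>m\<^sub>+\<^sub>1 + \<gamma>\<close> depend polynomially on two free parameters; they separate the monomials
  and reduce the piecewise domain property to that of polynomials in two variables.
  If \<open>\<beta>\<^sub>j = 0\<close>, then \<open>w = y\<^sub>j - \<alpha>\<^sub>j x\<^sub>j - \<gamma>\<^sub>j\<close> satisfies \<open>w u\<^sub>j = 0\<close>, hence \<open>w x\<^sub>j = 0\<close>, and the elements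
  \<open>u\<^sup>r w\<close> generate a strictly increasing chain of right ideals, as a highest weight module shows.
  Reversing paths exchanges left and right.\<close>

section \<open>The path algebra\<close>

text \<open>In the coordinates \<open>x\<close>, \<open>y\<close>, moving an arrow past a linear
  form mixes the two variables, so in general leading monomials are not preserved by multiplication.
  A lower variable that stays consistent has to span a line that returns to itself after one turn
  around the cycle. This is where algebraic closedness enters: the composite substitution is an
  invertible 2-by-2 matrix and needs an eigenvector. Leading monomials are characterised by
  existence, modulo spans that contain the relation ideal, so reduction works with spanning
  monomials; nonvanishing is detected separately, by evaluation on weight modules. These modules
  live on the integers, the unrolled cycle, so that already for n = 1 a vertex carries infinitely
  many positions, and two consecutive weights can be prescribed freely when all coefficients
  \<open>\<beta>\<close> are nonzero. Characteristic zero enters through the infinitude of the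
  field: polynomial identities in these two weights can be tested on values.\<close>

lemma vector_space_sc: "vector_space (sc :: 'k::field \<Rightarrow> 'k kq \<Rightarrow> 'k kq)"
  by unfold_locales (auto simp: sc_def fun_eq_iff algebra_simps)

interpretation kq: vector_space "sc :: 'k::field \<Rightarrow> 'k kq \<Rightarrow> 'k kq"
  by (rule vector_space_sc)

lemma sc_apply: "sc c f p = c * f p"
  by (simp add: sc_def)

text \<open>These rules would make the simplifier eta-expand elements of the path algebra.\<close>
declare plus_fun_apply [simp del] zero_fun_apply [simp del] minus_apply [simp del] uminus_apply [simp del]

lemmas pointwise = plus_fun_apply zero_fun_apply minus_apply uminus_apply sc_apply

lemma path_tgt_simps [simp]:
  "path_tgt n v [] = v"
  "path_tgt n v (a # as) = path_tgt n (tgt n a) as"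
  "path_tgt n v (xs @ ys) = path_tgt n (path_tgt n v xs) ys"
  by (auto simp: path_tgt_def)

lemma chain_append [simp]:
  "chain n v (xs @ ys) \<longleftrightarrow> chain n v xs \<and> chain n (path_tgt n v xs) ys"
  by (induction xs arbitrary: v) auto

lemma path_tgt_less: "valid_path n (v, xs) \<Longrightarrow> path_tgt n v xs < n"
proof (induction xs arbitrary: v)
  case (Cons a as)
  have "tgt n a < n"
    using Cons.prems by (cases a) (auto simp: valid_path_def)
  with Cons show ?case by (auto simp: valid_path_def)
qed (auto simp: valid_path_def)

lemma valid_path_append:
  "valid_path n (v, xs @ ys) \<longleftrightarrow> valid_path n (v, xs) \<and> valid_path n (path_tgt n v xs, ys)"
  using path_tgt_less[of n v xs] by (auto simp: valid_path_def)

abbreviation paths :: "nat \<Rightarrow> (nat \<times> arr list) set" where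
  "paths n \<equiv> {p. valid_path n p}"

lemma kQ_simps [simp]:
  "\<zero>\<^bsub>kQ n\<^esub> = 0" "f \<oplus>\<^bsub>kQ n\<^esub> g = f + g"
  by (auto simp: pointwise kQ_def fun_eq_iff)

lemma kQ_mult:
  "(f \<otimes>\<^bsub>kQ n\<^esub> g) (v, xs) =
    (\<Sum>k=0..length xs. f (v, take k xs) * g (path_tgt n v (take k xs), drop k xs))"
  by (simp add: kQ_def)

lemma kQ_one: "\<one>\<^bsub>kQ n\<^esub> = (\<lambda>(v, xs). if v < n \<and> xs = [] then 1 else 0)"
  by (simp add: kQ_def)

lemma kQ_carrier: "f \<in> carrier (kQ n) \<longleftrightarrow> finite {p. f p \<noteq> 0} \<and> (\<forall>p. f p \<noteq> 0 \<longrightarrow> valid_path n p)"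
  by (simp add: kQ_def)

text \<open>Both sides run over the ways to cut a path into three consecutive pieces; the exchange
  of summations is the one behind associativity of formal power series.\<close>

lemma kQ_assoc: "f \<otimes>\<^bsub>kQ n\<^esub> g \<otimes>\<^bsub>kQ n\<^esub> h = f \<otimes>\<^bsub>kQ n\<^esub> (g \<otimes>\<^bsub>kQ n\<^esub> h)"
proof (rule ext, clarify)
  fix v xs
  \<comment> \<open>\<open>i\<close>, \<open>j\<close>, \<open>l\<close> are the lengths of the
    three pieces, in the argument order of \<open>fps_mult_assoc_lemma\<close>.\<close>
  define F where "F i j l = f (v, take i xs) * g (path_tgt n v (take i xs), take j (drop i xs)) *
     h (path_tgt n v (take (i + j) xs), drop (i + j) xs)" for i j l :: nat
  have 1: "(f \<otimes>\<^bsub>kQ n\<^esub> g \<otimes>\<^bsub>kQ n\<^esub> h) (v, xs) =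
      (\<Sum>j=0..length xs. \<Sum>i=0..j. F i (j - i) (length xs - j))"
    unfolding kQ_mult sum_distrib_right
    by (intro sum.cong refl) (auto simp: F_def min_def drop_take)
  have 2: "(f \<otimes>\<^bsub>kQ n\<^esub> (g \<otimes>\<^bsub>kQ n\<^esub> h)) (v, xs) =
      (\<Sum>j=0..length xs. \<Sum>i=0..length xs - j. F j i (length xs - j - i))"
    unfolding kQ_mult sum_distrib_left
    by (intro sum.cong refl) (auto simp: F_def take_add add.commute mult.assoc)
  show "(f \<otimes>\<^bsub>kQ n\<^esub> g \<otimes>\<^bsub>kQ n\<^esub> h) (v, xs) = (f \<otimes>\<^bsub>kQ n\<^esub> (g \<otimes>\<^bsub>kQ n\<^esub> h)) (v, xs)"
    unfolding 1 2 by (rule fps_mult_assoc_lemma)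
qed

lemma kQ_distrib:
  "(f + g) \<otimes>\<^bsub>kQ n\<^esub> h = f \<otimes>\<^bsub>kQ n\<^esub> h + g \<otimes>\<^bsub>kQ n\<^esub> h"
  "h \<otimes>\<^bsub>kQ n\<^esub> (f + g) = h \<otimes>\<^bsub>kQ n\<^esub> f + h \<otimes>\<^bsub>kQ n\<^esub> g"
  by (auto simp: fun_eq_iff kQ_mult pointwise algebra_simps sum.distrib)

lemma kQ_distrib_diff:
  "(f - g) \<otimes>\<^bsub>kQ n\<^esub> h = f \<otimes>\<^bsub>kQ n\<^esub> h - g \<otimes>\<^bsub>kQ n\<^esub> h"
  "h \<otimes>\<^bsub>kQ n\<^esub> (f - g) = h \<otimes>\<^bsub>kQ n\<^esub> f - h \<otimes>\<^bsub>kQ n\<^esub> g"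
  by (auto simp: fun_eq_iff kQ_mult pointwise algebra_simps sum_subtractf)

lemma kQ_sc [simp]:
  "sc c f \<otimes>\<^bsub>kQ n\<^esub> h = sc c (f \<otimes>\<^bsub>kQ n\<^esub> h)"
  "h \<otimes>\<^bsub>kQ n\<^esub> sc c f = sc c (h \<otimes>\<^bsub>kQ n\<^esub> f)"
  by (auto simp: fun_eq_iff kQ_mult pointwise algebra_simps sum_distrib_left)

lemma kQ_zero_mult [simp]:
  "0 \<otimes>\<^bsub>kQ n\<^esub> h = 0" "h \<otimes>\<^bsub>kQ n\<^esub> 0 = 0"
  by (auto simp: fun_eq_iff kQ_mult pointwise)

lemma pth_mult:
  "pth (v, xs) \<otimes>\<^bsub>kQ n\<^esub> pth (w, ys) =
    (if w = path_tgt n v xs then pth (v, xs @ ys) else (0 :: 'k::field kq))"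
proof (rule ext, clarify)
  fix v' zs
  have "(pth (v, xs) \<otimes>\<^bsub>kQ n\<^esub> pth (w, ys) :: 'k kq) (v', zs) =
    (\<Sum>k=0..length zs. if k = length xs \<and> v' = v \<and> zs = xs @ ys \<and> w = path_tgt n v xs then 1 else 0)"
    unfolding kQ_mult
  proof (intro sum.cong refl)
    fix k assume "k \<in> {0..length zs}"
    show "pth (v, xs) (v', take k zs) * pth (w, ys) (path_tgt n v' (take k zs), drop k zs) =
      (if k = length xs \<and> v' = v \<and> zs = xs @ ys \<and> w = path_tgt n v xs then 1 else (0::'k))"
    proof (cases "take k zs = xs")
      case True
      moreover from True \<open>k \<in> _\<close> have "k = length xs" by auto
      moreover from True have "zs = xs @ drop k zs" by (metis append_take_drop_id)
      moreover from calculation have "zs = xs @ ys \<longleftrightarrow> drop k zs = ys" by (metis append_eq_conv_conj)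
      ultimately show ?thesis by (auto simp: pth_def)
    next
      case False
      then show ?thesis by (auto simp: pth_def)
    qed
  qed
  also have "\<dots> = (if w = path_tgt n v xs then pth (v, xs @ ys) else 0) (v', zs)"
    by (auto simp: pth_def pointwise)
  finally show "(pth (v, xs) \<otimes>\<^bsub>kQ n\<^esub> pth (w, ys)) (v', zs) =
    (if w = path_tgt n v xs then pth (v, xs @ ys) else (0 :: 'k kq)) (v', zs)" .
qed

text \<open>Replaces finitely supported functions by linear combinations of paths;
  \<open>kQ_induct\<close> then reduces identities in the path algebra to checks on single
  paths.\<close>

lemma kQ_carrier_span: "carrier (kQ n) = kq.span ((pth :: _ \<Rightarrow> 'k::field kq) ` paths n)"
proof (rule kq.span_unique[symmetric])
  show "pth ` paths n \<subseteq> carrier (kQ n)"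
    by (auto simp: kQ_carrier pth_def split: if_splits)
  show "kq.subspace (carrier (kQ n) :: 'k kq set)"
  proof (rule kq.subspaceI)
    fix f g :: "'k kq" assume "f \<in> carrier (kQ n)" "g \<in> carrier (kQ n)"
    then show "f + g \<in> carrier (kQ n)"
      unfolding kQ_carrier
      by (auto simp: pointwise intro: finite_subset[of _ "{p. f p \<noteq> 0} \<union> {p. g p \<noteq> 0}"])
         (metis add_0)
  qed (auto simp: kQ_carrier pointwise intro: rev_finite_subset)
next
  fix T :: "'k kq set" assume T: "pth ` paths n \<subseteq> T" "kq.subspace T"
  show "(carrier (kQ n) :: 'k kq set) \<subseteq> T"
  proof
    fix f :: "'k kq" assume f: "f \<in> carrier (kQ n)"
    then have fin: "finite {p. f p \<noteq> 0}" by (simp add: kQ_carrier)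
    have "sum g S p = (\<Sum>q\<in>S. g q p)" for g :: "nat \<times> arr list \<Rightarrow> 'k kq" and S p
      by (induction S rule: infinite_finite_induct) (auto simp: pointwise)
    then have "f = (\<Sum>p | f p \<noteq> 0. sc (f p) (pth p))"
      using fin by (simp add: fun_eq_iff pointwise pth_def if_distrib cong: if_cong)
    moreover have "(\<Sum>p | f p \<noteq> 0. sc (f p) (pth p)) \<in> T"
      using f T by (intro kq.subspace_sum kq.subspace_scale) (auto simp: kQ_carrier)
    ultimately show "f \<in> T" by simp
  qed
qed

lemma kQ_subspace: "kq.subspace (carrier (kQ n) :: 'k::field kq set)"
  unfolding kQ_carrier_span by simp

lemma pth_carrier [simp]: "valid_path n p \<Longrightarrow> pth p \<in> carrier (kQ n)"
  by (auto simp: kQ_carrier pth_def split: if_splits)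

lemmas kQ_closed_linear [simp, intro] =
  kq.subspace_0[OF kQ_subspace] kq.subspace_add[OF kQ_subspace] kq.subspace_diff[OF kQ_subspace]
  kq.subspace_neg[OF kQ_subspace] kq.subspace_scale[OF kQ_subspace] kq.subspace_sum[OF kQ_subspace]

lemma kQ_induct [consumes 1, case_names zero add sc path]:
  assumes "f \<in> carrier (kQ n)"
    and "P 0" "\<And>f g. f \<in> carrier (kQ n) \<Longrightarrow> g \<in> carrier (kQ n) \<Longrightarrow> P f \<Longrightarrow> P g \<Longrightarrow> P (f + g)"
    and "\<And>c f. f \<in> carrier (kQ n) \<Longrightarrow> P f \<Longrightarrow> P (sc c f)" "\<And>p. valid_path n p \<Longrightarrow> P (pth p)"
  shows "P (f :: 'k::field kq)"
proof -
  have "kq.subspace {f \<in> carrier (kQ n). P f}"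
    using assms(2-4) by (intro kq.subspaceI) auto
  then have "kq.span (pth ` paths n) \<subseteq> {f \<in> carrier (kQ n). P f}"
    using assms(5) by (intro kq.span_minimal) auto
  with assms(1) show ?thesis unfolding kQ_carrier_span by blast
qed

lemma kQ_mult_closed [simp, intro]:
  assumes "f \<in> carrier (kQ n)" "g \<in> carrier (kQ n)"
  shows "f \<otimes>\<^bsub>kQ n\<^esub> g \<in> carrier (kQ n)"
  using assms(1)
proof (induction f rule: kQ_induct)
  case (path p)
  from assms(2) show ?case
  proof (induction g rule: kQ_induct)
    case (path q)
    with \<open>valid_path n p\<close> show ?case
      by (cases p; cases q) (auto simp: pth_mult valid_path_append)
  qed (auto simp: kQ_distrib)
qed (auto simp: kQ_distrib)

lemma kQ_one_mult [simp]:
  fixes f :: "'k::field kq"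
  assumes "f \<in> carrier (kQ n)"
  shows "\<one>\<^bsub>kQ n\<^esub> \<otimes>\<^bsub>kQ n\<^esub> f = f" "f \<otimes>\<^bsub>kQ n\<^esub> \<one>\<^bsub>kQ n\<^esub> = f"
proof -
  have "\<one>\<^bsub>kQ n\<^esub> \<otimes>\<^bsub>kQ n\<^esub> f = f \<and> f \<otimes>\<^bsub>kQ n\<^esub> \<one>\<^bsub>kQ n\<^esub> = f"
    using assms
  proof (induction f rule: kQ_induct)
    case (path p)
    obtain v xs where p: "p = (v, xs)" by (cases p)
    have v: "v < n" "path_tgt n v xs < n"
      using path path_tgt_less unfolding p by (auto simp: valid_path_def)
    have "(\<one>\<^bsub>kQ n\<^esub> \<otimes>\<^bsub>kQ n\<^esub> pth p :: 'k kq) (w, zs) = pth p (w, zs)" for w zs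
    proof -
      have "(\<one>\<^bsub>kQ n\<^esub> \<otimes>\<^bsub>kQ n\<^esub> pth p :: 'k kq) (w, zs) =
         (\<Sum>k\<in>{0..length zs}. if k = 0 then pth p (w, zs) else 0)"
        unfolding kQ_mult using v by (intro sum.cong) (auto simp: kQ_one pth_def p)
      then show ?thesis by simp
    qed
    moreover have "(pth p \<otimes>\<^bsub>kQ n\<^esub> \<one>\<^bsub>kQ n\<^esub> :: 'k kq) (w, zs) = pth p (w, zs)" for w zs
    proof -
      have "(pth p \<otimes>\<^bsub>kQ n\<^esub> \<one>\<^bsub>kQ n\<^esub> :: 'k kq) (w, zs) =
         (\<Sum>k\<in>{0..length zs}. if k = length zs then pth p (w, zs) else 0)"
        unfolding kQ_mult using v by (intro sum.cong) (auto simp: kQ_one pth_def p)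
      then show ?thesis by simp
    qed
    ultimately show ?case by auto
  qed (auto simp: kQ_distrib)
  then show "\<one>\<^bsub>kQ n\<^esub> \<otimes>\<^bsub>kQ n\<^esub> f = f" "f \<otimes>\<^bsub>kQ n\<^esub> \<one>\<^bsub>kQ n\<^esub> = f" by auto
qed

lemma kQ_one_closed [simp]: "\<one>\<^bsub>kQ n\<^esub> \<in> carrier (kQ n :: 'k::field kq ring)"
proof -
  have "{p. \<one>\<^bsub>kQ n\<^esub> p \<noteq> (0 :: 'k)} \<subseteq> (\<lambda>v. (v, [])) ` {..<n}"
    by (auto simp: kQ_one split: if_splits)
  then show ?thesis
    by (auto simp: kQ_carrier kQ_one valid_path_def split: if_splits intro: finite_subset)
qed

lemma kQ_ring: "ring (kQ n :: 'k::field kq ring)"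
proof (rule ringI)
  show "abelian_group (kQ n :: 'k kq ring)"
  proof (rule abelian_groupI)
    fix f :: "'k kq" assume "f \<in> carrier (kQ n)"
    then show "\<exists>g\<in>carrier (kQ n). g \<oplus>\<^bsub>kQ n\<^esub> f = \<zero>\<^bsub>kQ n\<^esub>"
      by (intro bexI[of _ "- f"]) auto
  qed (auto simp: algebra_simps)
  show "monoid (kQ n :: 'k kq ring)"
    by (rule monoidI) (auto simp: kQ_assoc)
qed (auto simp: kQ_distrib)

section \<open>The quotient and its one-sided ideals\<close>

definition acc :: "('a set \<Rightarrow> bool) \<Rightarrow> bool" where
  "acc P \<longleftrightarrow> (\<forall>C :: nat \<Rightarrow> 'a set.
     (\<forall>k. P (C k)) \<and> (\<forall>k. C k \<subseteq> C (Suc k)) \<longrightarrow> (\<exists>N. \<forall>m\<ge>N. C m = C N))"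

lemma right_noetherian_acc: "right_noetherian R \<longleftrightarrow> acc (right_ideal R)"
  by (simp add: right_noetherian_def acc_def)

lemma left_noetherian_acc: "left_noetherian R \<longleftrightarrow> acc (left_ideal R)"
  by (simp add: left_noetherian_def acc_def)

text \<open>A monotone map that can be undone on the sets in question carries chains to chains and
  reflects stationarity. It serves twice: between \<open>H\<close> and the path algebra, and between
  left and right ideals.\<close>

lemma acc_transfer:
  assumes "acc P" "\<And>X. Q X \<Longrightarrow> P (F X)" "\<And>X Y. X \<subseteq> Y \<Longrightarrow> F X \<subseteq> F Y" "\<And>X. Q X \<Longrightarrow> G (F X) = X"
  shows "acc Q"
  unfolding acc_def
proof (intro allI impI; elim conjE)
  fix C assume C: "\<forall>k. Q (C k)" "\<forall>k. C k \<subseteq> C (Suc k)"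
  then obtain N where N: "\<And>m. m \<ge> N \<Longrightarrow> F (C m) = F (C N)"
    using assms(1)[unfolded acc_def, rule_format, of "\<lambda>k. F (C k)"] assms(2,3) by blast
  have "C m = C N" if "m \<ge> N" for m
    using arg_cong[OF N[OF that], of G] assms(4) C(1) by metis
  then show "\<exists>N. \<forall>m\<ge>N. C m = C N" by blast
qed

locale down_up =
  fixes n :: nat and \<alpha> \<beta> \<gamma> :: "nat \<Rightarrow> 'k::field"
  assumes n_pos: "n \<ge> 1"
begin

abbreviation A :: "'k kq set" where "A \<equiv> carrier (kQ n)"

abbreviation mul :: "'k kq \<Rightarrow> 'k kq \<Rightarrow> 'k kq" (infixl "\<star>" 70) where
  "f \<star> g \<equiv> f \<otimes>\<^bsub>kQ n\<^esub> g"

abbreviation I :: "'k kq set" where "I \<equiv> relI n \<alpha> \<beta> \<gamma>"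

abbreviation H :: "'k kq set ring" where "H \<equiv> HH n \<alpha> \<beta> \<gamma>"

abbreviation cl :: "'k kq \<Rightarrow> 'k kq set" where "cl \<equiv> cls n \<alpha> \<beta> \<gamma>"

text \<open>Vertices and arrows are indexed by integers, so that no wrap-around cases occur.\<close>
definition vx :: "int \<Rightarrow> nat" where "vx k = nat (k mod int n)"

definition e :: "int \<Rightarrow> 'k kq" where "e k = pth (vx k, [])"
definition u :: "int \<Rightarrow> 'k kq" where "u k = pth (vx k, [U (vx k)])"
definition d :: "int \<Rightarrow> 'k kq" where "d k = pth (vx (k + 1), [D (vx k)])"
definition x :: "int \<Rightarrow> 'k kq" where "x k = u k \<star> d k"
definition y :: "int \<Rightarrow> 'k kq" where "y k = d (k - 1) \<star> u (k - 1)"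

abbreviation a :: "int \<Rightarrow> 'k" where "a k \<equiv> \<alpha> (vx k)"
abbreviation b :: "int \<Rightarrow> 'k" where "b k \<equiv> \<beta> (vx k)"
abbreviation c :: "int \<Rightarrow> 'k" where "c k \<equiv> \<gamma> (vx k)"

lemma vx_less [simp]: "vx k < n"
  using n_pos by (simp add: vx_def nat_less_iff)

lemma vx_eq_iff: "vx k = vx l \<longleftrightarrow> k mod int n = l mod int n"
  using n_pos by (simp add: vx_def nat_eq_iff)

lemma vx_eq_add: "vx k = vx l \<Longrightarrow> vx (k + m) = vx (l + m)"
  unfolding vx_eq_iff by (metis mod_add_left_eq)

lemma vx_eq_add_iff: "vx (k + m) = vx (l + m) \<longleftrightarrow> vx k = vx l"
  using vx_eq_add[of k l m] vx_eq_add[of "k + m" "l + m" "- m"] by auto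

lemma vx_of_nat [simp]: "i < n \<Longrightarrow> vx (int i) = i"
  by (simp add: vx_def)

lemma Suc_vx: "Suc (vx k) mod n = vx (k + 1)"
proof -
  have "int (Suc (vx k) mod n) = (k mod int n + 1) mod int n"
    using n_pos by (simp add: vx_def zmod_int add.commute)
  also have "\<dots> = int (vx (k + 1))"
    using n_pos by (simp add: vx_def mod_simps)
  finally show ?thesis by simp
qed

lemma nx_vx: "nx n (vx k) = vx (k + 1)"
  by (simp add: nx_def Suc_vx)

lemma pr_vx: "pr n (vx k) = vx (k - 1)"
proof -
  have "int (pr n (vx k)) = (k mod int n + int n - 1) mod int n"
    using n_pos by (simp add: pr_def vx_def zmod_int of_nat_diff)
  also have "\<dots> = (k mod int n - 1 + int n) mod int n"
    by (simp add: algebra_simps)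
  also have "\<dots> = int (vx (k - 1))"
    using n_pos by (simp add: vx_def mod_simps)
  finally show ?thesis by simp
qed

lemma euds_closed [simp]: "e k \<in> A" "u k \<in> A" "d k \<in> A" "x k \<in> A" "y k \<in> A"
  by (auto simp: e_def u_def d_def x_def y_def valid_path_def Suc_vx)

lemma e_mult_e: "e k \<star> e l = (if vx k = vx l then e k else 0)"
  by (auto simp: e_def pth_mult)

lemma e_mult [simp]:
  "e k \<star> u k = u k" "u k \<star> e (k + 1) = u k" "e (k + 1) \<star> d k = d k" "d k \<star> e k = d k"
  by (auto simp: e_def u_def d_def pth_mult Suc_vx)

lemma e_mult' [simp]: "e k \<star> d (k - 1) = d (k - 1)" "u (k - 1) \<star> e k = u (k - 1)"
  using e_mult(3)[of "k - 1"] e_mult(2)[of "k - 1"] by (simp_all del: e_mult)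

lemma euds_cong:
  assumes "vx k = vx l"
  shows "e k = e l" "u k = u l" "d k = d l" "x k = x l" "y k = y l"
  using assms vx_eq_add[OF assms, of "1"] vx_eq_add[OF assms, of "-1"]
  by (auto simp: e_def u_def d_def x_def y_def)

lemma e_x [simp]: "e k \<star> x k = x k" "x k \<star> e k = x k"
  by (simp add: x_def flip: kQ_assoc) (simp add: x_def kQ_assoc)

lemma e_y [simp]: "e k \<star> y k = y k" "y k \<star> e k = y k"
  by (simp add: y_def flip: kQ_assoc) (simp add: y_def kQ_assoc)

definition r1 :: "int \<Rightarrow> 'k kq" where
  "r1 k = d (k - 1) \<star> u (k - 1) \<star> u k - sc (a k) (u k \<star> d k \<star> u k)
    - sc (b k) (u k \<star> u (k + 1) \<star> d (k + 1)) - sc (c k) (u k)"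

definition r2 :: "int \<Rightarrow> 'k kq" where
  "r2 k = d k \<star> d (k - 1) \<star> u (k - 1) - sc (a k) (d k \<star> u k \<star> d k)
    - sc (b k) (u (k + 1) \<star> d (k + 1) \<star> d k) - sc (c k) (d k)"

lemma r1_eq: "r1 k = rel1 n \<alpha> \<beta> \<gamma> (vx k)"
  by (simp add: r1_def rel1_def u_def d_def pth_mult Suc_vx nx_vx pr_vx)

lemma r2_eq: "r2 k = rel2 n \<alpha> \<beta> \<gamma> (vx k)"
  by (simp add: r2_def rel2_def u_def d_def pth_mult Suc_vx nx_vx pr_vx)

lemma rels_eq: "rels n \<alpha> \<beta> \<gamma> = range r1 \<union> range r2"
proof -
  have "range vx = {..<n}"
    by (auto simp: image_iff) (metis vx_of_nat)
  then have "range r1 = rel1 n \<alpha> \<beta> \<gamma> ` {..<n}" "range r2 = rel2 n \<alpha> \<beta> \<gamma> ` {..<n}"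
    by (simp_all add: r1_eq [abs_def] r2_eq [abs_def] image_image flip: image_image[of _ vx])
  then show ?thesis
    unfolding rels_def by blast
qed

lemma r_closed [simp]: "r1 k \<in> A" "r2 k \<in> A"
  by (auto simp: r1_def r2_def)

lemma ideal_I: "ideal I (kQ n)"
  unfolding relI_def rels_eq by (intro ring.genideal_ideal kQ_ring) auto

interpretation I: ideal I "kQ n" by (rule ideal_I)

lemma r_in_I: "r1 k \<in> I" "r2 k \<in> I"
proof -
  have "rels n \<alpha> \<beta> \<gamma> \<subseteq> I"
    unfolding relI_def by (intro ring.genideal_self kQ_ring) (auto simp: rels_eq)
  then show "r1 k \<in> I" "r2 k \<in> I" by (auto simp: rels_eq)
qed

lemma I_closed: "f \<in> I \<Longrightarrow> f \<in> A"
  by (rule I.Icarr)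

lemma I_mult: "f \<in> I \<Longrightarrow> g \<in> A \<Longrightarrow> f \<star> g \<in> I" "f \<in> I \<Longrightarrow> g \<in> A \<Longrightarrow> g \<star> f \<in> I"
  by (auto intro: I.I_r_closed I.I_l_closed)

text \<open>Multiplying by a scalar multiple of the identity is scaling, so ideals, although defined
  without scalars, are open to linear algebra.\<close>

lemma subspace_right_mult:
  assumes "additive_subgroup J (kQ n)" "\<And>f g. f \<in> J \<Longrightarrow> g \<in> A \<Longrightarrow> f \<star> g \<in> J"
  shows "kq.subspace J"
proof -
  interpret J: additive_subgroup J "kQ n" by fact
  show ?thesis
  proof (rule kq.subspaceI)
    fix k f assume f: "f \<in> J"
    then have "f \<star> sc k \<one>\<^bsub>kQ n\<^esub> = sc k f" using J.a_Hcarr[of f] by simp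
    with assms(2)[OF f, of "sc k \<one>\<^bsub>kQ n\<^esub>"] show "sc k f \<in> J" by auto
  qed (use J.zero_closed J.a_closed in auto)
qed

lemma subspace_left_mult:
  assumes "additive_subgroup J (kQ n)" "\<And>f g. f \<in> J \<Longrightarrow> g \<in> A \<Longrightarrow> g \<star> f \<in> J"
  shows "kq.subspace J"
proof -
  interpret J: additive_subgroup J "kQ n" by fact
  show ?thesis
  proof (rule kq.subspaceI)
    fix k f assume f: "f \<in> J"
    then have "sc k \<one>\<^bsub>kQ n\<^esub> \<star> f = sc k f" using J.a_Hcarr[of f] by simp
    with assms(2)[OF f, of "sc k \<one>\<^bsub>kQ n\<^esub>"] show "sc k f \<in> J" by auto
  qed (use J.zero_closed J.a_closed in auto)
qed

lemma additive_subgroup_subspace: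
  assumes "kq.subspace J" "J \<subseteq> A"
  shows "additive_subgroup J (kQ n)"
proof -
  have "\<ominus>\<^bsub>kQ n\<^esub> f = - f" if "f \<in> J" for f
    using assms(2) that by (intro I.minus_equality) auto
  then have "subgroup J (add_monoid (kQ n))"
    using assms kq.subspace_0 kq.subspace_add kq.subspace_neg
    by (intro subgroup.intro; (unfold a_inv_def[symmetric])?; auto)
  then show ?thesis by (rule additive_subgroup.intro)
qed

lemma I_subspace: "kq.subspace I"
  using I.additive_subgroup_axioms I_mult(1) by (rule subspace_right_mult)

lemmas I_linear [simp, intro] =
  kq.subspace_0[OF I_subspace] kq.subspace_add[OF I_subspace] kq.subspace_diff[OF I_subspace]
  kq.subspace_neg[OF I_subspace] kq.subspace_scale[OF I_subspace] kq.subspace_sum[OF I_subspace]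

text \<open>Serves as the induction principle for the relation ideal: reversal and the module
  actions are shown to respect it by this route.\<close>

lemma I_minimal:
  assumes "kq.subspace J" "J \<subseteq> A" "\<And>f g. f \<in> J \<Longrightarrow> g \<in> A \<Longrightarrow> f \<star> g \<in> J"
    and "\<And>f g. f \<in> J \<Longrightarrow> g \<in> A \<Longrightarrow> g \<star> f \<in> J" "\<And>k. r1 k \<in> J" "\<And>k. r2 k \<in> J"
  shows "I \<subseteq> J"
proof -
  have "ideal J (kQ n)"
    using additive_subgroup_subspace[OF assms(1,2)] kQ_ring assms(3,4)
    by (auto simp: ideal_def ideal_axioms_def)
  then show ?thesis
    unfolding relI_def rels_eq using assms(5,6)
    by (intro ring.genideal_minimal kQ_ring) auto
qed

text \<open>Calculations use representatives modulo the relation ideal instead of cosets, because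
  elements of the path algebra are functions with a pointwise linear structure.\<close>

definition cong_I :: "'k kq \<Rightarrow> 'k kq \<Rightarrow> bool" (infix "\<approx>" 50) where
  "f \<approx> g \<longleftrightarrow> f - g \<in> I"

lemma cg_refl [simp]: "f \<approx> f" by (simp add: cong_I_def)

lemma cg_sym: "f \<approx> g \<Longrightarrow> g \<approx> f"
  unfolding cong_I_def using I_linear(4)[of "f - g"] by simp

lemma cg_trans [trans]: "f \<approx> g \<Longrightarrow> g \<approx> h \<Longrightarrow> f \<approx> h"
  unfolding cong_I_def using I_linear(2)[of "f - g" "g - h"] by simp

lemma cg_add: "f \<approx> g \<Longrightarrow> f' \<approx> g' \<Longrightarrow> f + f' \<approx> g + g'"
  unfolding cong_I_def using I_linear(2)[of "f - g" "f' - g'"] by (simp add: algebra_simps)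

lemma cg_diff: "f \<approx> g \<Longrightarrow> f' \<approx> g' \<Longrightarrow> f - f' \<approx> g - g'"
  unfolding cong_I_def using I_linear(3)[of "f - g" "f' - g'"] by (simp add: algebra_simps)

lemma cg_sc: "f \<approx> g \<Longrightarrow> sc r f \<approx> sc r g"
  unfolding cong_I_def using I_linear(5)[of "f - g" r] by (simp add: kq.scale_right_diff_distrib)

lemma cg_mult_right: "f \<approx> g \<Longrightarrow> h \<in> A \<Longrightarrow> f \<star> h \<approx> g \<star> h"
  unfolding cong_I_def using I_mult(1)[of "f - g" h] by (simp add: kQ_distrib_diff)

lemma cg_mult_left: "f \<approx> g \<Longrightarrow> h \<in> A \<Longrightarrow> h \<star> f \<approx> h \<star> g"
  unfolding cong_I_def using I_mult(2)[of "f - g" h] by (simp add: kQ_distrib_diff)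

lemma cg_I_iff: "f \<approx> g \<Longrightarrow> f \<in> I \<longleftrightarrow> g \<in> I"
  unfolding cong_I_def using I_linear(2)[of "f - g" g] I_linear(3)[of f "f - g"] by auto

lemma carrier_H: "carrier H = cl ` A"
  by (auto simp: HH_def FactRing_simps cls_def a_r_coset_def)

lemma cl_closed [simp]: "f \<in> A \<Longrightarrow> cl f \<in> carrier H"
  by (simp add: carrier_H)

lemma H_ring: "ring H"
  unfolding HH_def by (rule I.quotient_is_ring)

lemma cl_mult [simp]: "f \<in> A \<Longrightarrow> g \<in> A \<Longrightarrow> cl f \<otimes>\<^bsub>H\<^esub> cl g = cl (f \<star> g)"
  by (simp add: HH_def FactRing_def cls_def I.rcoset_mult_add)

lemma cl_add [simp]: "f \<in> A \<Longrightarrow> g \<in> A \<Longrightarrow> cl f \<oplus>\<^bsub>H\<^esub> cl g = cl (f + g)"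
  using I.a_rcos_sum[of f g] by (simp add: HH_def FactRing_def cls_def)

lemma cl_eq_iff: assumes "f \<in> A" "g \<in> A" shows "cl f = cl g \<longleftrightarrow> f \<approx> g"
proof -
  have "f \<ominus>\<^bsub>kQ n\<^esub> g = f - g"
  proof -
    have "\<ominus>\<^bsub>kQ n\<^esub> g = - g"
      using assms by (intro I.minus_equality) auto
    then show ?thesis by (simp add: a_minus_def)
  qed
  then show ?thesis
    using I.quotient_eq_iff_same_a_r_cos[OF ideal_I assms]
    by (simp add: cls_def cong_I_def)
qed

lemma H_zero: "\<zero>\<^bsub>H\<^esub> = cl 0"
  using I.a_rcos_const[of 0] by (simp add: HH_def FactRing_def cls_def)

lemma H_one: "\<one>\<^bsub>H\<^esub> = cl \<one>\<^bsub>kQ n\<^esub>"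
  by (simp add: HH_def FactRing_def cls_def)

lemma cl_eq_0_iff: "f \<in> A \<Longrightarrow> cl f = \<zero>\<^bsub>H\<^esub> \<longleftrightarrow> f \<in> I"
  by (simp add: H_zero cl_eq_iff cong_I_def)

lemma cl_sc: "f \<in> A \<Longrightarrow> scH n \<alpha> \<beta> \<gamma> r (cl f) = cl (sc r f)"
  by (simp add: scH_def)

lemma cl_sum:
  assumes "\<And>i. i \<in> S \<Longrightarrow> F i \<in> A" "finite S"
  shows "finsum H (\<lambda>i. cl (F i)) S = cl (sum F S)"
proof -
  interpret H: ring H by (rule H_ring)
  show ?thesis using assms(2,1)
  proof (induction S)
    case (insert i S)
    then have "F i \<in> A" "sum F S \<in> A" "(\<lambda>i. cl (F i)) \<in> S \<rightarrow> carrier H" by auto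
    with insert show ?case by (subst H.finsum_insert) auto
  qed (simp add: H_zero)
qed

text \<open>One-sided ideals of the path algebra containing \<open>I\<close> correspond to those of \<open>H\<close>.\<close>
definition rid :: "'k kq set \<Rightarrow> bool" where
  "rid J \<longleftrightarrow> kq.subspace J \<and> I \<subseteq> J \<and> J \<subseteq> A \<and> (\<forall>f\<in>J. \<forall>g\<in>A. f \<star> g \<in> J)"

definition lid :: "'k kq set \<Rightarrow> bool" where
  "lid J \<longleftrightarrow> kq.subspace J \<and> I \<subseteq> J \<and> J \<subseteq> A \<and> (\<forall>f\<in>J. \<forall>g\<in>A. g \<star> f \<in> J)"

lemma additive_subgroup_H:
  assumes "kq.subspace J" "I \<subseteq> J" "J \<subseteq> A"
  shows "additive_subgroup (cl ` J) H"
proof -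
  interpret H: ring H by (rule H_ring)
  have neg: "\<ominus>\<^bsub>H\<^esub> cl f = cl (- f)" if "f \<in> J" for f
    using assms(3) that by (intro H.minus_equality) (auto simp: H_zero)
  have add: "cl f \<oplus>\<^bsub>H\<^esub> cl g = cl (f + g)" if "f \<in> J" "g \<in> J" for f g
    using assms(3) that by (intro cl_add) auto
  have "subgroup (cl ` J) (add_monoid H)"
    using assms kq.subspace_0 kq.subspace_add kq.subspace_neg
    by (intro subgroup.intro; (unfold a_inv_def[symmetric])?;
        auto simp: neg add H_zero intro!: imageI)
  then show ?thesis by (rule additive_subgroup.intro)
qed

lemma additive_subgroup_preimage:
  assumes "additive_subgroup X H"
  shows "additive_subgroup {f \<in> A. cl f \<in> X} (kQ n)" "I \<subseteq> {f \<in> A. cl f \<in> X}"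
proof -
  interpret H: ring H by (rule H_ring)
  interpret X: additive_subgroup X H by fact
  have neg: "- f \<in> A \<and> cl (- f) \<in> X" if "f \<in> A" "cl f \<in> X" for f
  proof -
    have "\<ominus>\<^bsub>H\<^esub> cl f = cl (- f)"
      using that by (intro H.minus_equality) (auto simp: H_zero)
    then show ?thesis using X.a_inv_closed[OF that(2)] that by auto
  qed
  have minus: "\<ominus>\<^bsub>kQ n\<^esub> f = - f" if "f \<in> A" for f
    using that by (intro I.minus_equality) auto
  have add: "cl (f + g) \<in> X" if "f \<in> A" "g \<in> A" "cl f \<in> X" "cl g \<in> X" for f g
    using X.a_closed[OF that(3,4)] that by simp
  have "subgroup {f \<in> A. cl f \<in> X} (add_monoid (kQ n))"
    using neg X.zero_closed
    by (intro subgroup.intro; (unfold a_inv_def[symmetric])?; auto simp: minus add H_zero)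
  then show "additive_subgroup {f \<in> A. cl f \<in> X} (kQ n)" by (rule additive_subgroup.intro)
  show "I \<subseteq> {f \<in> A. cl f \<in> X}"
    using X.zero_closed cl_eq_0_iff[OF I_closed] I_closed by auto
qed

lemma cl_image_preimage: "X \<subseteq> carrier H \<Longrightarrow> cl ` {f \<in> A. cl f \<in> X} = X"
  by (auto simp: carrier_H)

lemma preimage_cl_image:
  assumes "kq.subspace J" "I \<subseteq> J" "J \<subseteq> A"
  shows "{f \<in> A. cl f \<in> cl ` J} = J"
proof -
  have "f \<in> J" if "f \<in> A" "g \<in> J" "cl f = cl g" for f g
  proof -
    have "f - g \<in> J" using that assms(2,3) cl_eq_iff[of f g] by (auto simp: cong_I_def)
    then have "f - g + g \<in> J" using that(2) assms(1) kq.subspace_add by blast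
    then show ?thesis by simp
  qed
  then show ?thesis using assms(3) by blast
qed

lemma right_noetherian_iff: "right_noetherian H \<longleftrightarrow> acc rid"
proof -
  have 1: "right_ideal H (cl ` J)" if "rid J" for J
    using that additive_subgroup_H[of J]
    by (auto simp: right_ideal_def rid_def carrier_H subset_iff)
  have 2: "rid {f \<in> A. cl f \<in> X}" if "right_ideal H X" for X
  proof -
    have sub: "additive_subgroup X H" using that by (auto simp: right_ideal_def)
    have m: "\<And>f g. f \<in> {f \<in> A. cl f \<in> X} \<Longrightarrow> g \<in> A \<Longrightarrow> f \<star> g \<in> {f \<in> A. cl f \<in> X}"
      using that by (force simp: right_ideal_def simp flip: cl_mult)
    show ?thesis
      unfolding rid_def
      using m subspace_right_mult[OF additive_subgroup_preimage(1)[OF sub] m]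
        additive_subgroup_preimage(2)[OF sub] by auto
  qed
  show ?thesis
    unfolding right_noetherian_acc
  proof
    assume "acc (right_ideal H)"
    then show "acc rid"
      by (rule acc_transfer[where F = "(`) cl" and G = "\<lambda>X. {f \<in> A. cl f \<in> X}"])
         (simp_all add: 1 image_mono, simp add: rid_def preimage_cl_image)
  next
    assume "acc rid"
    then show "acc (right_ideal H)"
      by (rule acc_transfer[where G = "(`) cl" and F = "\<lambda>X. {f \<in> A. cl f \<in> X}"])
         (auto simp: 2 right_ideal_def intro!: cl_image_preimage additive_subgroup.a_subset)
  qed
qed

lemma left_noetherian_iff: "left_noetherian H \<longleftrightarrow> acc lid"
proof -
  have 1: "left_ideal H (cl ` J)" if "lid J" for J
    using that additive_subgroup_H[of J]
    by (auto simp: left_ideal_def lid_def carrier_H subset_iff)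
  have 2: "lid {f \<in> A. cl f \<in> X}" if "left_ideal H X" for X
  proof -
    have sub: "additive_subgroup X H" using that by (auto simp: left_ideal_def)
    have m: "\<And>f g. f \<in> {f \<in> A. cl f \<in> X} \<Longrightarrow> g \<in> A \<Longrightarrow> g \<star> f \<in> {f \<in> A. cl f \<in> X}"
      using that by (force simp: left_ideal_def simp flip: cl_mult)
    show ?thesis
      unfolding lid_def
      using m subspace_left_mult[OF additive_subgroup_preimage(1)[OF sub] m]
        additive_subgroup_preimage(2)[OF sub] by auto
  qed
  show ?thesis
    unfolding left_noetherian_acc
  proof
    assume "acc (left_ideal H)"
    then show "acc lid"
      by (rule acc_transfer[where F = "(`) cl" and G = "\<lambda>X. {f \<in> A. cl f \<in> X}"])
         (simp_all add: 1 image_mono, simp add: lid_def preimage_cl_image)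
  next
    assume "acc lid"
    then show "acc (left_ideal H)"
      by (rule acc_transfer[where G = "(`) cl" and F = "\<lambda>X. {f \<in> A. cl f \<in> X}"])
         (auto simp: 2 left_ideal_def intro!: cl_image_preimage additive_subgroup.a_subset)
  qed
qed

end

section \<open>Path reversal\<close>

fun sw :: "arr \<Rightarrow> arr" where
  "sw (U i) = D i" | "sw (D i) = U i"

lemma sw_simps [simp]:
  "sw (sw z) = z" "src n (sw z) = tgt n z" "tgt n (sw z) = src n z" "arr_idx (sw z) = arr_idx z"
  by (cases z; simp)+

definition rpath :: "nat \<Rightarrow> nat \<times> arr list \<Rightarrow> nat \<times> arr list" where
  "rpath n = (\<lambda>(v, xs). (path_tgt n v xs, rev (map sw xs)))"

lemma chain_rev:
  "chain n v xs \<Longrightarrow> chain n (path_tgt n v xs) (rev (map sw xs)) \<and>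
    path_tgt n (path_tgt n v xs) (rev (map sw xs)) = v"
  by (induction xs arbitrary: v) auto

lemma valid_rpath: "valid_path n \<pi> \<Longrightarrow> valid_path n (rpath n \<pi>)"
  using path_tgt_less[of n "fst \<pi>" "snd \<pi>"] chain_rev[of n "fst \<pi>" "snd \<pi>"]
  by (auto simp: valid_path_def rpath_def split: prod.splits)

lemma rpath_rpath: "valid_path n \<pi> \<Longrightarrow> rpath n (rpath n \<pi>) = \<pi>"
  using chain_rev[of n "fst \<pi>" "snd \<pi>"]
  by (auto simp: valid_path_def rpath_def rev_map comp_def split: prod.splits)

text \<open>The anti-automorphism that exchanges up and down arrows. The guard is there because
  \<open>rpath\<close> is an involution only on valid paths and can send an invalid path to a valid
  one.\<close>

definition rev_kQ :: "nat \<Rightarrow> 'k::field kq \<Rightarrow> 'k kq" where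
  "rev_kQ n f = (\<lambda>\<pi>. if valid_path n \<pi> then f (rpath n \<pi>) else 0)"

lemma rev_kQ_linear [simp]:
  "rev_kQ n 0 = 0" "rev_kQ n (f + g) = rev_kQ n f + rev_kQ n g"
  "rev_kQ n (f - g) = rev_kQ n f - rev_kQ n g" "rev_kQ n (sc r f) = sc r (rev_kQ n f)"
  by (auto simp: rev_kQ_def fun_eq_iff pointwise)

lemma rev_kQ_pth: "valid_path n \<pi> \<Longrightarrow> rev_kQ n (pth \<pi>) = pth (rpath n \<pi>)"
  by (auto simp: rev_kQ_def pth_def fun_eq_iff valid_rpath rpath_rpath)

lemma rev_kQ_closed [simp]: "f \<in> carrier (kQ n) \<Longrightarrow> rev_kQ n f \<in> carrier (kQ n)"
  by (induction f rule: kQ_induct) (auto simp: rev_kQ_pth valid_rpath)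

lemma rev_kQ_rev_kQ: "f \<in> carrier (kQ n) \<Longrightarrow> rev_kQ n (rev_kQ n f) = f"
  by (induction f rule: kQ_induct) (auto simp: rev_kQ_pth valid_rpath rpath_rpath)

lemma rev_kQ_mult:
  assumes "f \<in> carrier (kQ n)" "g \<in> carrier (kQ n)"
  shows "rev_kQ n (f \<otimes>\<^bsub>kQ n\<^esub> g) = rev_kQ n g \<otimes>\<^bsub>kQ n\<^esub> rev_kQ n f"
  using assms(1)
proof (induction f rule: kQ_induct)
  case (path p)
  from assms(2) show ?case
  proof (induction g rule: kQ_induct)
    case (path q)
    obtain v xs w ys where pq: "p = (v, xs)" "q = (w, ys)" by fastforce
    have *: "path_tgt n (path_tgt n w ys) (rev (map sw ys)) = w"
      using path chain_rev[of n w ys] by (auto simp: pq valid_path_def)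
    show ?case
    proof (cases "w = path_tgt n v xs")
      case True
      then show ?thesis
        using path \<open>valid_path n p\<close> *
        by (simp add: pq pth_mult rev_kQ_pth valid_path_append) (simp add: rpath_def pth_mult)
    next
      case False
      then show ?thesis
        using path \<open>valid_path n p\<close> *
        by (simp add: pq pth_mult rev_kQ_pth) (simp add: rpath_def pth_mult)
    qed
  qed (auto simp: kQ_distrib)
qed (auto simp: kQ_distrib)

context down_up
begin

lemma rev_kQ_uds: "rev_kQ n (u k) = d k" "rev_kQ n (d k) = u k"
proof -
  have "valid_path n (vx k, [U (vx k)])" "valid_path n (vx (k + 1), [D (vx k)])"
    by (auto simp: valid_path_def Suc_vx)
  then show "rev_kQ n (u k) = d k" "rev_kQ n (d k) = u k"
    by (auto simp: u_def d_def rev_kQ_pth rpath_def Suc_vx)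
qed

lemma rev_kQ_r: "rev_kQ n (r1 k) = r2 k" "rev_kQ n (r2 k) = r1 k"
  by (simp_all add: r1_def r2_def rev_kQ_mult rev_kQ_uds kQ_assoc)

text \<open>The two families of relations are mirror images with the same coefficients, so
  \<open>H\<close> is anti-isomorphic to itself without a change of parameters.\<close>

lemma rev_kQ_I: "f \<in> I \<Longrightarrow> rev_kQ n f \<in> I"
proof -
  have "I \<subseteq> {f \<in> A. rev_kQ n f \<in> I}"
  proof (rule I_minimal)
    show "kq.subspace {f \<in> A. rev_kQ n f \<in> I}"
      by (rule kq.subspaceI) auto
  qed (auto simp: rev_kQ_mult I_mult rev_kQ_r r_in_I)
  then show "f \<in> I \<Longrightarrow> rev_kQ n f \<in> I" by auto
qed

lemma rev_kQ_image_subspace: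
  assumes "kq.subspace J" "I \<subseteq> J" "J \<subseteq> A"
  shows "kq.subspace (rev_kQ n ` J)" "I \<subseteq> rev_kQ n ` J" "rev_kQ n ` J \<subseteq> A"
    and "rev_kQ n ` rev_kQ n ` J = J"
proof -
  have "rev_kQ n f + rev_kQ n g \<in> rev_kQ n ` J" if "f \<in> J" "g \<in> J" for f g
    using kq.subspace_add[OF assms(1) that] by (metis image_eqI rev_kQ_linear(2))
  moreover have "sc r (rev_kQ n f) \<in> rev_kQ n ` J" if "f \<in> J" for f r
    using kq.subspace_scale[OF assms(1) that] by (metis image_eqI rev_kQ_linear(4))
  moreover have "0 \<in> rev_kQ n ` J"
    using kq.subspace_0[OF assms(1)] by (metis image_eqI rev_kQ_linear(1))
  ultimately show "kq.subspace (rev_kQ n ` J)" by (intro kq.subspaceI) auto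
  show "I \<subseteq> rev_kQ n ` J"
  proof
    fix f assume f: "f \<in> I"
    then have "rev_kQ n f \<in> J" "f = rev_kQ n (rev_kQ n f)"
      using rev_kQ_I assms(2) I_closed[OF f] by (auto simp: rev_kQ_rev_kQ)
    then show "f \<in> rev_kQ n ` J" by blast
  qed
  show "rev_kQ n ` J \<subseteq> A" using assms(3) by auto
  have "rev_kQ n (rev_kQ n f) = f" if "f \<in> J" for f
    using assms(3) that rev_kQ_rev_kQ by auto
  then show "rev_kQ n ` rev_kQ n ` J = J" by (auto simp: image_image)
qed

lemma acc_lid_iff_acc_rid: "acc lid \<longleftrightarrow> acc rid"
proof -
  have 1: "lid (rev_kQ n ` J)" if J: "rid J" for J
  proof -
    have "g \<star> rev_kQ n f \<in> rev_kQ n ` J" if "f \<in> J" "g \<in> A" for f g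
    proof -
      have "f \<in> A" "f \<star> rev_kQ n g \<in> J" using J that by (auto simp: rid_def)
      then show ?thesis
        using that by (intro image_eqI[of _ _ "f \<star> rev_kQ n g"]) (auto simp: rev_kQ_mult rev_kQ_rev_kQ)
    qed
    then show ?thesis
      using J rev_kQ_image_subspace[of J] by (auto simp: rid_def lid_def)
  qed
  have 2: "rid (rev_kQ n ` J)" if J: "lid J" for J
  proof -
    have "rev_kQ n f \<star> g \<in> rev_kQ n ` J" if "f \<in> J" "g \<in> A" for f g
    proof -
      have "f \<in> A" "rev_kQ n g \<star> f \<in> J" using J that by (auto simp: lid_def)
      then show ?thesis
        using that by (intro image_eqI[of _ _ "rev_kQ n g \<star> f"]) (auto simp: rev_kQ_mult rev_kQ_rev_kQ)
    qed
    then show ?thesis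
      using J rev_kQ_image_subspace[of J] by (auto simp: rid_def lid_def)
  qed
  show ?thesis
  proof
    assume "acc lid" then show "acc rid"
      by (rule acc_transfer[where F = "(`) (rev_kQ n)" and G = "(`) (rev_kQ n)"])
         (simp_all add: 1 image_mono, simp add: rid_def rev_kQ_image_subspace)
  next
    assume "acc rid" then show "acc lid"
      by (rule acc_transfer[where F = "(`) (rev_kQ n)" and G = "(`) (rev_kQ n)"])
         (simp_all add: 2 image_mono, simp add: lid_def rev_kQ_image_subspace)
  qed
qed

end

section \<open>Weight modules\<close>

context down_up
begin

text \<open>Positions unroll the cycle. The guards test that the arrow starts at the vertex below
  position \<open>m\<close>; for \<open>D i\<close> this means that \<open>m - 1\<close> lies above
  \<open>i\<close>.\<close>

fun arr_act :: "(int \<Rightarrow> 'k) \<Rightarrow> (int \<Rightarrow> 'k) \<Rightarrow> arr \<Rightarrow> (int \<Rightarrow> 'k) \<Rightarrow> int \<Rightarrow> 'k" where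
  "arr_act p q (U i) g = (\<lambda>m. if vx m = i then p m * g (m + 1) else 0)"
| "arr_act p q (D i) g = (\<lambda>m. if vx (m - 1) = i then q m * g (m - 1) else 0)"

definition path_act :: "(int \<Rightarrow> 'k) \<Rightarrow> (int \<Rightarrow> 'k) \<Rightarrow> nat \<times> arr list \<Rightarrow> (int \<Rightarrow> 'k) \<Rightarrow> int \<Rightarrow> 'k" where
  "path_act p q \<pi> g = (\<lambda>m. if vx m = fst \<pi> then foldr (arr_act p q) (snd \<pi>) g m else 0)"

text \<open>A left module structure on functions \<open>int \<Rightarrow> 'k\<close>; integer positions are read
  modulo \<open>n\<close> to obtain vertices. It is the dual of a module with basis \<open>v\<^sub>m\<close> in which
  \<open>v\<^sub>m u = p\<^sub>m v\<^sub>m\<^sub>+\<^sub>1\<close> and \<open>v\<^sub>m d = q\<^sub>m v\<^sub>m\<^sub>-\<^sub>1\<close>.\<close>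

definition act :: "(int \<Rightarrow> 'k) \<Rightarrow> (int \<Rightarrow> 'k) \<Rightarrow> 'k kq \<Rightarrow> (int \<Rightarrow> 'k) \<Rightarrow> int \<Rightarrow> 'k" where
  "act p q f g = (\<lambda>m. \<Sum>\<pi> | f \<pi> \<noteq> 0. f \<pi> * path_act p q \<pi> g m)"

lemma act_superset:
  assumes "finite S" "{\<pi>. f \<pi> \<noteq> 0} \<subseteq> S"
  shows "act p q f g m = (\<Sum>\<pi>\<in>S. f \<pi> * path_act p q \<pi> g m)"
  unfolding act_def using assms by (intro sum.mono_neutral_left) auto

lemma act_zero [simp]: "act p q 0 g = (\<lambda>_. 0)"
  by (simp add: act_def pointwise)

lemma act_add:
  assumes "f \<in> A" "f' \<in> A"
  shows "act p q (f + f') g = (\<lambda>m. act p q f g m + act p q f' g m)"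
proof
  fix m
  let ?S = "{\<pi>. f \<pi> \<noteq> 0} \<union> {\<pi>. f' \<pi> \<noteq> 0}"
  have fin: "finite ?S" using assms by (auto simp: kQ_carrier)
  have "act p q (f + f') g m = (\<Sum>\<pi>\<in>?S. (f + f') \<pi> * path_act p q \<pi> g m)"
    by (rule act_superset[OF fin]) (auto simp: pointwise)
  also have "\<dots> = act p q f g m + act p q f' g m"
    unfolding act_superset[OF fin Un_upper1] act_superset[OF fin Un_upper2]
    by (simp add: pointwise algebra_simps sum.distrib)
  finally show "act p q (f + f') g m = act p q f g m + act p q f' g m" .
qed

lemma act_sc:
  assumes "f \<in> A"
  shows "act p q (sc r f) g = (\<lambda>m. r * act p q f g m)"
proof
  fix m
  have fin: "finite {\<pi>. f \<pi> \<noteq> 0}" using assms by (auto simp: kQ_carrier)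
  have "act p q (sc r f) g m = (\<Sum>\<pi>\<in>{\<pi>. f \<pi> \<noteq> 0}. sc r f \<pi> * path_act p q \<pi> g m)"
    by (rule act_superset[OF fin]) (auto simp: pointwise)
  then show "act p q (sc r f) g m = r * act p q f g m"
    by (simp add: act_def sum_distrib_left pointwise algebra_simps)
qed

lemma act_diff:
  assumes "f \<in> A" "f' \<in> A"
  shows "act p q (f - f') g = (\<lambda>m. act p q f g m - act p q f' g m)"
proof -
  have "f - f' = f + sc (-1) f'" by (simp add: fun_eq_iff pointwise)
  then have "act p q (f - f') g = act p q (f + sc (-1) f') g" by (rule arg_cong)
  also have "\<dots> = (\<lambda>m. act p q f g m + (-1) * act p q f' g m)"
    using assms by (simp only: act_add act_sc kQ_closed_linear)
  finally show ?thesis by simp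
qed

lemma act_sum:
  assumes "\<And>i. i \<in> S \<Longrightarrow> F i \<in> A"
  shows "act p q (sum F S) g = (\<lambda>m. \<Sum>i\<in>S. act p q (F i) g m)"
  using assms by (induction S rule: infinite_finite_induct) (auto simp: act_add)

lemma act_pth [simp]: "act p q (pth \<pi>) g = path_act p q \<pi> g"
proof
  fix m
  have "act p q (pth \<pi>) g m = (\<Sum>\<rho>\<in>{\<pi>}. pth \<pi> \<rho> * path_act p q \<rho> g m)"
    by (rule act_superset) (auto simp: pth_def)
  then show "act p q (pth \<pi>) g m = path_act p q \<pi> g m"
    by (simp add: pth_def)
qed

lemma arr_act_linear:
  "arr_act p q z (\<lambda>m. g m + g' m) = (\<lambda>m. arr_act p q z g m + arr_act p q z g' m)"
  "arr_act p q z (\<lambda>m. r * g m) = (\<lambda>m. r * arr_act p q z g m)"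
  "arr_act p q z (\<lambda>m. 0) = (\<lambda>m. 0)"
  by (cases z; auto simp: fun_eq_iff algebra_simps)+

lemma path_act_linear:
  "path_act p q \<pi> (\<lambda>m. g m + g' m) = (\<lambda>m. path_act p q \<pi> g m + path_act p q \<pi> g' m)"
  "path_act p q \<pi> (\<lambda>m. r * g m) = (\<lambda>m. r * path_act p q \<pi> g m)"
  "path_act p q \<pi> (\<lambda>m. 0) = (\<lambda>m. 0)"
proof -
  have "foldr (arr_act p q) xs (\<lambda>m. g m + g' m) =
      (\<lambda>m. foldr (arr_act p q) xs g m + foldr (arr_act p q) xs g' m) \<and>
    foldr (arr_act p q) xs (\<lambda>m. r * g m) = (\<lambda>m. r * foldr (arr_act p q) xs g m) \<and>
    foldr (arr_act p q) xs (\<lambda>m. 0) = (\<lambda>m. 0)" for xs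
    by (induction xs) (simp_all add: arr_act_linear)
  then show
    "path_act p q \<pi> (\<lambda>m. g m + g' m) = (\<lambda>m. path_act p q \<pi> g m + path_act p q \<pi> g' m)"
    "path_act p q \<pi> (\<lambda>m. r * g m) = (\<lambda>m. r * path_act p q \<pi> g m)"
    "path_act p q \<pi> (\<lambda>m. 0) = (\<lambda>m. 0)"
    by (auto simp: path_act_def fun_eq_iff)
qed

lemma act_zero_right [simp]: "act p q f (\<lambda>m. 0) = (\<lambda>m. 0)"
  by (simp add: act_def path_act_linear)

text \<open>All positions that a path reads from \<open>m\<close> lie above its target vertex, so
  restricting the argument to one vertex either changes nothing or kills the value. This yields the
  module law for composable and non-composable paths at once.\<close>

lemma foldr_arr_act_restrict:
  assumes "chain n (vx m) xs" "\<forall>z\<in>set xs. arr_idx z < n"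
  shows "foldr (arr_act p q) xs (\<lambda>t. if vx t = w then g t else 0) m =
    (if path_tgt n (vx m) xs = w then foldr (arr_act p q) xs g m else 0)"
  using assms
proof (induction xs arbitrary: m)
  case (Cons z xs)
  show ?case
  proof (cases z)
    case (U i)
    then have "i = vx m" using Cons.prems by auto
    then show ?thesis using Cons U by (auto simp: Suc_vx)
  next
    case (D i)
    then have "Suc i mod n = vx m" "i < n" using Cons.prems by auto
    then have "vx (int i + 1) = vx m" using Suc_vx[of "int i"] by simp
    then have "vx (m - 1) = i"
      using vx_eq_add[of "int i + 1" m "-1"] \<open>i < n\<close> by simp
    then show ?thesis using Cons D by auto
  qed
qed auto

lemma path_act_path_act:
  assumes "valid_path n (v, xs)"
  shows "path_act p q (v, xs) (path_act p q (w, ys) g) =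
    (if w = path_tgt n v xs then path_act p q (v, xs @ ys) g else (\<lambda>m. 0))"
proof
  fix m
  show "path_act p q (v, xs) (path_act p q (w, ys) g) m =
    (if w = path_tgt n v xs then path_act p q (v, xs @ ys) g else (\<lambda>m. 0)) m"
    using assms foldr_arr_act_restrict[of m xs p q w "foldr (arr_act p q) ys g"]
    by (auto simp: path_act_def valid_path_def cong: if_cong)
qed

lemma act_mult:
  assumes "f \<in> A" "h \<in> A"
  shows "act p q (f \<star> h) g = act p q f (act p q h g)"
  using assms(1)
proof (induction f rule: kQ_induct)
  case (path \<pi>)
  from assms(2) show ?case
  proof (induction h rule: kQ_induct)
    case (path \<rho>)
    then show ?case
      using \<open>valid_path n \<pi>\<close>
      by (cases \<pi>; cases \<rho>) (auto simp: pth_mult path_act_path_act)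
  qed (use \<open>valid_path n \<pi>\<close> in \<open>auto simp: kQ_distrib act_add act_sc path_act_linear\<close>)
qed (use assms(2) in \<open>auto simp: kQ_distrib act_add act_sc\<close>)

lemma act_gens:
  "act p q (e k) g m = (if vx m = vx k then g m else 0)"
  "act p q (u k) g m = (if vx m = vx k then p m * g (m + 1) else 0)"
  "act p q (d k) g m = (if vx m = vx (k + 1) then q m * g (m - 1) else 0)"
  using vx_eq_add_iff[of "m - 1" 1 k]
  by (auto simp: e_def u_def d_def path_act_def)

lemma act_x: "act p q (x k) g m = (if vx m = vx k then p m * q (m + 1) * g m else 0)"
  using vx_eq_add_iff[of m 1 k] by (auto simp: x_def act_mult act_gens)

lemma act_y: "act p q (y k) g m = (if vx m = vx k then p (m - 1) * q m * g m else 0)"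
  using vx_eq_add_iff[of m "-1" k] by (auto simp: y_def act_mult act_gens)

text \<open>\<open>p m * q (m + 1)\<close> is the weight of \<open>x\<close> at position
  \<open>m\<close>, and \<open>p (m - 1) * q m\<close> that of \<open>y\<close>. The first
  alternative allows a cut: no arrow crosses between \<open>m\<close> and \<open>m + 1\<close>, so
  the relations attached to that step are vacuous.\<close>

definition wt_mod :: "(int \<Rightarrow> 'k) \<Rightarrow> (int \<Rightarrow> 'k) \<Rightarrow> bool" where
  "wt_mod p q \<longleftrightarrow> (\<forall>m. p m = 0 \<and> q (m + 1) = 0 \<or>
     p (m - 1) * q m = a m * (p m * q (m + 1)) + b m * (p (m + 1) * q (m + 2)) + c m)"

text \<open>Evaluated at position \<open>m\<close>, the first relation carries the factor
  \<open>p m\<close> and the second the factor \<open>q m\<close>; the cofactor is the weight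
  recurrence at \<open>m\<close>, respectively at \<open>m - 1\<close>.\<close>

lemma act_r:
  assumes "wt_mod p q"
  shows "act p q (r1 k) g = (\<lambda>m. 0)" "act p q (r2 k) g = (\<lambda>m. 0)"
proof -
  have r1: "r1 k = y k \<star> u k - sc (a k) (x k \<star> u k) - sc (b k) (u k \<star> x (k + 1)) - sc (c k) (u k)"
    by (simp add: r1_def x_def y_def kQ_assoc)
  have r2: "r2 k = d k \<star> y k - sc (a k) (d k \<star> x k) - sc (b k) (x (k + 1) \<star> d k) - sc (c k) (d k)"
    by (simp add: r2_def x_def y_def kQ_assoc)
  note simps = act_diff act_sc act_mult act_x act_y act_gens
  show "act p q (r1 k) g = (\<lambda>m. 0)"
  proof
    fix m
    consider "p m = 0" | "p (m - 1) * q m = a m * (p m * q (m + 1)) + b m * (p (m + 1) * q (m + 2)) + c m"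
      using assms by (auto simp: wt_mod_def)
    then show "act p q (r1 k) g m = 0"
    proof cases
      case 1
      then show ?thesis by (simp add: r1 simps)
    next
      case 2
      then show ?thesis
        using vx_eq_add_iff[of m 1 k]
        by (simp add: r1 simps add.assoc) (simp add: algebra_simps)
    qed
  qed
  show "act p q (r2 k) g = (\<lambda>m. 0)"
  proof
    fix m
    consider "q m = 0" | "p (m - 2) * q (m - 1) =
        a (m - 1) * (p (m - 1) * q m) + b (m - 1) * (p m * q (m + 1)) + c (m - 1)"
      using assms[unfolded wt_mod_def, rule_format, of "m - 1"] by (auto simp: algebra_simps)
    then show "act p q (r2 k) g m = 0"
    proof cases
      case 1
      then show ?thesis by (simp add: r2 simps)
    next
      case 2
      show ?thesis
      proof (cases "vx m = vx (k + 1)")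
        case True
        then have "vx (m - 1) = vx k" using vx_eq_add_iff[of m "- 1" "k + 1"] by simp
        with 2 True show ?thesis
          by (simp add: r2 simps add.assoc) (simp add: algebra_simps)
      qed (use vx_eq_add_iff[of m "- 1" "k + 1"] in \<open>simp add: r2 simps\<close>)
    qed
  qed
qed

lemma act_I:
  assumes "wt_mod p q" "f \<in> I"
  shows "act p q f g = (\<lambda>m. 0)"
proof -
  have "I \<subseteq> {f \<in> A. \<forall>g. act p q f g = (\<lambda>m. 0)}"
  proof (rule I_minimal)
    show "kq.subspace {f \<in> A. \<forall>g. act p q f g = (\<lambda>m. 0)}"
      by (rule kq.subspaceI) (auto simp: act_add act_sc)
  qed (use assms(1) in \<open>auto simp: act_mult act_r\<close>)
  then show ?thesis using assms(2) by blast
qed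

primrec pu :: "int \<Rightarrow> nat \<Rightarrow> 'k kq" where
  "pu k 0 = e k"
| "pu k (Suc r) = pu k r \<star> u (k + int r)"

primrec pd :: "int \<Rightarrow> nat \<Rightarrow> 'k kq" where
  "pd k 0 = e k"
| "pd k (Suc r) = pd k r \<star> d (k - int r - 1)"

lemma pu_pd_closed [simp]: "pu k r \<in> A" "pd k r \<in> A"
  by (induction r) auto

lemma act_pu: "act p q (pu k r) g m = (if vx m = vx k then (\<Prod>i<r. p (m + int i)) * g (m + int r) else 0)"
proof (induction r arbitrary: g)
  case (Suc r)
  show ?case
    using vx_eq_add_iff[of m "int r" k] by (auto simp: act_mult Suc act_gens algebra_simps)
qed (auto simp: act_gens)

lemma act_pd: "act p q (pd k r) g m = (if vx m = vx k then (\<Prod>i<r. q (m - int i)) * g (m - int r) else 0)"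
proof (induction r arbitrary: g)
  case (Suc r)
  show ?case
    using vx_eq_add_iff[of m "- int r" k] by (auto simp: act_mult Suc act_gens algebra_simps)
qed (auto simp: act_gens)

end

section \<open>The case of a vanishing coefficient\<close>

context down_up
begin

section \<open>The conditions on the quotient, expressed by representatives\<close>

lemma cl_e: "i < n \<Longrightarrow> eH n \<alpha> \<beta> \<gamma> i = cl (e (int i))"
  by (simp add: eH_def e_def)

lemma cl_x: "i < n \<Longrightarrow> udH n \<alpha> \<beta> \<gamma> i = cl (x (int i))"
  using Suc_vx[of "int i"] by (simp add: udH_def x_def u_def d_def pth_mult)

lemma cl_y:
  assumes "i < n"
  shows "duH n \<alpha> \<beta> \<gamma> i = cl (y (int i))"
proof -
  have "pr n i = vx (int i - 1)" using pr_vx[of "int i"] assms by simp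
  then show ?thesis
    using assms by (simp add: duH_def y_def u_def d_def pth_mult)
qed

lemma kQ_pow_closed [simp]: "f \<in> A \<Longrightarrow> f [^]\<^bsub>kQ n\<^esub> (r::nat) \<in> A"
  by (intro monoid.nat_pow_closed ring.is_monoid kQ_ring)

lemma cl_pow: "f \<in> A \<Longrightarrow> cl f [^]\<^bsub>H\<^esub> (r::nat) = cl (f [^]\<^bsub>kQ n\<^esub> r)"
  by (induction r) (simp_all add: H_one)

definition xy_mon :: "int \<Rightarrow> nat \<times> nat \<Rightarrow> 'k kq" where
  "xy_mon k = (\<lambda>(i, j). e k \<star> x k [^]\<^bsub>kQ n\<^esub> i \<star> y k [^]\<^bsub>kQ n\<^esub> j)"

lemma xy_mon_closed [simp]: "xy_mon k s \<in> A"
  by (cases s) (auto simp: xy_mon_def)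

lemma poly_ring_iff:
  assumes "i < n"
  shows "poly_ring_two_vars n \<alpha> \<beta> \<gamma> i \<longleftrightarrow> x (int i) \<star> y (int i) \<approx> y (int i) \<star> x (int i) \<and>
    (\<forall>t :: nat \<times> nat \<Rightarrow> 'k. finite {s. t s \<noteq> 0} \<longrightarrow>
      (\<Sum>s | t s \<noteq> 0. sc (t s) (xy_mon (int i) s)) \<in> I \<longrightarrow> (\<forall>s. t s = 0))"
proof -
  let ?k = "int i"
  have mon: "(case s of (l, m) \<Rightarrow> cl (e ?k) \<otimes>\<^bsub>H\<^esub> (cl (x ?k) [^]\<^bsub>H\<^esub> l) \<otimes>\<^bsub>H\<^esub> (cl (y ?k) [^]\<^bsub>H\<^esub> m)) =
      cl (xy_mon ?k s)" for s :: "nat \<times> nat"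
    by (cases s) (auto simp: cl_pow xy_mon_def)
  have sum: "finsum H (\<lambda>s. scH n \<alpha> \<beta> \<gamma> (t s) (cl (xy_mon ?k s))) {s. t s \<noteq> 0} = \<zero>\<^bsub>H\<^esub> \<longleftrightarrow>
      (\<Sum>s | t s \<noteq> 0. sc (t s) (xy_mon ?k s)) \<in> I"
    if "finite {s. t s \<noteq> 0}" for t :: "nat \<times> nat \<Rightarrow> 'k"
  proof -
    have "finsum H (\<lambda>s. scH n \<alpha> \<beta> \<gamma> (t s) (cl (xy_mon ?k s))) {s. t s \<noteq> 0} =
        cl (\<Sum>s | t s \<noteq> 0. sc (t s) (xy_mon ?k s))"
      using that by (simp add: cl_sc cl_sum)
    then show ?thesis by (simp add: cl_eq_0_iff)
  qed
  have "cl (x ?k) \<otimes>\<^bsub>H\<^esub> cl (y ?k) = cl (y ?k) \<otimes>\<^bsub>H\<^esub> cl (x ?k) \<longleftrightarrow>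
      x ?k \<star> y ?k \<approx> y ?k \<star> x ?k"
    by (simp add: cl_eq_iff)
  then show ?thesis
    unfolding poly_ring_two_vars_def Let_def cl_e[OF assms] cl_x[OF assms] cl_y[OF assms] mon
    using sum by auto
qed

lemma piecewise_domain_iff:
  "piecewise_domain H n (eH n \<alpha> \<beta> \<gamma>) \<longleftrightarrow>
    (\<forall>k l m. \<forall>f\<in>A. \<forall>g\<in>A. (e k \<star> f \<star> e l) \<star> (e l \<star> g \<star> e m) \<in> I \<longrightarrow>
      e k \<star> f \<star> e l \<in> I \<or> e l \<star> g \<star> e m \<in> I)" (is "?L \<longleftrightarrow> ?R")
proof -
  have el: "{cl (e i) \<otimes>\<^bsub>H\<^esub> s \<otimes>\<^bsub>H\<^esub> cl (e k) | s. s \<in> carrier H} = (\<lambda>f. cl (e i \<star> f \<star> e k)) ` A" for i k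
    by (simp add: Setcompr_eq_image carrier_H image_image cong: image_cong_simp)
  have *: "(\<forall>a. a \<in> F ` A \<longrightarrow> (\<forall>b. b \<in> G ` A \<longrightarrow> P a b)) \<longleftrightarrow> (\<forall>f\<in>A. \<forall>g\<in>A. P (F f) (G g))"
    for F G :: "'k kq \<Rightarrow> 'k kq set" and P
    by blast
  have "?L \<longleftrightarrow> (\<forall>i<n. \<forall>j<n. \<forall>k<n. \<forall>f\<in>A. \<forall>g\<in>A.
      (e (int i) \<star> f \<star> e (int k)) \<star> (e (int k) \<star> g \<star> e (int j)) \<in> I \<longrightarrow>
      e (int i) \<star> f \<star> e (int k) \<in> I \<or> e (int k) \<star> g \<star> e (int j) \<in> I)"
    unfolding piecewise_domain_def
    by (simp add: cl_e el * cl_eq_0_iff del: imp_disjL cong: imp_cong ball_cong)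
  also have "\<dots> \<longleftrightarrow> ?R"
  proof (intro iffI allI ballI impI)
    fix k l m f g
    assume *: "\<forall>i<n. \<forall>j<n. \<forall>k<n. \<forall>f\<in>A. \<forall>g\<in>A.
      (e (int i) \<star> f \<star> e (int k)) \<star> (e (int k) \<star> g \<star> e (int j)) \<in> I \<longrightarrow>
      e (int i) \<star> f \<star> e (int k) \<in> I \<or> e (int k) \<star> g \<star> e (int j) \<in> I"
      and **: "f \<in> A" "g \<in> A" "(e k \<star> f \<star> e l) \<star> (e l \<star> g \<star> e m) \<in> I"
    have "e (int (vx t)) = e t" for t by (rule euds_cong) simp
    then show "e k \<star> f \<star> e l \<in> I \<or> e l \<star> g \<star> e m \<in> I"
      using *[rule_format, of "vx k" "vx m" "vx l" f g] ** by simp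
  qed blast
  finally show ?thesis .
qed

end

text \<open>If \<open>\<beta>\<^sub>j = 0\<close> then \<open>w = y - \<alpha>\<^sub>j x - \<gamma>\<^sub>j\<close> is killed by \<open>u\<^sub>j\<close> from the right. It acts with
  rank one on a highest weight module whose weight at the top differs from \<open>\<gamma>\<^sub>j\<close>.\<close>

locale down_up_zero = down_up +
  fixes j :: int
  assumes b_j: "b j = 0"
begin

text \<open>\<open>t r\<close> is the weight of \<open>x\<close> at position \<open>j - r\<close>.
  It is 0 at the top, and the value \<open>c j + 1\<close> is chosen so that \<open>w\<close> acts
  by 1 at position \<open>j\<close>.\<close>

fun t :: "nat \<Rightarrow> 'a" where
  "t 0 = 0"
| "t (Suc 0) = c j + 1"
| "t (Suc (Suc r)) = a (j - int r - 1) * t (Suc r) + b (j - int r - 1) * t r + c (j - int r - 1)"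

text \<open>Up-steps are normalised to one and down-steps carry the weights; the module is cut
  between \<open>j\<close> and \<open>j + 1\<close>, since \<open>p j\<close> and
  \<open>q (j + 1)\<close> vanish.\<close>

definition p :: "int \<Rightarrow> 'a" where "p m = (if m < j then 1 else 0)"
definition q :: "int \<Rightarrow> 'a" where "q m = (if m \<le> j then t (nat (j - m + 1)) else 0)"

lemma p_q: "p m * q (m + 1) = (if m < j then t (nat (j - m)) else 0)"
  by (auto simp: p_def q_def)

lemma weight_rec:
  assumes "m < j"
  shows "p (m - 1) * q m = a m * (p m * q (m + 1)) + b m * (p (m + 1) * q (m + 2)) + c m"
proof -
  define r where "r = nat (j - m - 1)"
  have m: "m = j - int r - 1" using assms by (simp add: r_def)
  have "p (m - 1) * q m = t (Suc (Suc r))" "p m * q (m + 1) = t (Suc r)"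
    using p_q[of "m - 1"] p_q[of m] by (auto simp: m nat_add_distrib)
  moreover have "p (m + 1) * q (m + 2) = t r"
  proof -
    have "m + 1 = j - int r" "m + 2 = j - int r + 1" by (auto simp: m)
    then show ?thesis by (cases "r = 0") (simp_all only: p_q, simp_all)
  qed
  ultimately show ?thesis by (simp add: m del: of_nat_Suc)
qed

lemma wt_mod: "wt_mod p q"
  unfolding wt_mod_def using weight_rec by (auto simp: p_def q_def)

definition w :: "'a kq" where "w = y j - sc (a j) (x j) - sc (c j) (e j)"

lemma w_closed [simp]: "w \<in> A"
  by (simp add: w_def)

lemma e_w [simp]: "e j \<star> w = w" "w \<star> e j = w"
  by (simp_all add: w_def kQ_distrib_diff e_mult_e)

lemma w_u: "w \<star> u j \<in> I"
proof -
  have "w \<star> u j = r1 j"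
    by (simp add: w_def r1_def x_def y_def kQ_distrib_diff b_j)
  then show ?thesis by (simp add: r_in_I)
qed

text \<open>At a lower position above the same vertex, \<open>b m = b j = 0\<close> turns the weight
  recurrence into the vanishing of the weight of \<open>w\<close>. At \<open>j\<close> there is no
  recurrence, and the weight is 1.\<close>

lemma act_w:
  assumes "\<And>m. m > j \<Longrightarrow> g m = 0"
  shows "act p q w g m = (if m = j then g j else 0)"
proof (cases "vx m = vx j")
  case True
  then have eq: "act p q w g m = (p (m - 1) * q m - a m * (p m * q (m + 1)) - c m) * g m"
    by (simp add: w_def act_diff act_sc act_x act_y act_gens) (simp add: algebra_simps)
  consider "m < j" | "m = j" | "m > j" by linarith
  then show ?thesis
  proof cases
    case 1
    have "b m = 0" using b_j True by simp
    then show ?thesis using weight_rec[OF 1] 1 eq by simp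
  next
    case 2
    then show ?thesis using eq by (simp add: p_def q_def algebra_simps)
  next
    case 3
    then show ?thesis using eq assms by simp
  qed
qed (auto simp: w_def act_diff act_sc act_x act_y act_gens)

lemma act_support:
  assumes "f \<in> A" "\<And>m. m > j \<Longrightarrow> g m = 0" "m > j"
  shows "act p q f g m = 0"
  using assms(1,3)
proof (induction f arbitrary: m rule: kQ_induct)
  case (path \<pi>)
  have "foldr (arr_act p q) xs g m = 0" if "m > j" for xs m
    using that
  proof (induction xs arbitrary: m)
    case (Cons z xs)
    then show ?case by (cases z) (auto simp: p_def q_def)
  qed (auto simp: assms(2))
  then show ?case using path by (auto simp: path_act_def)
qed (auto simp: act_add act_sc)

text \<open>Right ideals cut out by an action instead of by generators: functions supported up to
  \<open>j\<close> are stable under the algebra by \<open>act_support\<close>, so closure under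
  right multiplication is immediate.\<close>

definition chain_ideal :: "nat \<Rightarrow> 'a kq set" where
  "chain_ideal N = {f \<in> A. \<forall>g. (\<forall>m>j. g m = 0) \<longrightarrow> (\<forall>m<j - int N. act p q f g m = 0)}"

lemma rid_chain_ideal: "rid (chain_ideal N)"
proof -
  have "kq.subspace (chain_ideal N)"
    by (rule kq.subspaceI) (auto simp: chain_ideal_def act_add act_sc)
  moreover have "I \<subseteq> chain_ideal N"
    by (auto simp: chain_ideal_def I_closed act_I[OF wt_mod])
  ultimately show ?thesis
    by (auto simp: rid_def chain_ideal_def act_mult act_support)
qed

lemma chain_ideal_mono: "chain_ideal N \<subseteq> chain_ideal (Suc N)"
  by (auto simp: chain_ideal_def)

lemma act_pu_w:
  assumes "\<And>m. m > j \<Longrightarrow> g m = 0"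
  shows "act p q (pu (j - int N) N \<star> w) g m = (if m = j - int N then g j else 0)"
proof -
  have "(\<Prod>i<N. p (j - int N + int i)) = 1"
    by (intro prod.neutral) (auto simp: p_def)
  then show ?thesis using assms by (auto simp: act_mult act_pu act_w)
qed

lemma not_acc_rid: "\<not> acc rid"
proof
  assume "acc rid"
  then obtain N where N: "\<And>m. m \<ge> N \<Longrightarrow> chain_ideal m = chain_ideal N"
    using rid_chain_ideal chain_ideal_mono unfolding acc_def by blast
  \<comment> \<open>\<open>w\<close> extracts the value at \<open>j\<close>, and the up-path carries
    it to position \<open>j - N - 1\<close>, the first one at which \<open>chain_ideal N\<close>
    demands zero.\<close>
  let ?f = "pu (j - int (Suc N)) (Suc N) \<star> w" and ?g = "\<lambda>m. if m = j then 1 else 0 :: 'a"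
  have "?f \<in> chain_ideal (Suc N)"
    using act_pu_w[of _ "Suc N"] by (auto simp: chain_ideal_def)
  moreover have "act p q ?f ?g (j - int (Suc N)) = 1"
    by (subst act_pu_w) auto
  then have "?f \<notin> chain_ideal N"
    by (auto simp: chain_ideal_def simp del: pu.simps of_nat_Suc
        intro!: exI[of _ ?g] exI[of _ "j - int (Suc N)"])
  ultimately show False using N[of "Suc N"] by simp
qed

lemma w_notin_I: "w \<notin> I"
  using act_I[OF wt_mod, of w "\<lambda>m. if m = j then 1 else 0"]
    act_w[of "\<lambda>m. if m = j then 1 else 0" j] by (auto simp: fun_eq_iff)

lemma u_notin_I: "u j \<notin> I"
proof
  assume "u j \<in> I"
  \<comment> \<open>At \<open>j\<close> itself \<open>p\<close> vanishes; \<open>j - n\<close> lies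
    above the same vertex and strictly below the top.\<close>
  then have "act p q (u j) (\<lambda>_. 1) (j - int n) = 0"
    using act_I[OF wt_mod] by simp
  moreover have "vx (j - int n) = vx j" by (simp add: vx_eq_iff)
  ultimately show False using n_pos by (simp add: act_gens p_def)
qed

lemma not_piecewise_domain: "\<not> piecewise_domain H n (eH n \<alpha> \<beta> \<gamma>)"
proof
  assume "piecewise_domain H n (eH n \<alpha> \<beta> \<gamma>)"
  then show False
    unfolding piecewise_domain_iff
    using w_notin_I u_notin_I w_u
    by (metis e_w e_mult(1,2) w_closed euds_closed(2))
qed

end

context down_up
begin

text \<open>If \<open>x\<close> and \<open>y\<close> commute, then \<open>w x = 0\<close> becomes
  the polynomial relation \<open>x y - a x^2 - c x = 0\<close>, whose coefficient at
  \<open>x y\<close> is 1.\<close>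

lemma not_poly_ring:
  assumes "i < n" "\<beta> i = 0"
  shows "\<not> poly_ring_two_vars n \<alpha> \<beta> \<gamma> i"
proof
  let ?k = "int i"
  assume "poly_ring_two_vars n \<alpha> \<beta> \<gamma> i"
  note poly = this[unfolded poly_ring_iff[OF assms(1)]]
  have comm: "x ?k \<star> y ?k \<approx> y ?k \<star> x ?k"
    by (rule conjunct1[OF poly])
  have indep: "t s = 0" if "finite {s. t s \<noteq> 0}" "(\<Sum>s | t s \<noteq> 0. sc (t s) (xy_mon ?k s)) \<in> I"
    for t :: "nat \<times> nat \<Rightarrow> 'k" and s
    using conjunct2[OF poly] that by blast
  interpret down_up_zero n \<alpha> \<beta> \<gamma> ?k
    using assms by unfold_locales simp
  define t :: "nat \<times> nat \<Rightarrow> 'k" where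
    "t = (\<lambda>s. if s = (1, 1) then 1 else if s = (2, 0) then - a ?k else if s = (1, 0) then - c ?k else 0)"
  \<comment> \<open>Only an inclusion, since \<open>a\<close> and \<open>c\<close> may vanish at
    this vertex.\<close>
  have sub: "{s. t s \<noteq> 0} \<subseteq> {(1, 1), (2, 0), (1, 0)}"
    by (auto simp: t_def)
  then have fin: "finite {s. t s \<noteq> 0}"
    by (rule finite_subset) simp
  have mon: "xy_mon ?k (1, 1) = x ?k \<star> y ?k" "xy_mon ?k (2, 0) = x ?k \<star> x ?k"
      "xy_mon ?k (1, 0) = x ?k"
    by (simp_all add: xy_mon_def numeral_2_eq_2 flip: kQ_assoc)
  let ?S = "\<Sum>s | t s \<noteq> 0. sc (t s) (xy_mon ?k s)"
  have "?S = (\<Sum>s\<in>{(1, 1), (2, 0), (1, 0)}. sc (t s) (xy_mon ?k s))"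
    using sub by (intro sum.mono_neutral_left) auto
  also have "\<dots> = x ?k \<star> y ?k - sc (a ?k) (x ?k \<star> x ?k) - sc (c ?k) (x ?k)"
    by (simp add: mon[simplified]) (simp add: t_def)
  finally have S: "?S = x ?k \<star> y ?k - sc (a ?k) (x ?k \<star> x ?k) - sc (c ?k) (x ?k)" .
  have eq: "?S \<approx> y ?k \<star> x ?k - sc (a ?k) (x ?k \<star> x ?k) - sc (c ?k) (x ?k)"
    unfolding S by (intro cg_diff comm cg_refl)
  have "w \<star> x ?k = y ?k \<star> x ?k - sc (a ?k) (x ?k \<star> x ?k) - sc (c ?k) (x ?k)"
    by (simp only: w_def kQ_distrib_diff kQ_sc e_x)
  moreover have "w \<star> x ?k \<in> I"
    unfolding x_def kQ_assoc[symmetric] by (rule I_mult(1)[OF w_u]) simp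
  ultimately have "?S \<in> I"
    by (simp only: cg_I_iff[OF eq])
  then have "t (1, 1) = 0" by (rule indep[OF fin])
  then show False by (simp add: t_def)
qed

end

section \<open>Moving arrows past affine forms\<close>

context down_up
begin

definition lin :: "int \<Rightarrow> 'k \<Rightarrow> 'k \<Rightarrow> 'k \<Rightarrow> 'k kq" where
  "lin k r s t = sc r (x k) + sc s (y k) + sc t (e k)"

lemma lin_closed [simp]: "lin k r s t \<in> A"
  by (auto simp: lin_def)

lemma e_lin [simp]: "e k \<star> lin k r s t = lin k r s t" "lin k r s t \<star> e k = lin k r s t"
  by (simp_all add: lin_def kQ_distrib e_mult_e)

lemma lin_x: "x k = lin k 1 0 0" and lin_y: "y k = lin k 0 1 0"
  by (auto simp: lin_def)

lemma r1_eq': "r1 k = y k \<star> u k - sc (a k) (x k \<star> u k) - sc (b k) (u k \<star> x (k + 1)) - sc (c k) (u k)"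
  by (simp add: r1_def x_def y_def kQ_assoc)

lemma r2_eq': "r2 k = d k \<star> y k - sc (a k) (d k \<star> x k) - sc (b k) (x (k + 1) \<star> d k) - sc (c k) (d k)"
  by (simp add: r2_def x_def y_def kQ_assoc)

lemma u_y: "u k \<star> y (k + 1) = x k \<star> u k" and y_d: "y (k + 1) \<star> d k = d k \<star> x k"
  by (simp_all add: x_def y_def kQ_assoc)

text \<open>\<open>u k\<close> passes \<open>y (k + 1)\<close> exactly, turning it into
  \<open>x k\<close>; only \<open>x (k + 1)\<close> needs the first relation, which is solved for it
  by dividing by \<open>b k\<close>.\<close>

lemma u_lin:
  assumes "b k \<noteq> 0"
  shows "u k \<star> lin (k + 1) r s t \<approx> lin k (s - r * a k / b k) (r / b k) (t - r * c k / b k) \<star> u k"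
proof -
  have "u k \<star> lin (k + 1) r s t - lin k (s - r * a k / b k) (r / b k) (t - r * c k / b k) \<star> u k
      = sc (- (r / b k)) (r1 k)"
    unfolding lin_def r1_eq' kQ_distrib kQ_sc u_y e_mult
    using assms by (intro ext) (simp add: pointwise field_simps)
  then show ?thesis unfolding cong_I_def using r_in_I by simp
qed

text \<open>Dually, \<open>d k\<close> turns \<open>x k\<close> into \<open>y (k + 1)\<close>
  exactly, and the second relation already expresses \<open>d k\<close> times \<open>y k\<close>
  without a division.\<close>

lemma d_lin:
  "d k \<star> lin k r s t \<approx> lin (k + 1) (b k * s) (r + a k * s) (t + c k * s) \<star> d k"
proof -
  have "d k \<star> lin k r s t - lin (k + 1) (b k * s) (r + a k * s) (t + c k * s) \<star> d k
      = sc s (r2 k)"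
    unfolding lin_def r2_eq' kQ_distrib kQ_sc y_d e_mult
    by (intro ext) (simp add: pointwise algebra_simps)
  then show ?thesis unfolding cong_I_def using r_in_I by simp
qed

text \<open>The overlap of the two relations: in \<open>u k\<close> times the second minus the first
  times \<open>d k\<close>, all terms with coefficients cancel.\<close>

lemma x_y_comm: "x k \<star> y k \<approx> y k \<star> x k"
proof -
  have "u k \<star> r2 k - r1 k \<star> d k = x k \<star> y k - y k \<star> x k"
    by (simp add: r1_def r2_def x_def y_def kQ_distrib_diff kQ_assoc)
  then show ?thesis
    unfolding cong_I_def using I_mult r_in_I I_linear(3) by (metis euds_closed(2,3))
qed

section \<open>Straight paths of net degree m\<close>

definition P :: "int \<Rightarrow> int \<Rightarrow> 'k kq" where
  "P k m = (if m \<ge> 0 then pu k (nat m) else pd k (nat (- m)))"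

lemma P_closed [simp]: "P k m \<in> A"
  by (simp add: P_def)

lemma P_0 [simp]: "P k 0 = e k"
  by (simp add: P_def)

lemma P_u: "m \<ge> 0 \<Longrightarrow> P k m \<star> u (k + m) = P k (m + 1)"
  by (simp add: P_def nat_add_distrib)

lemma P_d:
  assumes "m \<le> 0"
  shows "P k m \<star> d (k + m - 1) = P k (m - 1)"
proof -
  have "nat (1 - m) = Suc (nat (- m))" "k - int (nat (- m)) = k + m" using assms by auto
  then show ?thesis using assms by (auto simp: P_def)
qed

text \<open>An up-arrow after a down-path backtracks, and the loop so closed is \<open>y\<close> at
  the new end.\<close>

lemma P_u_neg: "m < 0 \<Longrightarrow> P k m \<star> u (k + m) = P k (m + 1) \<star> y (k + m + 1)"
  using P_d[of "m + 1" k] by (simp add: y_def algebra_simps kQ_assoc) (simp add: kQ_assoc[symmetric])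

lemma P_d_pos: "m > 0 \<Longrightarrow> P k m \<star> d (k + m - 1) = P k (m - 1) \<star> x (k + m - 1)"
  using P_u[of "m - 1" k] by (simp add: x_def algebra_simps) (simp add: kQ_assoc[symmetric])

lemma e_P [simp]: "e k \<star> P k m = P k m"
proof -
  have "e k \<star> pu k r = pu k r" "e k \<star> pd k r = pd k r" for r
    by (induction r) (simp_all add: e_mult_e flip: kQ_assoc)
  then show ?thesis by (simp add: P_def)
qed

lemma P_e [simp]: "P k m \<star> e (k + m) = P k m"
proof -
  have pu: "pu k r \<star> e (k + int r) = pu k r" for r
  proof (cases r)
    case (Suc r')
    have kr: "k + int r = k + int r' + 1" using Suc by simp
    show ?thesis unfolding kr by (simp only: Suc pu.simps kQ_assoc e_mult)
  qed (simp add: e_mult_e)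
  have pd: "pd k r \<star> e (k - int r) = pd k r" for r
  proof (cases r)
    case (Suc r')
    have kr: "k - int r = k - int r' - 1" using Suc by simp
    show ?thesis unfolding kr by (simp only: Suc pd.simps kQ_assoc e_mult)
  qed (simp add: e_mult_e)
  show ?thesis
    using pu[of "nat m"] pd[of "nat (- m)"] by (cases "m \<ge> 0") (simp_all add: P_def)
qed

end

locale down_up_nz = down_up +
  assumes b_nz: "b k \<noteq> 0"
    and infinite_field: "infinite (UNIV :: 'a set)"

text \<open>The linear parts of \<open>W\<^sub>k\<close> are eigenvectors of the automorphism induced by going once around the
  cycle; \<open>Z\<^sub>k\<close> completes them to a basis of the linear forms in \<open>x\<^sub>k\<close>, \<open>y\<^sub>k\<close>. In this basis moving an arrow
  past an affine form is triangular, so that leading monomials are respected.\<close>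

locale down_up_eig = down_up_nz +
  fixes p q p' q' ev :: "int \<Rightarrow> 'a"
  assumes det: "p k * q' k - q k * p' k = 1"
    and periodic: "vx k = vx l \<Longrightarrow> p k = p l \<and> q k = q l \<and> p' k = p' l \<and> q' k = q' l"
    and eig: "q (k + 1) - p (k + 1) * a k / b k = ev k * p k" "p (k + 1) / b k = ev k * q k"
begin

definition W :: "int \<Rightarrow> 'a kq" where "W k = lin k (p k) (q k) 0"
definition Z :: "int \<Rightarrow> 'a kq" where "Z k = lin k (p' k) (q' k) 0"

definition aff :: "int \<Rightarrow> 'a \<Rightarrow> 'a \<Rightarrow> 'a \<Rightarrow> 'a kq" where
  "aff k r s t = sc r (Z k) + sc s (W k) + sc t (e k)"

lemma WZ_closed [simp]: "W k \<in> A" "Z k \<in> A" "aff k r s t \<in> A"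
  by (auto simp: W_def Z_def aff_def)

lemma e_WZ [simp]:
  "e k \<star> W k = W k" "W k \<star> e k = W k" "e k \<star> Z k = Z k" "Z k \<star> e k = Z k"
  "e k \<star> aff k r s t = aff k r s t" "aff k r s t \<star> e k = aff k r s t"
  by (simp_all add: W_def Z_def aff_def kQ_distrib e_mult_e)

lemma WZ_cong:
  assumes "vx k = vx l"
  shows "W k = W l" "Z k = Z l"
  using euds_cong[OF assms] periodic[OF assms] by (auto simp: W_def Z_def lin_def)

lemma W_aff: "W k = aff k 0 1 0" and Z_aff: "Z k = aff k 1 0 0"
  by (auto simp: aff_def)

lemma aff_lin: "aff k r s t = lin k (r * p' k + s * p k) (r * q' k + s * q k) t"
  by (intro ext) (simp add: aff_def W_def Z_def lin_def pointwise algebra_simps)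

text \<open>Cramer's rule for a basis change of determinant one.\<close>

lemma lin_aff: "lin k r s t = aff k (p k * s - q k * r) (r * q' k - s * p' k) t"
proof -
  have "(p k * s - q k * r) * p' k + (r * q' k - s * p' k) * p k = r * (p k * q' k - q k * p' k)"
    "(p k * s - q k * r) * q' k + (r * q' k - s * p' k) * q k = s * (p k * q' k - q k * p' k)"
    by (simp_all add: algebra_simps)
  then show ?thesis by (simp add: aff_lin det)
qed

lemma eig': "p (k + 1) = b k * ev k * q k" "q (k + 1) = ev k * p k + a k * ev k * q k"
proof -
  show 1: "p (k + 1) = b k * ev k * q k"
    using eig(2)[of k] b_nz[of k] by (simp add: field_simps)
  show "q (k + 1) = ev k * p k + a k * ev k * q k"
    using eig(1)[of k] b_nz[of k] unfolding 1 by (simp add: field_simps)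
qed

lemma ev_nz: "ev k \<noteq> 0"
  using det[of "k + 1"] eig'[of k] by auto

lemma W_Z_comm: "W k \<star> Z k \<approx> Z k \<star> W k"
proof -
  have "W k \<star> Z k - Z k \<star> W k = sc (p k * q' k - q k * p' k) (x k \<star> y k - y k \<star> x k)"
    unfolding W_def Z_def lin_def kQ_distrib kQ_sc
    by (intro ext) (simp add: pointwise algebra_simps)
  then show ?thesis
    using x_y_comm[of k] by (simp add: cong_I_def det)
qed

text \<open>\<open>r\<close> and \<open>s\<close> stand for the coefficients of \<open>Z\<close> and
  \<open>W\<close>, with \<open>Z\<close> ranked above \<open>W\<close> and \<open>W\<close> above
  constants. Only vanishing is compared, because nonzero factors may appear on the way.\<close>

definition same_lead :: "'a \<Rightarrow> 'a \<Rightarrow> 'a \<Rightarrow> 'a \<Rightarrow> bool" where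
  "same_lead r s r' s' \<longleftrightarrow> (r = 0 \<longleftrightarrow> r' = 0) \<and> (r = 0 \<longrightarrow> (s = 0 \<longleftrightarrow> s' = 0))"

lemma same_lead_refl [simp]: "same_lead r s r s"
  by (simp add: same_lead_def)

lemma same_lead_trans: "same_lead r s r' s' \<Longrightarrow> same_lead r' s' r'' s'' \<Longrightarrow> same_lead r s r'' s''"
  by (auto simp: same_lead_def)

text \<open>The new \<open>Z\<close>-coefficient is the determinant of \<open>W k\<close> against
  the moved form. As \<open>W (k + 1)\<close> itself is moved to \<open>ev k\<close> times
  \<open>W k\<close>, this is the old determinant \<open>r\<close> times the determinant
  \<open>- 1 / b k\<close> of the substitution, divided by \<open>ev k\<close>.\<close>

lemma u_aff: "\<exists>r' s' t'. u k \<star> aff (k + 1) r s t \<approx> aff k r' s' t' \<star> u k \<and> same_lead r s r' s'"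
proof -
  define R where "R = r * p' (k + 1) + s * p (k + 1)"
  define S where "S = r * q' (k + 1) + s * q (k + 1)"
  define X where "X = S - R * a k / b k"
  define Y where "Y = R / b k"
  have slide: "u k \<star> aff (k + 1) r s t \<approx> aff k (p k * Y - q k * X) (X * q' k - Y * p' k) (t - R * c k / b k) \<star> u k"
    using u_lin[OF b_nz, of k R S t]
    by (simp only: lin_aff[of k] X_def[symmetric] Y_def[symmetric]) (simp only: aff_lin[of "k + 1"] R_def S_def)
  have "ev k * b k * (p k * Y - q k * X) = ev k * p k * R - ev k * q k * (b k * S - a k * R)"
    using b_nz[of k] by (simp add: X_def Y_def field_simps)
  also have "\<dots> = R * (ev k * p k + a k * ev k * q k) - S * (b k * ev k * q k)"
    by (simp add: algebra_simps)
  also have "\<dots> = - r * (p (k + 1) * q' (k + 1) - q (k + 1) * p' (k + 1))"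
    unfolding eig'[symmetric] R_def S_def by (simp add: algebra_simps)
  finally have 1: "ev k * b k * (p k * Y - q k * X) = - r"
    by (simp add: det)
  have 2: "X * q' k - Y * p' k = ev k * s" if "r = 0"
  proof -
    have "X = s * (ev k * p k)" "Y = s * (ev k * q k)"
      unfolding eig[symmetric] using that by (simp_all add: X_def Y_def R_def S_def algebra_simps)
    then have "X * q' k - Y * p' k = s * ev k * (p k * q' k - q k * p' k)"
      by (simp add: algebra_simps)
    then show ?thesis by (simp add: det)
  qed
  have "same_lead r s (p k * Y - q k * X) (X * q' k - Y * p' k)"
    unfolding same_lead_def using 1 2 ev_nz[of k] b_nz[of k] by auto
  with slide show ?thesis by blast
qed

text \<open>Down-arrows substitute in the opposite direction, so \<open>W\<close> picks up the
  inverse of \<open>ev k\<close>; the determinant argument is the same.\<close>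

lemma d_aff: "\<exists>r' s' t'. d k \<star> aff k r s t \<approx> aff (k + 1) r' s' t' \<star> d k \<and> same_lead r s r' s'"
proof -
  define R where "R = r * p' k + s * p k"
  define S where "S = r * q' k + s * q k"
  define X where "X = b k * S"
  define Y where "Y = R + a k * S"
  have slide: "d k \<star> aff k r s t \<approx>
      aff (k + 1) (p (k + 1) * Y - q (k + 1) * X) (X * q' (k + 1) - Y * p' (k + 1)) (t + c k * S) \<star> d k"
    using d_lin[of k R S t]
    by (simp only: lin_aff[of "k + 1"] X_def[symmetric] Y_def[symmetric]) (simp only: aff_lin[of k] R_def S_def)
  have 1: "p (k + 1) * Y - q (k + 1) * X = - (b k * ev k) * r * (p k * q' k - q k * p' k)"
    unfolding eig' X_def Y_def R_def S_def by (simp add: algebra_simps)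
  have 2: "ev k * (X * q' (k + 1) - Y * p' (k + 1)) = s" if "r = 0"
  proof -
    have "ev k * X = s * p (k + 1)" "ev k * Y = s * q (k + 1)"
      unfolding eig' using that by (simp_all add: X_def Y_def R_def S_def algebra_simps)
    then have "ev k * X * q' (k + 1) - ev k * Y * p' (k + 1) =
        s * (p (k + 1) * q' (k + 1) - q (k + 1) * p' (k + 1))"
      by (simp only: right_diff_distrib mult.assoc)
    then show ?thesis by (simp add: det right_diff_distrib mult.assoc)
  qed
  have "same_lead r s (p (k + 1) * Y - q (k + 1) * X) (X * q' (k + 1) - Y * p' (k + 1))"
    unfolding same_lead_def using 1 2 ev_nz[of k] b_nz[of k] by (auto simp: det)
  with slide show ?thesis by blast
qed

lemma pu_aff: "\<exists>r' s' t'. pu k l \<star> aff (k + int l) r s t \<approx> aff k r' s' t' \<star> pu k l \<and> same_lead r s r' s'"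
proof (induction l arbitrary: r s t)
  case 0
  show ?case by (intro exI[of _ r] exI[of _ s] exI[of _ t]) simp
next
  case (Suc l)
  obtain r1 s1 t1 where 1: "u (k + int l) \<star> aff (k + int l + 1) r s t \<approx> aff (k + int l) r1 s1 t1 \<star> u (k + int l)"
      "same_lead r s r1 s1"
    using u_aff by blast
  obtain r2 s2 t2 where 2: "pu k l \<star> aff (k + int l) r1 s1 t1 \<approx> aff k r2 s2 t2 \<star> pu k l" "same_lead r1 s1 r2 s2"
    using Suc by blast
  have "pu k (Suc l) \<star> aff (k + int (Suc l)) r s t \<approx> aff k r2 s2 t2 \<star> pu k (Suc l)"
    using cg_trans[OF cg_mult_left[OF 1(1), of "pu k l"] cg_mult_right[OF 2(1), of "u (k + int l)", unfolded kQ_assoc]]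
    by (simp add: kQ_assoc add.assoc add.commute[of 1])
  with 1(2) 2(2) same_lead_trans show ?case by blast
qed

lemma pd_aff: "\<exists>r' s' t'. pd k l \<star> aff (k - int l) r s t \<approx> aff k r' s' t' \<star> pd k l \<and> same_lead r s r' s'"
proof (induction l arbitrary: r s t)
  case 0
  show ?case by (intro exI[of _ r] exI[of _ s] exI[of _ t]) simp
next
  case (Suc l)
  let ?d = "d (k - int l - 1)"
  obtain r1 s1 t1 where 1: "?d \<star> aff (k - int l - 1) r s t \<approx> aff (k - int l) r1 s1 t1 \<star> ?d"
      "same_lead r s r1 s1"
    using d_aff[of "k - int l - 1" r s t] unfolding diff_add_cancel by blast
  obtain r2 s2 t2 where 2: "pd k l \<star> aff (k - int l) r1 s1 t1 \<approx> aff k r2 s2 t2 \<star> pd k l" "same_lead r1 s1 r2 s2"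
    using Suc by blast
  have "pd k (Suc l) \<star> aff (k - int (Suc l)) r s t \<approx> aff k r2 s2 t2 \<star> pd k (Suc l)"
    using cg_trans[OF cg_mult_left[OF 1(1), of "pd k l"] cg_mult_right[OF 2(1), of ?d, unfolded kQ_assoc]]
    by (simp add: kQ_assoc algebra_simps)
  with 1(2) 2(2) same_lead_trans show ?case by blast
qed

lemma P_aff: "\<exists>r' s' t'. P k m \<star> aff (k + m) r s t \<approx> aff k r' s' t' \<star> P k m \<and> same_lead r s r' s'"
proof (cases "m \<ge> 0")
  case True
  then show ?thesis using pu_aff[of k "nat m" r s t] by (simp add: P_def)
next
  case False
  then show ?thesis using pd_aff[of k "nat (- m)" r s t] by (simp add: P_def)
qed

section \<open>Monomials and their products with affine forms\<close>

primrec Wp :: "int \<Rightarrow> nat \<Rightarrow> 'a kq" where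
  "Wp k 0 = e k" | "Wp k (Suc i) = Wp k i \<star> W k"

primrec Zp :: "int \<Rightarrow> nat \<Rightarrow> 'a kq" where
  "Zp k 0 = e k" | "Zp k (Suc i) = Zp k i \<star> Z k"

lemma WZp_closed [simp]: "Wp k i \<in> A" "Zp k i \<in> A"
  by (induction i) auto

lemma WZp_e [simp]: "e k \<star> Wp k i = Wp k i" "Wp k i \<star> e k = Wp k i" "Zp k i \<star> e k = Zp k i"
proof -
  show "e k \<star> Wp k i = Wp k i" by (induction i) (simp_all add: e_mult_e flip: kQ_assoc)
  show "Wp k i \<star> e k = Wp k i" "Zp k i \<star> e k = Zp k i"
    by (cases i; simp add: e_mult_e kQ_assoc)+
qed

lemma Zp_W: "Zp k i \<star> W k \<approx> W k \<star> Zp k i"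
proof (induction i)
  case (Suc i)
  have "Zp k i \<star> (Z k \<star> W k) \<approx> Zp k i \<star> (W k \<star> Z k)"
    by (intro cg_mult_left cg_sym[OF W_Z_comm]) simp
  moreover have "Zp k i \<star> W k \<star> Z k \<approx> W k \<star> Zp k i \<star> Z k"
    by (intro cg_mult_right Suc) simp
  ultimately show ?case
    unfolding Zp.simps kQ_assoc by (rule cg_trans)
qed simp

definition mon :: "nat \<times> nat \<times> nat \<times> int \<Rightarrow> 'a kq" where
  "mon = (\<lambda>(v, i, j, m). Wp (int v) i \<star> Zp (int v) j \<star> P (int v) m)"

lemma mon_closed [simp]: "mon \<mu> \<in> A"
  by (cases \<mu>) (auto simp: mon_def)

lemma mon_e [simp]: "mon (v, i, j, m) \<star> e (int v + m) = mon (v, i, j, m)"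
  "e (int v) \<star> mon (v, i, j, m) = mon (v, i, j, m)"
  by (simp add: mon_def kQ_assoc) (simp add: mon_def flip: kQ_assoc)

lemma mon_mult_other:
  assumes "vx l \<noteq> vx (int v + m)" "e l \<star> f = f"
  shows "mon (v, i, j, m) \<star> f = 0"
proof -
  have "mon (v, i, j, m) \<star> f = mon (v, i, j, m) \<star> (e (int v + m) \<star> e l) \<star> f"
    by (subst (1) assms(2)[symmetric], subst (1) mon_e(1)[symmetric]) (simp only: kQ_assoc)
  then show ?thesis using assms(1) by (simp add: e_mult_e)
qed

text \<open>The form is carried left past the path without changing its leading part; then
  \<open>Z\<close> joins its power directly, and \<open>W\<close> joins its own after commuting past
  the power of \<open>Z\<close>.\<close>

lemma mon_aff:
  "\<exists>r' s' t'. mon (v, i, j, m) \<star> aff (int v + m) r s t \<approx>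
      sc r' (mon (v, i, Suc j, m)) + sc s' (mon (v, Suc i, j, m)) + sc t' (mon (v, i, j, m)) \<and>
    same_lead r s r' s'"
proof -
  let ?k = "int v"
  obtain r' s' t' where 1: "P ?k m \<star> aff (?k + m) r s t \<approx> aff ?k r' s' t' \<star> P ?k m" "same_lead r s r' s'"
    using P_aff by blast
  have 2: "Wp ?k i \<star> (Zp ?k j \<star> W ?k) \<star> P ?k m \<approx> Wp ?k i \<star> (W ?k \<star> Zp ?k j) \<star> P ?k m"
    by (intro cg_mult_left cg_mult_right Zp_W) auto
  have 3: "mon (v, i, j, m) \<star> aff (?k + m) r s t \<approx> Wp ?k i \<star> Zp ?k j \<star> (aff ?k r' s' t' \<star> P ?k m)"
    unfolding mon_def prod.case kQ_assoc[where g = "P ?k m"] by (intro cg_mult_left 1(1)) auto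
  have 4: "Wp ?k i \<star> Zp ?k j \<star> (aff ?k r' s' t' \<star> P ?k m) =
      sc r' (mon (v, i, Suc j, m)) + sc s' (Wp ?k i \<star> (Zp ?k j \<star> W ?k) \<star> P ?k m) + sc t' (mon (v, i, j, m))"
    by (simp add: aff_def mon_def kQ_distrib) (simp add: kQ_assoc)
  have 5: "sc r' (mon (v, i, Suc j, m)) + sc s' (Wp ?k i \<star> (Zp ?k j \<star> W ?k) \<star> P ?k m) + sc t' (mon (v, i, j, m)) \<approx>
      sc r' (mon (v, i, Suc j, m)) + sc s' (mon (v, Suc i, j, m)) + sc t' (mon (v, i, j, m))"
    using 2 by (intro cg_add cg_sc cg_refl) (simp add: mon_def kQ_assoc)
  show ?thesis
    using cg_trans[OF 3[unfolded 4] 5] 1(2) by blast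
qed

end

section \<open>Leading monomials and the noetherian property\<close>

lemma nat_mono_subseq:
  fixes h :: "nat \<Rightarrow> nat"
  shows "\<exists>r :: nat \<Rightarrow> nat. strict_mono r \<and> mono (\<lambda>s. h (r s))"
proof -
  obtain r where r: "strict_mono r" "monoseq (\<lambda>s. h (r s))"
    using seq_monosub by blast
  from r(2) consider "mono (\<lambda>s. h (r s))" | "decseq (\<lambda>s. h (r s))"
    unfolding monoseq_iff incseq_def decseq_def mono_def by blast
  then show ?thesis
  proof cases
    case 2
    \<comment> \<open>A decreasing sequence of naturals is constant from its minimum on.\<close>
    obtain N where N: "\<And>s. h (r N) \<le> h (r s)"
      using ex_has_least_nat[of "\<lambda>_. True" 0 "\<lambda>s. h (r s)"] by auto
    have "h (r (N + s)) = h (r N)" for s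
      using N[of "N + s"] 2 by (intro antisym) (auto simp: decseq_def)
    then have "mono (\<lambda>s. h (r (N + s)))" by (simp add: mono_def)
    moreover have "strict_mono (\<lambda>s. r (N + s))" using r(1) by (simp add: strict_mono_def)
    ultimately show ?thesis by blast
  qed (use r(1) in blast)
qed

text \<open>Dickson's lemma for three coordinates: thinning out again keeps the monotonicity already
  achieved.\<close>

lemma nat_mono_subseq3:
  fixes h1 h2 h3 :: "nat \<Rightarrow> nat"
  shows "\<exists>r :: nat \<Rightarrow> nat. strict_mono r \<and> mono (\<lambda>s. h1 (r s)) \<and> mono (\<lambda>s. h2 (r s)) \<and> mono (\<lambda>s. h3 (r s))"
proof -
  obtain r1 :: "nat \<Rightarrow> nat" where 1: "strict_mono r1" "mono (\<lambda>s. h1 (r1 s))" using nat_mono_subseq by blast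
  obtain r2 :: "nat \<Rightarrow> nat" where 2: "strict_mono r2" "mono (\<lambda>s. h2 (r1 (r2 s)))"
    using nat_mono_subseq[of "\<lambda>s. h2 (r1 s)"] by blast
  obtain r3 :: "nat \<Rightarrow> nat" where 3: "strict_mono r3" "mono (\<lambda>s. h3 (r1 (r2 (r3 s))))"
    using nat_mono_subseq[of "\<lambda>s. h3 (r1 (r2 s))"] by blast
  have "mono r2" "mono r3" using 2 3 by (simp_all add: strict_mono_mono)
  with 1 2 3 show ?thesis
    by (intro exI[of _ "\<lambda>s. r1 (r2 (r3 s))"]) (auto simp: strict_mono_def mono_def)
qed

text \<open>Otherwise new elements keep entering; of two that are comparable in the right order, the
  later one already belonged to the stage that received the earlier one, against its choice as
  new.\<close>

lemma ascending_wqo_stabilises: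
  fixes S :: "nat \<Rightarrow> 'b set" and leq :: "'b \<Rightarrow> 'b \<Rightarrow> bool"
  assumes asc: "\<And>k. S k \<subseteq> S (Suc k)" and sub: "\<And>k. S k \<subseteq> X"
    and up: "\<And>k a b. a \<in> S k \<Longrightarrow> leq a b \<Longrightarrow> b \<in> X \<Longrightarrow> b \<in> S k"
    and wqo: "\<And>f :: nat \<Rightarrow> 'b. range f \<subseteq> X \<Longrightarrow> \<exists>s t. s < t \<and> leq (f s) (f t)"
  shows "\<exists>N. \<forall>m\<ge>N. S m = S N"
proof (rule ccontr)
  assume no: "\<nexists>N. \<forall>m\<ge>N. S m = S N"
  have mono: "s \<le> t \<Longrightarrow> S s \<subseteq> S t" for s t
    using lift_Suc_mono_le[of S] asc by blast
  have "\<forall>N. \<exists>m a. m \<ge> N \<and> a \<in> S m \<and> a \<notin> S N" using no mono by (meson subset_antisym subsetI)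
  then obtain M el where M: "\<And>N. M N \<ge> N" "\<And>N. el N \<in> S (M N)" "\<And>N. el N \<notin> S N"
    by metis
  \<comment> \<open>Iterating \<open>M\<close> places the element chosen at stage \<open>r s\<close>
    in the stage \<open>r (Suc s)\<close>, at or before every later choice.\<close>
  define r where "r = rec_nat 0 (\<lambda>_. M)"
  have r_Suc: "r (Suc s) = M (r s)" for s by (simp add: r_def)
  have r_mono: "mono r" unfolding mono_iff_le_Suc r_Suc using M(1) by blast
  obtain s t where st: "s < t" "leq (el (r s)) (el (r t))"
    using wqo[of "\<lambda>s. el (r s)"] M(2) sub by blast
  have "el (r t) \<in> S (r (Suc s))"
    using up[OF _ st(2)] M(2) sub r_Suc by (metis subset_iff)
  moreover have "r (Suc s) \<le> r t" using st(1) r_mono by (simp add: mono_def)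
  ultimately show False using mono M(3) by blast
qed

context down_up_eig
begin

section \<open>The monomial order and reduction\<close>

definition Idx :: "(nat \<times> nat \<times> nat \<times> int) set" where
  "Idx = {\<mu>. fst \<mu> < n}"

text \<open>Total degree (\<open>u\<close>, \<open>d\<close> have degree \<open>1\<close>) is compared before the net degree \<open>m\<close>, which is
  shifted by the total degree to become a natural number.\<close>

definition key :: "nat \<times> nat \<times> nat \<times> int \<Rightarrow> nat \<times> nat \<times> nat \<times> nat" where
  "key = (\<lambda>(v, i, j, m). (v, 2 * (i + j) + nat \<bar>m\<bar>, nat (m + int (2 * (i + j) + nat \<bar>m\<bar>)), j))"

lemma key_less:
  "key (v, i, j, m) < key (v', i', j', m') \<longleftrightarrow> v < v' \<or> v = v' \<and>
    (2 * (i + j) + nat \<bar>m\<bar> < 2 * (i' + j') + nat \<bar>m'\<bar> \<or>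
     2 * (i + j) + nat \<bar>m\<bar> = 2 * (i' + j') + nat \<bar>m'\<bar> \<and> (m < m' \<or> m = m' \<and> j < j'))"
  unfolding key_def by (auto simp: less_prod_simp)

lemma key_inj: "key \<mu> = key \<nu> \<Longrightarrow> \<mu> = \<nu>"
  by (cases \<mu>; cases \<nu>) (auto simp: key_def nat_eq_iff split: if_splits)

text \<open>Including the relation ideal makes the lower span invariant under congruence, so
  products may be rewritten freely.\<close>

definition low :: "nat \<times> nat \<times> nat \<times> nat \<Rightarrow> 'a kq set" where
  "low \<kappa> = kq.span (mon ` {\<nu> \<in> Idx. key \<nu> < \<kappa>} \<union> I)"

lemma low_subspace: "kq.subspace (low \<kappa>)"
  by (simp add: low_def)

lemmas low_linear [simp, intro] =
  kq.subspace_0[OF low_subspace] kq.subspace_add[OF low_subspace] kq.subspace_diff[OF low_subspace]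
  kq.subspace_scale[OF low_subspace]

lemma low_mon: "\<nu> \<in> Idx \<Longrightarrow> key \<nu> < \<kappa> \<Longrightarrow> mon \<nu> \<in> low \<kappa>"
  by (auto simp: low_def intro: kq.span_base)

lemma low_I: "f \<in> I \<Longrightarrow> f \<in> low \<kappa>"
  by (auto simp: low_def intro: kq.span_base)

lemma low_cong: "f \<approx> g \<Longrightarrow> g \<in> low \<kappa> \<Longrightarrow> f \<in> low \<kappa>"
  using low_linear(2)[of "f - g" \<kappa> g] low_I[of "f - g" \<kappa>] by (simp add: cong_I_def)

lemma low_mono: "\<kappa> \<le> \<kappa>' \<Longrightarrow> low \<kappa> \<subseteq> low \<kappa>'"
  unfolding low_def by (intro kq.span_mono) auto

lemma span_mon_I_mult:
  assumes "f \<in> kq.span (mon ` S \<union> I)" "g \<in> A" "kq.subspace T" "I \<subseteq> T" "\<And>\<nu>. \<nu> \<in> S \<Longrightarrow> mon \<nu> \<star> g \<in> T"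
  shows "f \<star> g \<in> T"
proof -
  have "kq.span (mon ` S \<union> I) \<subseteq> {f. f \<star> g \<in> T}"
  proof (rule kq.span_minimal)
    show "mon ` S \<union> I \<subseteq> {f. f \<star> g \<in> T}" using assms(2,4,5) I_mult(1) by auto
    show "kq.subspace {f. f \<star> g \<in> T}"
      by (rule kq.subspaceI)
         (auto simp: kQ_distrib intro: kq.subspace_0[OF assms(3)] kq.subspace_add[OF assms(3)]
            kq.subspace_scale[OF assms(3)])
  qed
  then show ?thesis using assms(1) by blast
qed

lemma span_mon_I_carrier: "kq.span (mon ` S \<union> I) \<subseteq> A"
  by (intro kq.span_minimal kQ_subspace) (auto simp: I_closed)

lemma mon_aff_low:
  assumes "v < n" "key (v, i, Suc j, m) < \<kappa>"
  shows "mon (v, i, j, m) \<star> aff (int v + m) r s t \<in> low \<kappa>"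
proof -
  obtain r' s' t' where *: "mon (v, i, j, m) \<star> aff (int v + m) r s t \<approx>
      sc r' (mon (v, i, Suc j, m)) + sc s' (mon (v, Suc i, j, m)) + sc t' (mon (v, i, j, m))"
    using mon_aff by blast
  have "key (v, Suc i, j, m) < key (v, i, Suc j, m)" "key (v, i, j, m) < key (v, i, Suc j, m)"
    by (auto simp: key_less)
  then have "key (v, Suc i, j, m) < \<kappa>" "key (v, i, j, m) < \<kappa>" using assms(2) less_trans by blast+
  with assms show ?thesis
    by (intro low_cong[OF *] low_linear low_mon) (auto simp: Idx_def)
qed

text \<open>Here the eigenvector pays off: no \<open>Z\<close>-term arises. Such a term would
  outrank the expected monomial, since \<open>j\<close> breaks ties in the order.\<close>

lemma mon_W:
  assumes "v < n"
  shows "\<exists>r\<noteq>0. mon (v, i, j, m) \<star> W (int v + m) - sc r (mon (v, Suc i, j, m)) \<in> low (key (v, Suc i, j, m))"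
proof -
  obtain r s t where *: "mon (v, i, j, m) \<star> W (int v + m) \<approx>
      sc r (mon (v, i, Suc j, m)) + sc s (mon (v, Suc i, j, m)) + sc t (mon (v, i, j, m))"
      "same_lead 0 1 r s"
    using mon_aff[of v i j m 0 1 0] unfolding W_aff by blast
  then have rs: "r = 0" "s \<noteq> 0" by (auto simp: same_lead_def)
  have "mon (v, i, j, m) \<star> W (int v + m) - sc s (mon (v, Suc i, j, m)) \<approx> sc t (mon (v, i, j, m))"
    using *(1) by (simp add: cong_I_def rs algebra_simps)
  moreover have "sc t (mon (v, i, j, m)) \<in> low (key (v, Suc i, j, m))"
    using assms by (intro low_linear low_mon) (auto simp: Idx_def key_less)
  ultimately show ?thesis using rs(2) low_cong by blast
qed

lemma mon_Z:
  assumes "v < n"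
  shows "\<exists>r\<noteq>0. mon (v, i, j, m) \<star> Z (int v + m) - sc r (mon (v, i, Suc j, m)) \<in> low (key (v, i, Suc j, m))"
proof -
  obtain r s t where *: "mon (v, i, j, m) \<star> Z (int v + m) \<approx>
      sc r (mon (v, i, Suc j, m)) + sc s (mon (v, Suc i, j, m)) + sc t (mon (v, i, j, m))"
      "same_lead 1 0 r s"
    using mon_aff[of v i j m 1 0 0] unfolding Z_aff by blast
  then have r: "r \<noteq> 0" by (auto simp: same_lead_def)
  have "mon (v, i, j, m) \<star> Z (int v + m) - sc r (mon (v, i, Suc j, m)) \<approx>
      sc s (mon (v, Suc i, j, m)) + sc t (mon (v, i, j, m))"
    using *(1) by (simp add: cong_I_def algebra_simps)
  moreover have "sc s (mon (v, Suc i, j, m)) + sc t (mon (v, i, j, m)) \<in> low (key (v, i, Suc j, m))"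
    using assms by (intro low_linear low_mon) (auto simp: Idx_def key_less)
  ultimately show ?thesis using r low_cong by blast
qed

lemma mon_u:
  "m \<ge> 0 \<Longrightarrow> mon (v, i, j, m) \<star> u (int v + m) = mon (v, i, j, m + 1)"
  "m < 0 \<Longrightarrow> mon (v, i, j, m) \<star> u (int v + m) = mon (v, i, j, m + 1) \<star> y (int v + (m + 1))"
  by (simp_all add: mon_def kQ_assoc P_u P_u_neg add.assoc)

lemma mon_d:
  "m \<le> 0 \<Longrightarrow> mon (v, i, j, m) \<star> d (int v + m - 1) = mon (v, i, j, m - 1)"
  "m > 0 \<Longrightarrow> mon (v, i, j, m) \<star> d (int v + m - 1) = mon (v, i, j, m - 1) \<star> x (int v + (m - 1))"
  by (simp_all add: mon_def kQ_assoc P_d P_d_pos add_diff_eq)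

text \<open>For \<open>m \<ge> 0\<close> the path gets longer. For \<open>m < 0\<close> it
  backtracks and leaves a factor \<open>y\<close>, an affine form, whose top monomial raises
  \<open>j\<close>; hence the two different bounds.\<close>

lemma mon_u_low:
  assumes "v < n" "m \<ge> 0 \<Longrightarrow> key (v, i, j, m + 1) < \<kappa>" "m < 0 \<Longrightarrow> key (v, i, Suc j, m + 1) < \<kappa>"
  shows "mon (v, i, j, m) \<star> u l \<in> low \<kappa>"
proof (cases "vx l = vx (int v + m)")
  case True
  have "mon (v, i, j, m) \<star> u (int v + m) \<in> low \<kappa>"
  proof (cases "m \<ge> 0")
    case True
    then show ?thesis using assms by (simp add: mon_u low_mon Idx_def)
  next
    case False
    then show ?thesis
      using assms mon_aff_low[of v i j "m + 1"] by (simp add: mon_u lin_y lin_aff)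
  qed
  then show ?thesis using euds_cong(2)[OF True] by simp
qed (use mon_mult_other in simp)

lemma mon_d_low:
  assumes "v < n" "m \<le> 0 \<Longrightarrow> key (v, i, j, m - 1) < \<kappa>" "m > 0 \<Longrightarrow> key (v, i, Suc j, m - 1) < \<kappa>"
  shows "mon (v, i, j, m) \<star> d (l - 1) \<in> low \<kappa>"
proof (cases "vx l = vx (int v + m)")
  case True
  have "mon (v, i, j, m) \<star> d (int v + m - 1) \<in> low \<kappa>"
  proof (cases "m \<le> 0")
    case True
    then show ?thesis using assms by (simp add: mon_d low_mon Idx_def)
  next
    case False
    then show ?thesis
      using assms mon_aff_low[of v i j "m - 1"] by (simp add: mon_d lin_x lin_aff)
  qed
  moreover have "d (l - 1) = d (int v + m - 1)"
    using euds_cong(3)[OF vx_eq_add[OF True, of "-1"]] by simp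
  ultimately show ?thesis by simp
qed (use mon_mult_other[of l v m "d (l - 1)"] in simp)

lemma mon_W_low:
  assumes "v < n" "key (v, Suc i, j, m) < \<kappa>"
  shows "mon (v, i, j, m) \<star> W l \<in> low \<kappa>"
proof (cases "vx l = vx (int v + m)")
  case True
  obtain r where "mon (v, i, j, m) \<star> W (int v + m) - sc r (mon (v, Suc i, j, m)) \<in> low (key (v, Suc i, j, m))"
    using mon_W[OF assms(1)] by blast
  then have "mon (v, i, j, m) \<star> W (int v + m) - sc r (mon (v, Suc i, j, m)) \<in> low \<kappa>"
    using low_mono[OF less_imp_le[OF assms(2)]] by blast
  moreover have "sc r (mon (v, Suc i, j, m)) \<in> low \<kappa>"
    using assms by (intro low_linear low_mon) (auto simp: Idx_def)
  ultimately have "mon (v, i, j, m) \<star> W (int v + m) \<in> low \<kappa>"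
    by (metis low_linear(2) diff_add_cancel)
  then show ?thesis using WZ_cong(1)[OF True] by simp
qed (use mon_mult_other in simp)

lemma mon_Z_low:
  assumes "v < n" "key (v, i, Suc j, m) < \<kappa>"
  shows "mon (v, i, j, m) \<star> Z l \<in> low \<kappa>"
proof (cases "vx l = vx (int v + m)")
  case True
  then show ?thesis
    using WZ_cong(2)[OF True] mon_aff_low[OF assms] by (simp add: Z_aff)
qed (use mon_mult_other in simp)

text \<open>The span contains the vertices and is stable under appending an arrow on the right, so
  it contains all paths.\<close>

lemma carrier_span_mon: "A = kq.span (mon ` Idx \<union> I)"
proof
  show "kq.span (mon ` Idx \<union> I) \<subseteq> A" by (rule span_mon_I_carrier)
  let ?T = "kq.span (mon ` Idx \<union> I)"
  have low_T: "low \<kappa> \<subseteq> ?T" for \<kappa> unfolding low_def by (intro kq.span_mono) auto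
  have I_T: "I \<subseteq> ?T" by (auto intro: kq.span_base)
  have u: "mon \<nu> \<star> u l \<in> ?T" if "\<nu> \<in> Idx" for \<nu> l
  proof (cases \<nu>)
    case (fields v i j m)
    \<comment> \<open>The key is only a bound that is large enough in both cases of
      \<open>mon_u_low\<close>.\<close>
    have "mon \<nu> \<star> u l \<in> low (key (v, i, Suc (Suc j), \<bar>m\<bar> + 1))"
      unfolding fields using that by (intro mon_u_low) (auto simp: key_less Idx_def fields)
    then show ?thesis using low_T by blast
  qed
  have d: "mon \<nu> \<star> d l \<in> ?T" if "\<nu> \<in> Idx" for \<nu> l
  proof (cases \<nu>)
    case (fields v i j m)
    have "mon \<nu> \<star> d (l + 1 - 1) \<in> low (key (v, i, Suc (Suc j), \<bar>m\<bar> + 1))"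
      unfolding fields using that by (intro mon_d_low) (auto simp: key_less Idx_def fields)
    then show ?thesis using low_T[of "key (v, i, Suc (Suc j), \<bar>m\<bar> + 1)"] by auto
  qed
  have "pth (v, xs) \<in> ?T" if "valid_path n (v, xs)" for v xs
    using that
  proof (induction xs rule: rev_induct)
    case Nil
    then have "v < n" by (simp add: valid_path_def)
    then have "pth (v, []) = mon (v, 0, 0, 0)"
      by (simp add: mon_def e_mult_e) (simp add: e_def)
    moreover have "mon (v, 0, 0, 0) \<in> ?T"
      using \<open>v < n\<close> by (intro kq.span_base) (auto simp: Idx_def)
    ultimately show ?case by simp
  next
    case (snoc z xs)
    then have IH: "pth (v, xs) \<in> ?T" and z: "arr_idx z < n" "src n z = path_tgt n v xs"
      by (auto simp: valid_path_def)
    show ?case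
    proof (cases z)
      case (U i)
      then have "pth (v, xs @ [z]) = pth (v, xs) \<star> u (int i)"
        using z by (simp add: u_def pth_mult)
      then show ?thesis using span_mon_I_mult[OF IH _ kq.subspace_span I_T u] by simp
    next
      case (D i)
      then have "pth (v, xs @ [z]) = pth (v, xs) \<star> d (int i)"
        using z Suc_vx[of "int i"] by (simp add: d_def pth_mult)
      then show ?thesis using span_mon_I_mult[OF IH _ kq.subspace_span I_T d] by simp
    qed
  qed
  then show "A \<subseteq> ?T"
    unfolding kQ_carrier_span by (intro kq.span_minimal) auto
qed

lemma span_mon_I_explicit:
  assumes "f \<in> kq.span (mon ` S \<union> I)"
  shows "\<exists>t T. finite T \<and> T \<subseteq> S \<and> (\<forall>\<mu>\<in>T. t \<mu> \<noteq> 0) \<and> f \<approx> (\<Sum>\<mu>\<in>T. sc (t \<mu>) (mon \<mu>))"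
proof -
  obtain g h where gh: "f = g + h" "g \<in> kq.span (mon ` S)" "h \<in> kq.span I"
    using assms unfolding kq.span_Un by auto
  have h: "h \<in> I" using gh(3) I_subspace by (simp add: kq.span_eq_iff[THEN iffD2])
  obtain t0 T0 where T0: "finite T0" "T0 \<subseteq> mon ` S" "g = (\<Sum>a\<in>T0. sc (t0 a) a)"
    using gh(2) unfolding kq.span_explicit by blast
  obtain T where T: "T \<subseteq> S" "inj_on mon T" "T0 = mon ` T"
    using T0(2) unfolding subset_image_inj by blast
  have fin: "finite T" using T0(1) T(2,3) by (simp add: finite_image_iff)
  let ?T = "{\<mu> \<in> T. t0 (mon \<mu>) \<noteq> 0}"
  have "g = (\<Sum>\<mu>\<in>T. sc (t0 (mon \<mu>)) (mon \<mu>))"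
    unfolding T0(3) T(3) by (simp add: sum.reindex[OF T(2)])
  also have "\<dots> = (\<Sum>\<mu>\<in>?T. sc (t0 (mon \<mu>)) (mon \<mu>))"
    using fin by (intro sum.mono_neutral_right) auto
  finally have "f \<approx> (\<Sum>\<mu>\<in>?T. sc (t0 (mon \<mu>)) (mon \<mu>))"
    using gh(1) h by (simp add: cong_I_def)
  then show ?thesis
    using fin T(1) by (intro exI[of _ "\<lambda>\<mu>. t0 (mon \<mu>)"] exI[of _ ?T]) auto
qed

text \<open>Keys are injective, so the term with the largest key is single. The set \<open>S\<close>
  is a parameter because the descent in \<open>LM_eq_imp_eq\<close> needs a leading monomial below a
  given key.\<close>

lemma leading_monomial:
  assumes "f \<in> kq.span (mon ` S \<union> I)" "S \<subseteq> Idx" "f \<notin> I"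
  shows "\<exists>\<mu>\<in>S. \<exists>r. r \<noteq> 0 \<and> f - sc r (mon \<mu>) \<in> low (key \<mu>)"
proof -
  obtain t T where T: "finite T" "T \<subseteq> S" "\<forall>\<mu>\<in>T. t \<mu> \<noteq> 0" "f \<approx> (\<Sum>\<mu>\<in>T. sc (t \<mu>) (mon \<mu>))"
    using span_mon_I_explicit[OF assms(1)] by blast
  have "T \<noteq> {}" using T(4) assms(3) by (auto simp: cong_I_def)
  then have "Max (key ` T) \<in> key ` T" using T(1) by (intro Max_in) auto
  then obtain \<mu> where max: "\<mu> \<in> T" "Max (key ` T) = key \<mu>" by blast
  have \<mu>: "\<mu> \<in> T" "\<And>\<nu>. \<nu> \<in> T \<Longrightarrow> key \<nu> \<le> key \<mu>"
    using max(1) Max_ge[of "key ` T", unfolded max(2)] T(1) by auto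
  have eq: "(\<Sum>\<nu>\<in>T. sc (t \<nu>) (mon \<nu>)) = sc (t \<mu>) (mon \<mu>) + (\<Sum>\<nu>\<in>T - {\<mu>}. sc (t \<nu>) (mon \<nu>))"
    using \<mu>(1) T(1) by (simp add: sum.remove)
  have "(\<Sum>\<nu>\<in>T - {\<mu>}. sc (t \<nu>) (mon \<nu>)) \<in> low (key \<mu>)"
  proof (intro kq.subspace_sum[OF low_subspace] low_linear low_mon)
    fix \<nu> assume "\<nu> \<in> T - {\<mu>}"
    then show "\<nu> \<in> Idx" "key \<nu> < key \<mu>"
      using \<mu>(2)[of \<nu>] key_inj[of \<nu> \<mu>] T(2) assms(2) by (auto simp: order_less_le)
  qed
  moreover have "f - sc (t \<mu>) (mon \<mu>) \<approx> (\<Sum>\<nu>\<in>T - {\<mu>}. sc (t \<nu>) (mon \<nu>))"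
    using T(4) unfolding eq by (simp add: cong_I_def algebra_simps)
  ultimately have "f - sc (t \<mu>) (mon \<mu>) \<in> low (key \<mu>)" using low_cong by blast
  then show ?thesis using \<mu>(1) T(2,3) by blast
qed

text \<open>The existential form lets an element have any monomial as leading one that some
  expansion allows.\<close>

definition LM :: "'a kq set \<Rightarrow> (nat \<times> nat \<times> nat \<times> int) set" where
  "LM J = {\<mu> \<in> Idx. \<exists>f\<in>J. f - mon \<mu> \<in> low (key \<mu>)}"

text \<open>Right multiplication by \<open>g\<close> transports a leading monomial as soon as
  everything below it lands below the new one; rescaling restores coefficient 1.\<close>

lemma LM_step:
  assumes J: "rid J" and \<mu>: "\<mu> \<in> LM J" and \<mu>': "\<mu>' \<in> Idx" and g: "g \<in> A"
    and lower: "\<And>\<nu>. \<nu> \<in> Idx \<Longrightarrow> key \<nu> < key \<mu> \<Longrightarrow> mon \<nu> \<star> g \<in> low (key \<mu>')"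
    and top: "\<exists>r\<noteq>0. mon \<mu> \<star> g - sc r (mon \<mu>') \<in> low (key \<mu>')"
  shows "\<mu>' \<in> LM J"
proof -
  obtain f where f: "f \<in> J" "f - mon \<mu> \<in> low (key \<mu>)" using \<mu> by (auto simp: LM_def)
  obtain r where r: "r \<noteq> 0" "mon \<mu> \<star> g - sc r (mon \<mu>') \<in> low (key \<mu>')" using top by blast
  have "(f - mon \<mu>) \<star> g \<in> low (key \<mu>')"
    using f(2) unfolding low_def[of "key \<mu>"]
    by (rule span_mon_I_mult[OF _ g low_subspace]) (auto simp: low_I lower)
  with r(2) have "(f - mon \<mu>) \<star> g + (mon \<mu> \<star> g - sc r (mon \<mu>')) \<in> low (key \<mu>')" by blast
  then have "sc (1 / r) (f \<star> g - sc r (mon \<mu>')) \<in> low (key \<mu>')"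
    by (simp add: kQ_distrib_diff)
  then have "sc (1 / r) (f \<star> g) - mon \<mu>' \<in> low (key \<mu>')"
    using r(1) by (simp add: kq.scale_right_diff_distrib)
  moreover have "sc (1 / r) (f \<star> g) \<in> J"
    using J f(1) g by (auto simp: rid_def intro!: kq.subspace_scale)
  ultimately show ?thesis using \<mu>' by (auto simp: LM_def)
qed

text \<open>An arrow is used only where it lengthens the path, away from net degree 0: there the
  product of the leading monomial with it is again a monomial.\<close>

lemma LM_closed:
  assumes J: "rid J" and \<mu>: "(v, i, j, m) \<in> LM J"
  shows "(v, Suc i, j, m) \<in> LM J" "(v, i, Suc j, m) \<in> LM J"
    and "m \<ge> 0 \<Longrightarrow> (v, i, j, m + 1) \<in> LM J" "m \<le> 0 \<Longrightarrow> (v, i, j, m - 1) \<in> LM J"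
proof -
  have v: "v < n" using \<mu> by (auto simp: LM_def Idx_def)
  show "(v, Suc i, j, m) \<in> LM J"
  proof (rule LM_step[OF J \<mu>])
    show "W (int v + m) \<in> A" by simp
    show "mon \<nu> \<star> W (int v + m) \<in> low (key (v, Suc i, j, m))"
      if "\<nu> \<in> Idx" "key \<nu> < key (v, i, j, m)" for \<nu>
      using that by (cases \<nu>) (auto intro!: mon_W_low simp: Idx_def key_less)
  qed (use v mon_W in \<open>auto simp: Idx_def\<close>)
  show "(v, i, Suc j, m) \<in> LM J"
  proof (rule LM_step[OF J \<mu>])
    show "Z (int v + m) \<in> A" by simp
    show "mon \<nu> \<star> Z (int v + m) \<in> low (key (v, i, Suc j, m))"
      if "\<nu> \<in> Idx" "key \<nu> < key (v, i, j, m)" for \<nu>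
      using that by (cases \<nu>) (auto intro!: mon_Z_low simp: Idx_def key_less)
  qed (use v mon_Z in \<open>auto simp: Idx_def\<close>)
  show "(v, i, j, m + 1) \<in> LM J" if m: "m \<ge> 0"
  proof (rule LM_step[OF J \<mu>])
    show "u (int v + m) \<in> A" by simp
    show "mon \<nu> \<star> u (int v + m) \<in> low (key (v, i, j, m + 1))"
      if "\<nu> \<in> Idx" "key \<nu> < key (v, i, j, m)" for \<nu>
    proof (cases \<nu>)
      case (fields v' i' j' m')
      \<comment> \<open>At equal total degree \<open>m' \<le> m\<close>. If \<open>m' < 0\<close>
        the product acquires a further \<open>Z\<close>, but then \<open>m' < m\<close>, and net
        degree outranks \<open>j\<close> in the key.\<close>
      show ?thesis
        using that m unfolding fields key_less by (intro mon_u_low) (auto simp: Idx_def key_less)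
    qed
    show "\<exists>r\<noteq>0. mon (v, i, j, m) \<star> u (int v + m) - sc r (mon (v, i, j, m + 1)) \<in> low (key (v, i, j, m + 1))"
      by (rule exI[of _ 1]) (simp add: mon_u m)
  qed (use v in \<open>auto simp: Idx_def\<close>)
  show "(v, i, j, m - 1) \<in> LM J" if m: "m \<le> 0"
  proof (rule LM_step[OF J \<mu>])
    show "d (int v + m - 1) \<in> A" by simp
    show "mon \<nu> \<star> d (int v + m - 1) \<in> low (key (v, i, j, m - 1))"
      if "\<nu> \<in> Idx" "key \<nu> < key (v, i, j, m)" for \<nu>
    proof (cases \<nu>)
      case (fields v' i' j' m')
      \<comment> \<open>At equal total degree \<open>m' \<le> m \<le> 0\<close>, so the down-arrow
        lengthens this path as well; backtracking occurs only at smaller total degree.\<close>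
      show ?thesis
        using that m unfolding fields key_less by (intro mon_d_low) (auto simp: Idx_def key_less)
    qed
    show "\<exists>r\<noteq>0. mon (v, i, j, m) \<star> d (int v + m - 1) - sc r (mon (v, i, j, m - 1)) \<in> low (key (v, i, j, m - 1))"
      by (rule exI[of _ 1]) (simp add: mon_d m)
  qed (use v in \<open>auto simp: Idx_def\<close>)
qed

text \<open>The net degree may only move away from 0, matching the steps that
  \<open>LM_closed\<close> permits.\<close>

fun mon_le :: "nat \<times> nat \<times> nat \<times> int \<Rightarrow> nat \<times> nat \<times> nat \<times> int \<Rightarrow> bool" where
  "mon_le (v, i, j, m) (v', i', j', m') \<longleftrightarrow>
    v = v' \<and> i \<le> i' \<and> j \<le> j' \<and> (0 \<le> m \<and> m \<le> m' \<or> m' \<le> m \<and> m \<le> 0)"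

lemma LM_up:
  assumes J: "rid J" and "\<mu> \<in> LM J" "mon_le \<mu> \<nu>"
  shows "\<nu> \<in> LM J"
proof -
  obtain v i j m i' j' m' where \<mu>: "\<mu> = (v, i, j, m)" and \<nu>: "\<nu> = (v, i', j', m')"
    and le: "i \<le> i'" "j \<le> j'" "0 \<le> m \<and> m \<le> m' \<or> m' \<le> m \<and> m \<le> 0"
    using assms(3) by (cases \<mu>; cases \<nu>) auto
  have "(v, i', j, m) \<in> LM J"
    using le(1) assms(2) unfolding \<mu> by (induction rule: dec_induct) (auto intro: LM_closed[OF J])
  with le(2) have "(v, i', j', m) \<in> LM J"
    by (induction rule: dec_induct) (auto intro: LM_closed[OF J])
  moreover have "m \<le> m' \<Longrightarrow> 0 \<le> m \<Longrightarrow> (v, i', j', m) \<in> LM J \<Longrightarrow> (v, i', j', m') \<in> LM J"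
    by (induction m' rule: int_ge_induct) (auto intro: LM_closed[OF J])
  moreover have "m' \<le> m \<Longrightarrow> m \<le> 0 \<Longrightarrow> (v, i', j', m) \<in> LM J \<Longrightarrow> (v, i', j', m') \<in> LM J"
    by (induction m' rule: int_le_induct) (auto intro: LM_closed[OF J])
  ultimately show ?thesis using le(3) unfolding \<nu> by blast
qed

text \<open>The pigeonhole principle fixes the vertex and the sign of the net degree; Dickson's
  lemma handles the two exponents and the absolute value.\<close>

lemma mon_le_wqo:
  fixes f :: "nat \<Rightarrow> nat \<times> nat \<times> nat \<times> int"
  assumes "range f \<subseteq> Idx"
  shows "\<exists>s t. s < t \<and> mon_le (f s) (f t)"
proof -
  define fv fi fj fm where "fv s = fst (f s)" and "fi s = fst (snd (f s))"
    and "fj s = fst (snd (snd (f s)))" and "fm s = snd (snd (snd (f s)))" for s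
  have f: "f s = (fv s, fi s, fj s, fm s)" for s
    by (simp add: fv_def fi_def fj_def fm_def)
  have "fv s < n" for s using assms by (auto simp: Idx_def fv_def)
  then have "range (\<lambda>s. (fv s, 0 \<le> fm s)) \<subseteq> {..<n} \<times> UNIV" by auto
  then have "finite (range (\<lambda>s. (fv s, 0 \<le> fm s)))"
    by (rule finite_subset) auto
  then obtain s0 where "infinite {s. (fv s, 0 \<le> fm s) = (fv s0, 0 \<le> fm s0)}"
    using pigeonhole_infinite[of UNIV "\<lambda>s. (fv s, 0 \<le> fm s)"] by auto
  then obtain r :: "nat \<Rightarrow> nat" where r: "strict_mono r" "\<And>s. (fv (r s), 0 \<le> fm (r s)) = (fv s0, 0 \<le> fm s0)"
    using infinite_enumerate[of "{s. (fv s, 0 \<le> fm s) = (fv s0, 0 \<le> fm s0)}"] by auto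
  obtain r' :: "nat \<Rightarrow> nat" where r': "strict_mono r'" "mono (\<lambda>s. fi (r (r' s)))" "mono (\<lambda>s. fj (r (r' s)))"
      "mono (\<lambda>s. nat \<bar>fm (r (r' s))\<bar>)"
    using nat_mono_subseq3[of "\<lambda>s. fi (r s)" "\<lambda>s. fj (r s)" "\<lambda>s. nat \<bar>fm (r s)\<bar>"] by blast
  let ?s = "r (r' 0)" and ?t = "r (r' 1)"
  have "?s < ?t" using r(1) r'(1) by (simp add: strict_mono_def)
  moreover have "fi ?s \<le> fi ?t" "fj ?s \<le> fj ?t" "nat \<bar>fm ?s\<bar> \<le> nat \<bar>fm ?t\<bar>"
    using r'(2-4) by (simp_all add: mono_def)
  then have "mon_le (f ?s) (f ?t)"
    unfolding f using r(2)[of "r' 0"] r(2)[of "r' 1"] by auto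
  ultimately show ?thesis by blast
qed

text \<open>Reduction by descent on keys: subtracting a multiple of an element of \<open>J\<close>
  with the same leading monomial leaves an element of \<open>J'\<close> that lies in the relation
  ideal or leads with a smaller key.\<close>

lemma LM_eq_imp_eq:
  assumes J: "rid J" "rid J'" "J \<subseteq> J'" and LM: "LM J' \<subseteq> LM J"
  shows "J = J'"
proof -
  have "f \<in> J" if "f \<in> J'" "\<mu> \<in> Idx" "r \<noteq> 0" "f - sc r (mon \<mu>) \<in> low (key \<mu>)" for f \<mu> r
    using that
  proof (induction "key \<mu>" arbitrary: f \<mu> r rule: less_induct)
    case less
    have "sc (1 / r) (f - sc r (mon \<mu>)) \<in> low (key \<mu>)" using less.prems(4) by blast
    then have "sc (1 / r) f - mon \<mu> \<in> low (key \<mu>)"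
      using less.prems(3) by (simp add: kq.scale_right_diff_distrib)
    moreover have "sc (1 / r) f \<in> J'"
      using J(2) less.prems(1) by (auto simp: rid_def intro!: kq.subspace_scale)
    ultimately have "\<mu> \<in> LM J" using LM less.prems(2) by (auto simp: LM_def)
    then obtain g where g: "g \<in> J" "g - mon \<mu> \<in> low (key \<mu>)" by (auto simp: LM_def)
    define h where "h = f - sc r g"
    have "f - sc r (mon \<mu>) - sc r (g - mon \<mu>) \<in> low (key \<mu>)" using g(2) less.prems(4) by blast
    then have h_low: "h \<in> low (key \<mu>)" by (simp add: h_def kq.scale_right_diff_distrib)
    have sub: "kq.subspace J" "kq.subspace J'" using J(1,2) by (auto simp: rid_def)
    have "sc r g \<in> J" using g(1) sub kq.subspace_scale by blast
    then have h_J': "h \<in> J'"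
      unfolding h_def using less.prems(1) J(3) sub kq.subspace_diff by blast
    have "h \<in> J"
    proof (cases "h \<in> I")
      case True
      then show ?thesis using J(1) by (auto simp: rid_def)
    next
      case False
      then obtain \<nu> s where "\<nu> \<in> Idx" "key \<nu> < key \<mu>" "s \<noteq> 0" "h - sc s (mon \<nu>) \<in> low (key \<nu>)"
        using leading_monomial[of h "{\<nu> \<in> Idx. key \<nu> < key \<mu>}"] h_low unfolding low_def[of "key \<mu>"] by blast
      then show ?thesis using less.hyps h_J' by blast
    qed
    then have "h + sc r g \<in> J" using \<open>sc r g \<in> J\<close> sub kq.subspace_add by blast
    then show ?case by (simp add: h_def)
  qed
  moreover have "f \<in> I \<or> (\<exists>\<mu>\<in>Idx. \<exists>r. r \<noteq> 0 \<and> f - sc r (mon \<mu>) \<in> low (key \<mu>))" if "f \<in> J'" for f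
  proof -
    have "f \<in> A" using that J(2) by (auto simp: rid_def)
    then show ?thesis using leading_monomial[of f Idx] carrier_span_mon by blast
  qed
  moreover have "I \<subseteq> J" using J(1) by (simp add: rid_def)
  ultimately have "J' \<subseteq> J" by blast
  then show ?thesis using J(3) by blast
qed

lemma acc_rid: "acc rid"
  unfolding acc_def
proof (intro allI impI; elim conjE)
  fix C :: "nat \<Rightarrow> 'a kq set"
  assume C: "\<forall>k. rid (C k)" "\<forall>k. C k \<subseteq> C (Suc k)"
  have "\<exists>N. \<forall>m\<ge>N. LM (C m) = LM (C N)"
  proof (rule ascending_wqo_stabilises[of _ Idx mon_le])
    show "LM (C k) \<subseteq> LM (C (Suc k))" for k using C(2) by (auto simp: LM_def)
    show "LM (C k) \<subseteq> Idx" for k by (auto simp: LM_def)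
    show "\<nu> \<in> LM (C k)" if "\<mu> \<in> LM (C k)" "mon_le \<mu> \<nu>" for k \<mu> \<nu>
      using LM_up[OF _ that] C(1) by blast
  qed (rule mon_le_wqo)
  then obtain N where N: "\<And>m. m \<ge> N \<Longrightarrow> LM (C m) = LM (C N)" by blast
  have "C m = C N" if "m \<ge> N" for m
  proof -
    have "C N \<subseteq> C m" using that C(2) lift_Suc_mono_le[of C] by blast
    then show ?thesis using LM_eq_imp_eq[of "C N" "C m"] C(1) N[OF that] by blast
  qed
  then show "\<exists>N. \<forall>m\<ge>N. C m = C N" by blast
qed

end

section \<open>Existence of the eigenvectors\<close>

text \<open>If \<open>C = 0\<close> the first basis vector works. Otherwise the second coordinate is
  set to 1; the eigenvalue must then be \<open>C t + D\<close>, which leaves the quadratic equation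
  \<open>C t^2 + (D - A) t - B = 0\<close>.\<close>

lemma algebraically_closed_eigenvector:
  fixes A B C D :: "'k::field"
  assumes "algebraically_closed TYPE('k)"
  shows "\<exists>r s l. (r \<noteq> 0 \<or> s \<noteq> 0) \<and> A * r + B * s = l * r \<and> C * r + D * s = l * s"
proof (cases "C = 0")
  case True
  then show ?thesis by (intro exI[of _ 1] exI[of _ 0] exI[of _ A]) simp
next
  case False
  obtain t where "t ^ 2 + (\<Sum>j<2. (if j = 0 then - B / C else (D - A) / C) * t ^ j) = 0"
    using assms[unfolded algebraically_closed_def, rule_format, of 2 "\<lambda>j. if j = 0 then - B / C else (D - A) / C"]
    by auto
  then have "t * t + (- B / C + (D - A) / C * t) = 0"
    by (simp add: numeral_2_eq_2)
  then have "(C * (t * t) - B + (D - A) * t) / C = 0"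
    using False by (simp add: add_divide_distrib diff_divide_distrib left_diff_distrib add_diff_eq diff_add_eq)
  then have "C * (t * t) - B + (D - A) * t = 0"
    using False by simp
  then have "A * t + B * 1 = (C * t + D) * t"
    by (simp add: algebra_simps)
  then show ?thesis
    by (intro exI[of _ t] exI[of _ 1] exI[of _ "C * t + D"]) simp
qed

context down_up_nz
begin

text \<open>The linear part of the substitution in \<open>u_lin\<close>, from forms at
  \<open>k + 1\<close> to forms at \<open>k\<close>.\<close>

definition pull :: "int \<Rightarrow> 'a \<times> 'a \<Rightarrow> 'a \<times> 'a" where
  "pull k = (\<lambda>(r, s). (s - r * a k / b k, r / b k))"

text \<open>The index counts the distance to the vertex \<open>n\<close>, identified with \<open>0\<close>.\<close>
primrec transport :: "'a \<times> 'a \<Rightarrow> nat \<Rightarrow> 'a \<times> 'a" where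
  "transport w 0 = w"
| "transport w (Suc r) = pull (int n - int r - 1) (transport w r)"

lemma pull_eq_0_iff: "pull k w = (0, 0) \<longleftrightarrow> w = (0, 0)"
  using b_nz[of k] by (cases w) (auto simp: pull_def)

lemma transport_eq_0_iff: "transport w r = (0, 0) \<longleftrightarrow> w = (0, 0)"
  by (induction r) (simp_all add: pull_eq_0_iff)

lemma transport_linear:
  "\<exists>A B C D. \<forall>r s. transport (r, s) l = (A * r + B * s, C * r + D * s)"
proof (induction l)
  case 0
  show ?case by (intro exI[of _ 1] exI[of _ 0]) simp
next
  case (Suc l)
  then obtain A B C D where "\<And>r s. transport (r, s) l = (A * r + B * s, C * r + D * s)" by blast
  then show ?case
    using b_nz
    by (intro exI[of _ "C - A * a (int n - int l - 1) / b (int n - int l - 1)"]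
        exI[of _ "D - B * a (int n - int l - 1) / b (int n - int l - 1)"]
        exI[of _ "A / b (int n - int l - 1)"] exI[of _ "B / b (int n - int l - 1)"])
       (simp add: pull_def field_simps)
qed

lemma eigen_data:
  assumes "algebraically_closed TYPE('a)"
  shows "\<exists>p q p' q' ev. down_up_eig n \<alpha> \<beta> p q p' q' ev"
proof -
  obtain A B C D where T: "\<And>r s. transport (r, s) n = (A * r + B * s, C * r + D * s)"
    using transport_linear by blast
  obtain r0 s0 l where w: "r0 \<noteq> 0 \<or> s0 \<noteq> 0" "transport (r0, s0) n = (l * r0, l * s0)"
    using algebraically_closed_eigenvector[OF assms, of A B C D] T by metis
  \<comment> \<open>The number of steps lies between 1 and \<open>n\<close>; at vertex 0 it is
    \<open>n\<close>, so the vector stored there is \<open>l\<close> times the starting one.\<close>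
  define p where "p k = fst (transport (r0, s0) (n - vx k))" for k
  define q where "q k = snd (transport (r0, s0) (n - vx k))" for k
  \<comment> \<open>The simplest completion to determinant one, dividing by whichever coordinate is
    nonzero.\<close>
  define p' where "p' k = (if p k = 0 then - 1 / q k else 0)" for k
  define q' where "q' k = (if p k = 0 then 0 else 1 / p k)" for k
  \<comment> \<open>The whole eigenvalue sits on the arrow from \<open>n - 1\<close> to 0, where the
    transported family has to close up.\<close>
  define ev where "ev k = (if vx k = n - 1 then l else 1)" for k
  have pq: "transport (r0, s0) (n - vx k) = (p k, q k)" for k by (simp add: p_def q_def)
  have nz: "p k \<noteq> 0 \<or> q k \<noteq> 0" for k
    using transport_eq_0_iff[of "(r0, s0)" "n - vx k"] w(1) unfolding pq by auto
  have pull: "pull k (p (k + 1), q (k + 1)) = (ev k * p k, ev k * q k)" for k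
  proof (cases "vx k = n - 1")
    case True
    have "vx (k + 1) = 0" using Suc_vx[of k] True n_pos by simp
    then have 1: "(p (k + 1), q (k + 1)) = (l * r0, l * s0)"
      using pq[of "k + 1"] w(2) by simp
    have "vx (k + 1) = vx (int n)" using \<open>vx (k + 1) = 0\<close> by (simp add: vx_def)
    then have "vx (int n - 1) = vx k" using vx_eq_add[of "k + 1" "int n" "-1"] by simp
    then have "pull (int n - 1) = pull k" by (simp add: pull_def)
    moreover have "n - vx k = Suc 0" using True n_pos by simp
    ultimately have 2: "(p k, q k) = pull k (r0, s0)" using pq[of k] by simp
    have "pull k (l * r0, l * s0) = (l * fst (pull k (r0, s0)), l * snd (pull k (r0, s0)))"
      by (simp add: pull_def algebra_simps)
    then show ?thesis unfolding 1 2[symmetric] by (simp add: ev_def True)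
  next
    case False
    define r where "r = n - vx (k + 1)"
    have v: "vx (k + 1) = Suc (vx k)" using False Suc_vx[of k] vx_less[of k] by simp
    then have r: "n - vx k = Suc r" "int n - int r - 1 = int (vx k)"
      using vx_less[of "k + 1"] vx_less[of k] by (auto simp: r_def)
    have "pull (int (vx k)) = pull k" by (simp add: pull_def)
    then have "(p k, q k) = pull k (p (k + 1), q (k + 1))"
      unfolding pq[symmetric] r(1) by (simp only: transport.simps r(2)) (simp add: r_def)
    then show ?thesis using False by (simp add: ev_def)
  qed
  have "down_up_eig n \<alpha> \<beta> p q p' q' ev"
  proof unfold_locales
    fix k l
    show "p k * q' k - q k * p' k = 1" using nz[of k] by (auto simp: p'_def q'_def)
    show "vx k = vx l \<Longrightarrow> p k = p l \<and> q k = q l \<and> p' k = p' l \<and> q' k = q' l"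
      by (simp add: p_def q_def p'_def q'_def)
    show "q (k + 1) - p (k + 1) * a k / b k = ev k * p k" "p (k + 1) / b k = ev k * q k"
      using pull[of k] by (simp_all add: pull_def)
  qed
  then show ?thesis by blast
qed

lemma right_noetherian_nz:
  assumes "algebraically_closed TYPE('a)"
  shows "acc rid"
proof -
  obtain p q p' q' ev where "down_up_eig n \<alpha> \<beta> p q p' q' ev" using eigen_data[OF assms] by blast
  then interpret down_up_eig n \<alpha> \<beta> \<gamma> p q p' q' ev .
  show ?thesis by (rule acc_rid)
qed

end

section \<open>Generic weights and the domain property\<close>

definition poly2 :: "'k::comm_ring_1 poly poly \<Rightarrow> 'k \<Rightarrow> 'k \<Rightarrow> 'k" where
  "poly2 F X Y = poly (poly F [:X:]) Y"

lemma poly2_simps: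
  "poly2 (F + G) X Y = poly2 F X Y + poly2 G X Y"
  "poly2 (F * G) X Y = poly2 F X Y * poly2 G X Y"
  "poly2 [:[:r:]:] X Y = r"
  by (simp_all add: poly2_def)

text \<open>A nonzero polynomial over a domain has finitely many roots. This is used for the field
  and then for the domain of one-variable polynomials, which contains infinitely many
  constants.\<close>

lemma poly2_eq_0:
  fixes F :: "'k::idom poly poly"
  assumes inf: "infinite (UNIV :: 'k set)" and F: "\<And>X Y. poly2 F X Y = 0"
  shows "F = 0"
proof -
  have "poly F [:X:] = 0" for X
  proof (rule ccontr)
    assume "poly F [:X:] \<noteq> 0"
    from poly_roots_finite[OF this] inf show False
      using F by (simp add: poly2_def)
  qed
  then have "range (\<lambda>X. [:X:]) \<subseteq> {G. poly F G = 0}" by auto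
  moreover have "infinite (range (\<lambda>X :: 'k. [:X:]))"
    using inf by (simp add: finite_image_iff inj_on_def)
  ultimately have "infinite {G. poly F G = 0}" using infinite_super by blast
  then show "F = 0" using poly_roots_finite[of F] by blast
qed

lemma monomials_independent:
  fixes t :: "nat \<times> nat \<Rightarrow> 'k::idom"
  assumes inf: "infinite (UNIV :: 'k set)" and S: "finite S"
    and zero: "\<And>X Y. (\<Sum>s\<in>S. t s * (X ^ fst s * Y ^ snd s)) = 0" and s: "s \<in> S"
  shows "t s = 0"
proof -
  define F where "F = (\<Sum>s\<in>S. monom (monom (t s) (snd s)) (fst s))"
  have "poly2 F X Y = (\<Sum>s\<in>S. t s * (X ^ fst s * Y ^ snd s))" for X Y
    by (simp add: poly2_def F_def poly_sum poly_monom algebra_simps)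
  then have "F = 0" using zero by (intro poly2_eq_0 inf) simp
  moreover have "coeff (coeff F (fst s)) (snd s) = (\<Sum>s'\<in>S. if s' = s then t s' else 0)"
    unfolding F_def coeff_sum by (intro sum.cong) (auto simp: prod_eq_iff)
  ultimately show ?thesis using S s by simp
qed

context down_up
begin

lemma act_one: "act r s \<one>\<^bsub>kQ n\<^esub> g = g"
proof
  fix m
  have "act r s (e m \<star> \<one>\<^bsub>kQ n\<^esub>) g m = act r s (e m) g m" by simp
  then show "act r s \<one>\<^bsub>kQ n\<^esub> g m = g m"
    unfolding act_mult[OF euds_closed(1) kQ_one_closed] act_gens by simp
qed

lemma act_pow:
  assumes "f \<in> A" "\<And>g m. vx m = vx k \<Longrightarrow> act r s f g m = h m * g m" "vx m = vx k"
  shows "act r s (f [^]\<^bsub>kQ n\<^esub> (i :: nat)) g m = h m ^ i * g m"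
  using assms(3)
proof (induction i arbitrary: g)
  case (Suc i)
  then show ?case using assms(1,2) by (simp add: act_mult)
qed (simp add: act_one)

end

context down_up_nz
begin

section \<open>Solutions of the weight recurrence\<close>

definition Sol :: "(int \<Rightarrow> 'a) set" where
  "Sol = {s. \<forall>m. s (m - 1) = a m * s m + b m * s (m + 1) + c m}"

text \<open>With up-steps equal to one, the shift in \<open>q\<close> makes \<open>s m\<close> the
  weight of \<open>x\<close> at \<open>m\<close> and \<open>s (m - 1)\<close> that of
  \<open>y\<close>.\<close>

lemma Sol_wt_mod: "s \<in> Sol \<Longrightarrow> wt_mod (\<lambda>_. 1) (\<lambda>m. s (m - 1))"
  unfolding Sol_def wt_mod_def
proof (intro allI disjI2)
  fix m assume "s \<in> {s. \<forall>m. s (m - 1) = a m * s m + b m * s (m + 1) + c m}"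
  then have "s (m - 1) = a m * s m + b m * s (m + 1) + c m" by blast
  moreover have "m + 1 - 1 = m" "m + 2 - 1 = m + 1" by simp_all
  ultimately show "1 * s (m - 1) = a m * (1 * s (m + 1 - 1)) + b m * (1 * s (m + 2 - 1)) + c m"
    by (simp only: mult_1)
qed

text \<open>\<open>fwd k X Y r\<close> is the weight at \<open>k - 1 + r\<close> and
  \<open>bwd k X Y r\<close> that at \<open>k - r\<close>; both start from the values at
  \<open>k - 1\<close> and \<open>k\<close>. Going forward is what needs \<open>b\<close>
  invertible.\<close>

fun fwd :: "int \<Rightarrow> 'a \<Rightarrow> 'a \<Rightarrow> nat \<Rightarrow> 'a" where
  "fwd k X Y 0 = Y"
| "fwd k X Y (Suc 0) = X"
| "fwd k X Y (Suc (Suc r)) =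
    (fwd k X Y r - a (k + int r) * fwd k X Y (Suc r) - c (k + int r)) / b (k + int r)"

fun bwd :: "int \<Rightarrow> 'a \<Rightarrow> 'a \<Rightarrow> nat \<Rightarrow> 'a" where
  "bwd k X Y 0 = X"
| "bwd k X Y (Suc 0) = Y"
| "bwd k X Y (Suc (Suc r)) = a (k - int r - 1) * bwd k X Y (Suc r) + b (k - int r - 1) * bwd k X Y r + c (k - int r - 1)"

lemma Sol_exists: "\<exists>s\<in>Sol. s k = X \<and> s (k - 1) = Y"
proof -
  define s where "s t = (if t \<ge> k then fwd k X Y (nat (t - k + 1)) else bwd k X Y (nat (k - t)))" for t
  have fwd: "s (k - 1 + int r) = fwd k X Y r" for r
    by (cases r) (auto simp: s_def nat_add_distrib)
  have bwd: "s (k - int r) = bwd k X Y r" for r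
    by (cases "r = 0") (simp_all add: s_def)
  have "s (m - 1) = a m * s m + b m * s (m + 1) + c m" for m
  proof (cases "m \<ge> k")
    case True
    define r where "r = nat (m - k)"
    have m: "m = k + int r" using True by (simp add: r_def)
    have "s (m - 1) = fwd k X Y r" "s m = fwd k X Y (Suc r)" "s (m + 1) = fwd k X Y (Suc (Suc r))"
      unfolding fwd[symmetric] by (simp_all add: m algebra_simps)
    then show ?thesis using b_nz[of m] by (simp add: m)
  next
    case False
    define r where "r = nat (k - m - 1)"
    have m: "m = k - int r - 1" using False by (simp add: r_def)
    have "s (m - 1) = bwd k X Y (Suc (Suc r))" "s m = bwd k X Y (Suc r)" "s (m + 1) = bwd k X Y r"
      unfolding bwd[symmetric] by (simp_all add: m algebra_simps)
    then show ?thesis by (simp add: m)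
  qed
  then have "s \<in> Sol" by (simp add: Sol_def)
  moreover have "s k = X" "s (k - 1) = Y" using fwd[of 1] fwd[of 0] by simp_all
  ultimately show ?thesis by blast
qed

text \<open>Polynomiality is demanded only on solutions, where \<open>s 0\<close> and
  \<open>s (- 1)\<close> are free coordinates by \<open>Sol_exists\<close>.\<close>

definition PF :: "((int \<Rightarrow> 'a) \<Rightarrow> 'a) set" where
  "PF = {f. \<exists>F. \<forall>s\<in>Sol. f s = poly2 F (s 0) (s (- 1))}"

lemma PF_const: "(\<lambda>s. r) \<in> PF"
  unfolding PF_def by (auto intro!: exI[of _ "[:[:r:]:]"] simp: poly2_simps)

lemma PF_add: "f \<in> PF \<Longrightarrow> g \<in> PF \<Longrightarrow> (\<lambda>s. f s + g s) \<in> PF"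
  unfolding PF_def by (clarsimp, rename_tac F G, rule_tac x = "F + G" in exI) (simp add: poly2_simps)

lemma PF_mult: "f \<in> PF \<Longrightarrow> g \<in> PF \<Longrightarrow> (\<lambda>s. f s * g s) \<in> PF"
  unfolding PF_def by (clarsimp, rename_tac F G, rule_tac x = "F * G" in exI) (simp add: poly2_simps)

lemma PF_power: "f \<in> PF \<Longrightarrow> (\<lambda>s. f s ^ i) \<in> PF"
  by (induction i) (auto intro: PF_const PF_mult)

lemma PF_sum: "(\<And>i. i \<in> S \<Longrightarrow> f i \<in> PF) \<Longrightarrow> (\<lambda>s. \<Sum>i\<in>S. f i s) \<in> PF"
  by (induction S rule: infinite_finite_induct) (auto intro: PF_const PF_add)

lemma PF_cong: "f \<in> PF \<Longrightarrow> (\<And>s. s \<in> Sol \<Longrightarrow> f s = g s) \<Longrightarrow> g \<in> PF"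
  unfolding PF_def by auto

text \<open>The recurrence can be solved for the next weight and for the previous one; carrying two
  neighbours along lets the induction run both ways.\<close>

lemma PF_eval: "(\<lambda>s. s m) \<in> PF"
proof -
  have "(\<lambda>s. s m) \<in> PF \<and> (\<lambda>s. s (m - 1)) \<in> PF"
  proof (induction m rule: int_induct[of _ 0])
    case base
    have "(\<lambda>s. s 0) \<in> PF" unfolding PF_def
      by (auto intro!: exI[of _ "[:0, 1:]"] simp: poly2_def)
    moreover have "(\<lambda>s. s (- 1)) \<in> PF" unfolding PF_def
      by (auto intro!: exI[of _ "[:[:0, 1:]:]"] simp: poly2_def)
    ultimately show ?case by simp
  next
    case (step1 m)
    have "(\<lambda>s. 1 / b m * s (m - 1) + ((- a m / b m) * s m + (- c m / b m))) \<in> PF"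
      using step1 by (intro PF_add PF_mult PF_const) auto
    then have "(\<lambda>s. s (m + 1)) \<in> PF"
    proof (rule PF_cong)
      fix s assume "s \<in> Sol"
      then have "s (m - 1) = a m * s m + b m * s (m + 1) + c m" by (simp add: Sol_def)
      then show "1 / b m * s (m - 1) + ((- a m / b m) * s m + (- c m / b m)) = s (m + 1)"
        using b_nz[of m] by (simp add: field_simps)
    qed
    with step1 show ?case by simp
  next
    case (step2 m)
    have "(\<lambda>s. a (m - 1) * s (m - 1) + (b (m - 1) * s m + c (m - 1))) \<in> PF"
      using step2 by (intro PF_add PF_mult PF_const) auto
    then have "(\<lambda>s. s (m - 2)) \<in> PF"
    proof (rule PF_cong)
      fix s assume "s \<in> Sol"
      then have "s (m - 1 - 1) = a (m - 1) * s (m - 1) + b (m - 1) * s (m - 1 + 1) + c (m - 1)"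
        unfolding Sol_def by blast
      then show "a (m - 1) * s (m - 1) + (b (m - 1) * s m + c (m - 1)) = s (m - 2)" by simp
    qed
    with step2 show ?case by simp
  qed
  then show ?thesis by blast
qed

definition PF0 :: "((int \<Rightarrow> 'a) \<Rightarrow> 'a) set" where
  "PF0 = {f \<in> PF. \<exists>s\<in>Sol. f s \<noteq> 0}"

text \<open>Every pair of values occurs as \<open>s 0\<close>, \<open>s (- 1)\<close>, so a
  vanishing product on solutions is a vanishing product of polynomials, and these form a
  domain.\<close>

lemma PF0_mult:
  assumes "f \<in> PF0" "g \<in> PF0"
  shows "(\<lambda>s. f s * g s) \<in> PF0"
proof (rule ccontr)
  assume "(\<lambda>s. f s * g s) \<notin> PF0"
  then have zero: "\<And>s. s \<in> Sol \<Longrightarrow> f s * g s = 0"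
    using assms PF_mult by (auto simp: PF0_def)
  obtain F G where FG: "\<And>s. s \<in> Sol \<Longrightarrow> f s = poly2 F (s 0) (s (- 1))"
      "\<And>s. s \<in> Sol \<Longrightarrow> g s = poly2 G (s 0) (s (- 1))"
    using assms unfolding PF0_def PF_def by blast
  have "poly2 (F * G) X Y = 0" for X Y
  proof -
    obtain s where "s \<in> Sol" "s 0 = X" "s (- 1) = Y" using Sol_exists[of 0 X Y] by auto
    then show ?thesis using zero[of s] FG[of s] by (simp add: poly2_simps)
  qed
  then have "F * G = 0" by (intro poly2_eq_0 infinite_field)
  then have "F = 0 \<or> G = 0" by simp
  then show False
    using assms FG by (auto simp: PF0_def poly2_def)
qed

lemma PF0_prod: "finite S \<Longrightarrow> (\<And>i. i \<in> S \<Longrightarrow> f i \<in> PF0) \<Longrightarrow> (\<lambda>s. \<Prod>i\<in>S. f i s) \<in> PF0"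
proof (induction S rule: finite_induct)
  case empty
  show ?case using PF_const[of 1] Sol_exists[of 0 0 0] by (auto simp: PF0_def)
next
  case (insert i S)
  then have "(\<lambda>s. f i s * (\<Prod>i\<in>S. f i s)) \<in> PF0" by (intro PF0_mult) auto
  then show ?case using insert by simp
qed

lemma PF0_eval: "(\<lambda>s. s m) \<in> PF0"
proof -
  obtain s where "s \<in> Sol" "s m = 1" using Sol_exists[of m 1 0] by blast
  then show ?thesis using PF_eval by (auto simp: PF0_def intro!: bexI[of _ s])
qed

text \<open>On the constant function 1, evaluated at position \<open>i\<close>, \<open>x\<close> and
  \<open>y\<close> act by the weights \<open>s i\<close> and \<open>s (i - 1)\<close>, which are
  arbitrary; a linear relation among monomials would be a polynomial vanishing at all
  points.\<close>

lemma poly_ring: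
  assumes "i < n"
  shows "poly_ring_two_vars n \<alpha> \<beta> \<gamma> i"
  unfolding poly_ring_iff[OF assms]
proof (intro conjI allI impI)
  let ?k = "int i"
  show "x ?k \<star> y ?k \<approx> y ?k \<star> x ?k" by (rule x_y_comm)
  fix t :: "nat \<times> nat \<Rightarrow> 'a" and s0
  assume fin: "finite {s. t s \<noteq> 0}" and zero: "(\<Sum>s | t s \<noteq> 0. sc (t s) (xy_mon ?k s)) \<in> I"
  have *: "(\<Sum>l | t l \<noteq> 0. t l * (X ^ fst l * Y ^ snd l)) = 0" for X Y
  proof -
    obtain s where s: "s \<in> Sol" "s ?k = X" "s (?k - 1) = Y" using Sol_exists by blast
    let ?q = "\<lambda>m. s (m - 1)"
    have mon: "act (\<lambda>_. 1) ?q (xy_mon ?k l) (\<lambda>_. 1) ?k = X ^ fst l * Y ^ snd l" for l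
    proof (cases l)
      case (Pair l1 l2)
      have "act (\<lambda>_. 1) ?q (x ?k [^]\<^bsub>kQ n\<^esub> l1) g ?k = s ?k ^ l1 * g ?k" for g
        by (rule act_pow[where h = s and k = ?k]) (auto simp: act_x)
      moreover have "act (\<lambda>_. 1) ?q (y ?k [^]\<^bsub>kQ n\<^esub> l2) g ?k = s (?k - 1) ^ l2 * g ?k" for g
        by (rule act_pow[where h = "\<lambda>m. s (m - 1)" and k = ?k]) (auto simp: act_y)
      ultimately show ?thesis by (simp add: Pair xy_mon_def act_mult act_gens s)
    qed
    have "act (\<lambda>_. 1) ?q (\<Sum>l | t l \<noteq> 0. sc (t l) (xy_mon ?k l)) (\<lambda>_. 1) ?k = 0"
      using act_I[OF Sol_wt_mod[OF s(1)] zero] by simp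
    then show ?thesis by (simp add: act_sum act_sc mon)
  qed
  show "t s0 = 0"
    using monomials_independent[OF infinite_field fin *, of s0] by (cases "t s0 = 0") auto
qed

end

context down_up_eig
begin

section \<open>Values of monomials on weight modules\<close>

definition wv :: "(int \<Rightarrow> 'a) \<Rightarrow> int \<Rightarrow> 'a" where "wv s m = p m * s m + q m * s (m - 1)"
definition zv :: "(int \<Rightarrow> 'a) \<Rightarrow> int \<Rightarrow> 'a" where "zv s m = p' m * s m + q' m * s (m - 1)"
definition pv :: "(int \<Rightarrow> 'a) \<Rightarrow> int \<Rightarrow> int \<Rightarrow> 'a" where
  "pv s m l = (if l \<ge> 0 then 1 else \<Prod>i<nat (- l). s (m - int i - 1))"

abbreviation sact :: "(int \<Rightarrow> 'a) \<Rightarrow> 'a kq \<Rightarrow> (int \<Rightarrow> 'a) \<Rightarrow> int \<Rightarrow> 'a" where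
  "sact s \<equiv> act (\<lambda>_. 1) (\<lambda>m. s (m - 1))"

lemma act_W: "sact s (W k) g m = (if vx m = vx k then wv s m * g m else 0)"
  using periodic[of m k]
  by (auto simp: W_def lin_def act_add act_sc act_x act_y act_gens wv_def algebra_simps)

lemma act_Z: "sact s (Z k) g m = (if vx m = vx k then zv s m * g m else 0)"
  using periodic[of m k]
  by (auto simp: Z_def lin_def act_add act_sc act_x act_y act_gens zv_def algebra_simps)

lemma act_Wp: "sact s (Wp k i) g m = (if vx m = vx k then wv s m ^ i * g m else 0)"
  by (induction i arbitrary: g) (auto simp: act_gens act_mult act_W)

lemma act_Zp: "sact s (Zp k i) g m = (if vx m = vx k then zv s m ^ i * g m else 0)"
  by (induction i arbitrary: g) (auto simp: act_gens act_mult act_Z)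

lemma act_P: "sact s (P k l) g m = (if vx m = vx k then pv s m l * g (m + l) else 0)"
  by (auto simp: P_def act_pu act_pd pv_def)

lemma act_mon:
  "v < n \<Longrightarrow> sact s (mon (v, i, j, l)) g m =
    (if vx m = v then wv s m ^ i * zv s m ^ j * pv s m l * g (m + l) else 0)"
  by (simp add: mon_def act_mult act_Wp act_Zp act_P)

lemma pv_PF0: "(\<lambda>s. pv s m l) \<in> PF0"
proof (cases "l \<ge> 0")
  case True
  then show ?thesis using PF0_prod[of "{}"] by (simp add: pv_def)
next
  case False
  then show ?thesis
    using PF0_prod[of "{..<nat (- l)}" "\<lambda>i s. s (m - int i - 1)"] PF0_eval by (simp add: pv_def)
qed

definition wz_sum :: "(nat \<times> nat \<Rightarrow> 'a) \<Rightarrow> (nat \<times> nat) set \<Rightarrow> int \<Rightarrow> (int \<Rightarrow> 'a) \<Rightarrow> 'a" where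
  "wz_sum t S m s = (\<Sum>(i, j)\<in>S. t (i, j) * (wv s m ^ i * zv s m ^ j))"

lemma wz_sum_PF0:
  assumes "finite S" "l \<in> S" "t l \<noteq> 0"
  shows "wz_sum t S m \<in> PF0"
proof -
  have "(\<lambda>s. \<Sum>l\<in>S. t l * (wv s m ^ fst l * zv s m ^ snd l)) \<in> PF"
    unfolding wv_def zv_def by (intro PF_sum PF_mult PF_add PF_power PF_eval PF_const)
  then have PF: "wz_sum t S m \<in> PF"
    unfolding wz_sum_def by (simp add: case_prod_beta')
  obtain X Y where XY: "(\<Sum>l\<in>S. t l * (X ^ fst l * Y ^ snd l)) \<noteq> 0"
    using monomials_independent[OF infinite_field assms(1) _ assms(2), of t] assms(3) by blast
  \<comment> \<open>The weights solve the 2-by-2 system that prescribes the values \<open>X\<close>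
    of \<open>W\<close> and \<open>Y\<close> of \<open>Z\<close>.\<close>
  obtain s where s: "s \<in> Sol" "s m = X * q' m - Y * q m" "s (m - 1) = Y * p m - X * p' m"
    using Sol_exists by blast
  have "wv s m = X * (p m * q' m - q m * p' m)" "zv s m = Y * (p m * q' m - q m * p' m)"
    unfolding wv_def zv_def s by (simp_all add: algebra_simps)
  then have "wv s m = X" "zv s m = Y" by (simp_all add: det)
  then have "wz_sum t S m s \<noteq> 0" using XY by (simp add: wz_sum_def case_prod_beta)
  then show ?thesis using PF s(1) by (auto simp: PF0_def)
qed

text \<open>Each monomial begins and ends at definite vertices, so passing to a corner keeps it or
  kills it.\<close>

lemma corner_span:
  assumes "f \<in> A"
  shows "e k \<star> f \<star> e l \<in> kq.span (mon ` {(v, i, j, m). v = vx k \<and> vx (k + m) = vx l} \<union> I)"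
proof -
  define S where "S = {(v, i :: nat, j :: nat, m). v = vx k \<and> vx (k + m) = vx l}"
  let ?T = "kq.span (mon ` S \<union> I)"
  have sub: "kq.subspace ?T" by simp
  have I_T: "I \<subseteq> ?T" by (auto intro: kq.span_base)
  have "kq.span (mon ` Idx \<union> I) \<subseteq> {f. e k \<star> f \<star> e l \<in> ?T}"
  proof (rule kq.span_minimal)
    show "kq.subspace {f. e k \<star> f \<star> e l \<in> ?T}"
      by (rule kq.subspaceI)
         (auto simp: kQ_distrib intro: kq.subspace_0[OF sub] kq.subspace_add[OF sub] kq.subspace_scale[OF sub])
    have "e k \<star> mon \<mu> \<star> e l \<in> ?T" if "\<mu> \<in> Idx" for \<mu>
    proof (cases \<mu>)
      case (fields v i j m)
      have v: "vx (int v) = v" using that by (simp add: fields Idx_def)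
      show ?thesis
      proof (cases "v = vx k \<and> vx (k + m) = vx l")
        case True
        then have "e k = e (int v)" by (intro euds_cong) (simp add: v)
        moreover have "vx (int v + m) = vx l"
          using True vx_eq_add[of "int v" k m] v by simp
        then have "e l = e (int v + m)" by (intro euds_cong) simp
        ultimately have "e k \<star> mon \<mu> \<star> e l = mon \<mu>" by (simp add: fields)
        then show ?thesis using True by (auto simp: fields S_def intro!: kq.span_base)
      next
        case False
        show ?thesis
        proof (cases "v = vx k")
          case True
          then have "vx l \<noteq> vx (int v + m)"
            using False vx_eq_add[of "int v" k m] v by auto
          then have "mon \<mu> \<star> e l = 0"
            unfolding fields by (rule mon_mult_other) (simp add: e_mult_e)
          then show ?thesis using kq.subspace_0[OF sub] by (simp add: kQ_assoc)
        next
          case False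
          then have "e k \<star> e (int v) = 0" using v by (auto simp: e_mult_e)
          then have "e k \<star> (e (int v) \<star> mon \<mu>) = 0" by (simp flip: kQ_assoc)
          then have "e k \<star> mon \<mu> = 0" by (simp add: fields)
          then show ?thesis using kq.subspace_0[OF sub] by simp
        qed
      qed
    qed
    then show "mon ` Idx \<union> I \<subseteq> {f. e k \<star> f \<star> e l \<in> ?T}"
      using I_T I_mult by auto
  qed
  then show ?thesis unfolding S_def[symmetric] using assms carrier_span_mon by blast
qed

text \<open>\<open>M\<close> is the top net degree of \<open>e\<^sub>k f e\<^sub>l\<close> and \<open>F\<close> its leading coefficient, evaluated on weights.\<close>
lemma corner_leading:
  assumes "f \<in> A" "e k \<star> f \<star> e l \<notin> I"
  shows "\<exists>M F. F \<in> PF0 \<and> vx (k + M) = vx l \<and>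
    (\<forall>s\<in>Sol. \<forall>h. (\<forall>m<k + M. h m = 0) \<longrightarrow> sact s (e k \<star> f \<star> e l) h k = F s * h (k + M) \<and>
       (\<forall>m<k. sact s (e k \<star> f \<star> e l) h m = 0))"
proof -
  obtain t T where T: "finite T" "T \<subseteq> {(v, i, j, m). v = vx k \<and> vx (k + m) = vx l}"
      "\<forall>\<mu>\<in>T. t \<mu> \<noteq> 0" "e k \<star> f \<star> e l \<approx> (\<Sum>\<mu>\<in>T. sc (t \<mu>) (mon \<mu>))"
    using span_mon_I_explicit[OF corner_span[OF assms(1), of k l]] by (elim exE conjE) (rule that)
  define dg :: "nat \<times> nat \<times> nat \<times> int \<Rightarrow> int" where "dg = (\<lambda>(v, i, j, m). m)"
  have "T \<noteq> {}" using T(4) assms(2) by (auto simp: cong_I_def)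
  then have max: "Max (dg ` T) \<in> dg ` T" using T(1) by (intro Max_in) auto
  define M where "M = Max (dg ` T)"
  obtain \<mu>0 where \<mu>0: "\<mu>0 \<in> T" "dg \<mu>0 = M" using max by (auto simp: M_def)
  have dg_le: "\<And>\<mu>. \<mu> \<in> T \<Longrightarrow> dg \<mu> \<le> M" unfolding M_def using T(1) by auto
  define S where "S = {(i, j). (vx k, i, j, M) \<in> T}"
  have inj: "inj_on (\<lambda>(i, j). (vx k, i, j, M)) S" by (auto simp: inj_on_def)
  have img: "(\<lambda>(i, j). (vx k, i, j, M)) ` S = {\<mu> \<in> T. dg \<mu> = M}"
    using T(2) by (auto simp: S_def dg_def image_iff)
  have finS: "finite S"
    by (rule finite_imageD[OF _ inj]) (simp add: img T(1))
  define t' where "t' = (\<lambda>(i, j). t (vx k, i, j, M))"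
  obtain i0 j0 where "\<mu>0 = (vx k, i0, j0, M)"
    using \<mu>0 T(2) by (cases \<mu>0) (auto simp: dg_def)
  then have S0: "(i0, j0) \<in> S" "t' (i0, j0) \<noteq> 0" using \<mu>0 T(3) by (auto simp: S_def t'_def)
  define F where "F = (\<lambda>s. wz_sum t' S k s * pv s k M)"
  have F: "F \<in> PF0"
    unfolding F_def by (intro PF0_mult pv_PF0 wz_sum_PF0[where l = "(i0, j0)"] finS S0)
  have vx_M: "vx (k + M) = vx l" using \<mu>0 T(2) by (auto simp: dg_def)
  have act_eq: "sact s (e k \<star> f \<star> e l) h m = (\<Sum>\<mu>\<in>T. t \<mu> * sact s (mon \<mu>) h m)" if "s \<in> Sol" for s h m
  proof -
    have "sact s (e k \<star> f \<star> e l - (\<Sum>\<mu>\<in>T. sc (t \<mu>) (mon \<mu>))) h m = 0"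
      using act_I[OF Sol_wt_mod[OF that]] T(4) by (simp add: cong_I_def)
    then show ?thesis
      using assms(1) by (simp add: act_diff act_sum act_sc)
  qed
  have "sact s (e k \<star> f \<star> e l) h k = F s * h (k + M) \<and> (\<forall>m<k. sact s (e k \<star> f \<star> e l) h m = 0)"
    if s: "s \<in> Sol" and h: "\<forall>m<k + M. h m = 0" for s h
  proof
    \<comment> \<open>A monomial of net degree \<open>m\<close> reads \<open>h\<close> at
      \<open>k + m\<close>, where \<open>h\<close> vanishes unless \<open>m\<close> is the top
      degree.\<close>
    have "(\<Sum>\<mu>\<in>T. t \<mu> * sact s (mon \<mu>) h k) = (\<Sum>\<mu>\<in>{\<mu> \<in> T. dg \<mu> = M}. t \<mu> * sact s (mon \<mu>) h k)"
    proof (rule sum.mono_neutral_right[OF T(1)])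
      show "\<forall>\<mu>\<in>T - {\<mu> \<in> T. dg \<mu> = M}. t \<mu> * sact s (mon \<mu>) h k = 0"
      proof
        fix \<mu> assume \<mu>: "\<mu> \<in> T - {\<mu> \<in> T. dg \<mu> = M}"
        then have "dg \<mu> < M" using dg_le[of \<mu>] by auto
        obtain v i j m where fields: "\<mu> = (v, i, j, m)" by (cases \<mu>)
        have "h (k + m) = 0" using h \<open>dg \<mu> < M\<close> by (simp add: fields dg_def)
        moreover have "v < n" using \<mu> T(2) by (auto simp: fields)
        ultimately show "t \<mu> * sact s (mon \<mu>) h k = 0" by (simp add: act_mon fields)
      qed
    qed auto
    also have "\<dots> = (\<Sum>(i, j)\<in>S. t (vx k, i, j, M) * sact s (mon (vx k, i, j, M)) h k)"
      unfolding img[symmetric] by (subst sum.reindex[OF inj]) (simp add: case_prod_beta')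
    also have "\<dots> = F s * h (k + M)"
      by (simp add: F_def wz_sum_def act_mon t'_def sum_distrib_right case_prod_beta' mult.assoc)
    finally show "sact s (e k \<star> f \<star> e l) h k = F s * h (k + M)" using act_eq[OF s] by simp
    show "\<forall>m<k. sact s (e k \<star> f \<star> e l) h m = 0"
    proof (intro allI impI)
      fix m assume m: "m < k"
      have "t \<mu> * sact s (mon \<mu>) h m = 0" if \<mu>: "\<mu> \<in> T" for \<mu>
      proof (cases \<mu>)
        case (fields v i j m')
        then have "h (m + m') = 0" using h m dg_le[OF \<mu>] by (simp add: dg_def)
        moreover have "v < n" using \<mu> T(2) fields by auto
        ultimately show ?thesis by (simp add: fields act_mon)
      qed
      then show "sact s (e k \<star> f \<star> e l) h m = 0" unfolding act_eq[OF s] by (rule sum.neutral[OF ballI])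
    qed
  qed
  then show ?thesis using F vx_M by blast
qed

text \<open>Leading coefficients multiply: tested on the function concentrated at one position, a
  product of two nonzero corner elements takes the value \<open>F s * G s\<close>, and
  \<open>PF0_mult\<close> supplies weights at which it is nonzero.\<close>

lemma piecewise_domain: "piecewise_domain H n (eH n \<alpha> \<beta> \<gamma>)"
  unfolding piecewise_domain_iff
proof (intro allI ballI impI)
  fix k l m f g
  assume fg: "f \<in> A" "g \<in> A" and prod: "(e k \<star> f \<star> e l) \<star> (e l \<star> g \<star> e m) \<in> I"
  show "e k \<star> f \<star> e l \<in> I \<or> e l \<star> g \<star> e m \<in> I"
  proof (rule ccontr)
    assume not: "\<not> (e k \<star> f \<star> e l \<in> I \<or> e l \<star> g \<star> e m \<in> I)"
    then obtain M F where F: "F \<in> PF0" "vx (k + M) = vx l"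
      "\<And>s h. s \<in> Sol \<Longrightarrow> \<forall>m<k + M. h m = 0 \<Longrightarrow> sact s (e k \<star> f \<star> e l) h k = F s * h (k + M)"
      using corner_leading[OF fg(1), of k l] by blast
    \<comment> \<open>The two factors must meet at one integer position, so the second is expanded
      at \<open>k + M\<close>, which lies above the same vertex as \<open>l\<close>.\<close>
    have el: "e (k + M) = e l" using F(2) by (rule euds_cong)
    with not obtain N G where G: "G \<in> PF0"
      "\<And>s h. s \<in> Sol \<Longrightarrow> \<forall>m<k + M + N. h m = 0 \<Longrightarrow>
         sact s (e l \<star> g \<star> e m) h (k + M) = G s * h (k + M + N) \<and>
         (\<forall>m'<k + M. sact s (e l \<star> g \<star> e m) h m' = 0)"
      using corner_leading[OF fg(2), of "k + M" m] unfolding el by blast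
    obtain s where s: "s \<in> Sol" "F s * G s \<noteq> 0"
      using PF0_mult[OF F(1) G(1)] by (auto simp: PF0_def)
    let ?h = "\<lambda>t. if t = k + M + N then 1 else 0 :: 'a"
    have "sact s ((e k \<star> f \<star> e l) \<star> (e l \<star> g \<star> e m)) ?h k = F s * G s"
      using fg F(3)[OF s(1), of "sact s (e l \<star> g \<star> e m) ?h"] G(2)[OF s(1), of ?h]
      by (simp add: act_mult del: mult_eq_0_iff)
    then show False
      using act_I[OF Sol_wt_mod[OF s(1)] prod] s(2) by simp
  qed
qed

end

context down_up_nz
begin

lemma piecewise_domain_nz:
  assumes "algebraically_closed TYPE('a)"
  shows "piecewise_domain H n (eH n \<alpha> \<beta> \<gamma>)"
proof -
  obtain p q p' q' ev where "down_up_eig n \<alpha> \<beta> p q p' q' ev" using eigen_data[OF assms] by blast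
  then interpret down_up_eig n \<alpha> \<beta> \<gamma> p q p' q' ev .
  show ?thesis by (rule piecewise_domain)
qed

end

theorem theorem4p2:
  fixes n :: nat and \<alpha> \<beta> \<gamma> :: "nat \<Rightarrow> 'k::field_char_0"
  assumes "algebraically_closed TYPE('k)"
    and "n \<ge> 1"
  shows "((\<forall>i<n. \<beta> i \<noteq> 0) \<longleftrightarrow> right_noetherian (HH n \<alpha> \<beta> \<gamma>))
       \<and> ((\<forall>i<n. \<beta> i \<noteq> 0) \<longleftrightarrow> left_noetherian (HH n \<alpha> \<beta> \<gamma>))
       \<and> ((\<forall>i<n. \<beta> i \<noteq> 0) \<longleftrightarrow> (\<forall>i<n. poly_ring_two_vars n \<alpha> \<beta> \<gamma> i))
       \<and> ((\<forall>i<n. \<beta> i \<noteq> 0) \<longleftrightarrow> piecewise_domain (HH n \<alpha> \<beta> \<gamma>) n (eH n \<alpha> \<beta> \<gamma>))"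
proof -
  interpret down_up n \<alpha> \<beta> \<gamma> by unfold_locales (rule assms(2))
  show ?thesis
  proof (cases "\<forall>i<n. \<beta> i \<noteq> 0")
    case True
    interpret down_up_nz n \<alpha> \<beta> \<gamma>
      using True infinite_UNIV_char_0 by unfold_locales auto
    show ?thesis
      using True poly_ring right_noetherian_nz[OF assms(1)] piecewise_domain_nz[OF assms(1)]
      by (simp add: right_noetherian_iff left_noetherian_iff acc_lid_iff_acc_rid)
  next
    case False
    then obtain i where i: "i < n" "\<beta> i = 0" by blast
    interpret down_up_zero n \<alpha> \<beta> \<gamma> "int i"
      using i by unfold_locales simp
    show ?thesis
      using False i not_poly_ring[OF i] not_acc_rid not_piecewise_domain
      by (auto simp: right_noetherian_iff left_noetherian_iff acc_lid_iff_acc_rid)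
  qed
qed

end
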